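(* Let $(A(n))_{n\in\mathbb{N}}$ be a stationary and ergodic sequence of random matrices with values in $\mathbb{R}_{\max}^{d\times d}$ such that $\max_{A_{ij}(0)\neq-\infty}A^+_{ij}(0)$ is integrable (the maximum over the pairs $(i,j)$ with $A_{ij}(0)\ne-\infty$, and $a^+=\max(a,0)$) and such that, for every $i\in\{1,\dots,d\}$, $$\mathbb{P}\left(A_{ii}(0)=-\infty\right)=0.$$ Then the limit of $\left(\frac1n y(n,0)\right)_n$ is given by $$\forall m\in\{1,\dots,K\},\quad \lim_n\frac1n y^{c_m}(n,0)=\gamma^{[m]}\mathbf{1}\quad\text{a.s.}$$ If the condition $\mathbb{P}(A_{ii}(0)=-\infty)=0$ is strengthened by demanding that $A_{ii}(0)$ is integrable for every $i$, then the sequence $\left(\frac1n x(n,0)\right)_n$ converges almost surely and its limit is given by $$\forall m\in\{1,\dots,K\},\quad \lim_n\frac1n x^{c_m}(n,0)=\gamma^{[m]}\mathbf{1}\quad\text{a.s.}$$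
   Context: Max-plus conventions. $\mathbb{R}_{\max}=\mathbb{R}\cup\{-\infty\}$ is the semi-ring with addition $\max$ and multiplication $+$. Products are max-plus: $(Ax)_i=\max_j(A_{ij}+x_j)$, $(AB)_{ij}=\max_k(A_{ik}+B_{kj})$. $0$ denotes the vector with all coordinates $0$ and $\mathbf{1}$ the vector with all coordinates $1$; $\gamma\mathbf 1$ is the vector with all coordinates equal to $\gamma\in\mathbb{R}_{\max}$. Limits are taken in $\mathbb{R}_{\max}=[-\infty,+\infty)$, so convergence to $-\infty$ is allowed. Sequences. $x(n,0):=A(n-1)A(n-2)\cdots A(0)\,0$. The stationary sequence is extended, up to a change of probability space, to a stationary sequence $(A(n))_{n\in\mathbb{Z}}$, and $y(n,0):=A(-1)A(-2)\cdots A(-n)\,0$. For $I\subset\{1,\dots,d\}$ and a vector $x$, $x^I:=(x_i)_{i\in I}$. Maximal Lyapunov exponent. For a stationary ergodic sequence of (square) random matrices $(M(n))$ with entries in $\mathbb{R}_{\max}$ (rows of $-\infty$ allowed) with $\max_{ij}M^+_{ij}(0)$ integrable, $\frac1n\max_{i,j}(M(n-1)\cdots M(0))_{ij}$ converges a.s. to a constant $\gamma(M)\in\mathbb{R}_{\max}$, the maximal Lyapunov exponent. Graph. $\mathcal{G}(A)$ is the directed graph with nodes $1,\dots,d$ and arcs the pairs $(i,j)$ with $\mathbb{P}(A_{ij}(0)\neq-\infty)>0$. Its strongly connected components are $c_1,\dots,c_K$. Write $m\rightarrow l$ if $m=l$ or there is a path in $\mathcal{G}(A)$ from a node of $c_m$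 to a node of $c_l$. For each $m$: $\gamma^{(m)}:=\gamma\big((A_{ij}(n))_{i,j\in c_m}\big)$; $E_m:=\{l: m\rightarrow l\}$; $\gamma^{[m]}:=\max_{l\in E_m}\gamma^{(l)}$. *)

theory Defs
  imports "HOL-Probability.Probability" "Graph_Theory.Digraph_Component"
begin

section \<open>Max-plus algebra\<close>

text \<open>
  The semiring of the max-plus reals is represented by the extended reals different from
  \<open>\<infinity>\<close>, so that max-plus multiplication is addition on \<^typ>\<open>ereal\<close>. All index sets in use
  are finite and nonempty, so every \<open>SUP\<close> over indices below is a maximum. A vector is a function
  on the index type and a matrix a function of two indices. The operations on matrices take the
  index set \<open>I\<close> as a parameter, because the diagonal blocks indexed by the components of a graph
  are multiplied as matrices in their own right.
\<close>

definition mp_one :: "'d \<Rightarrow> 'd \<Rightarrow> ereal" where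
  "mp_one i j = (if i = j then 0 else -\<infinity>)"

definition mp_mult :: "'d set \<Rightarrow> ('d \<Rightarrow> 'd \<Rightarrow> ereal) \<Rightarrow> ('d \<Rightarrow> 'd \<Rightarrow> ereal) \<Rightarrow> 'd \<Rightarrow> 'd \<Rightarrow> ereal" where
  "mp_mult I A B i j = (SUP k\<in>I. A i k + B k j)"

definition mp_apply :: "'d set \<Rightarrow> ('d \<Rightarrow> 'd \<Rightarrow> ereal) \<Rightarrow> ('d \<Rightarrow> ereal) \<Rightarrow> 'd \<Rightarrow> ereal" where
  "mp_apply I A x i = (SUP j\<in>I. A i j + x j)"

text \<open>\<open>mp_forward I A n = A(n-1) \<cdots> A(0)\<close> and \<open>mp_backward I A n = A(-1) \<cdots> A(-n)\<close>.\<close>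

fun mp_forward :: "'d set \<Rightarrow> (nat \<Rightarrow> 'd \<Rightarrow> 'd \<Rightarrow> ereal) \<Rightarrow> nat \<Rightarrow> 'd \<Rightarrow> 'd \<Rightarrow> ereal" where
  "mp_forward I A 0 = mp_one"
| "mp_forward I A (Suc n) = mp_mult I (A n) (mp_forward I A n)"

fun mp_backward :: "'d set \<Rightarrow> (int \<Rightarrow> 'd \<Rightarrow> 'd \<Rightarrow> ereal) \<Rightarrow> nat \<Rightarrow> 'd \<Rightarrow> 'd \<Rightarrow> ereal" where
  "mp_backward I A 0 = mp_one"
| "mp_backward I A (Suc n) = mp_mult I (mp_backward I A n) (A (- int (Suc n)))"

definition seq_x :: "(nat \<Rightarrow> 'd \<Rightarrow> 'd \<Rightarrow> ereal) \<Rightarrow> nat \<Rightarrow> 'd \<Rightarrow> ereal" where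
  "seq_x A n = mp_apply UNIV (mp_forward UNIV A n) (\<lambda>_. 0)"

definition seq_y :: "(int \<Rightarrow> 'd \<Rightarrow> 'd \<Rightarrow> ereal) \<Rightarrow> nat \<Rightarrow> 'd \<Rightarrow> ereal" where
  "seq_y A n = mp_apply UNIV (mp_backward UNIV A n) (\<lambda>_. 0)"

definition rmax_tendsto :: "(nat \<Rightarrow> ereal) \<Rightarrow> ereal \<Rightarrow> bool" where
  "rmax_tendsto u l \<longleftrightarrow> l \<noteq> \<infinity> \<and> u \<longlonglongrightarrow> l"


section \<open>Stationary and ergodic sequences\<close>

definition process_law :: "'a measure \<Rightarrow> ('i \<Rightarrow> 'a \<Rightarrow> 'b::topological_space) \<Rightarrow> ('i \<Rightarrow> 'b) measure" where
  "process_law M X = distr M (\<Pi>\<^sub>M n\<in>UNIV. borel) (\<lambda>\<omega> n. X n \<omega>)"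

text \<open>
  The index type is \<^typ>\<open>nat\<close> or \<^typ>\<open>int\<close>. For matrices of finite size, the Borel sets
  of the function space (with its product topology) are the product of the entrywise Borel sets.
\<close>

definition stationary_process ::
    "'a measure \<Rightarrow> ('i::semiring_1 \<Rightarrow> 'a \<Rightarrow> 'b::topological_space) \<Rightarrow> bool" where
  "stationary_process M X \<longleftrightarrow>
     (\<forall>n. X n \<in> borel_measurable M) \<and> process_law M (\<lambda>n. X (n + 1)) = process_law M X"

definition ergodic_process :: "'a measure \<Rightarrow> (nat \<Rightarrow> 'a \<Rightarrow> 'b::topological_space) \<Rightarrow> bool" where
  "ergodic_process M X \<longleftrightarrow>
     (\<forall>E \<in> sets (\<Pi>\<^sub>M n\<in>(UNIV :: nat set). (borel :: 'b measure)).
        (\<lambda>x n. x (n + 1)) -` E = E \<longrightarrow> \<P>(\<omega> in M. (\<lambda>n. X n \<omega>) \<in> E) \<in> {0, 1})"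

definition rmax_valued :: "'a measure \<Rightarrow> ('i \<Rightarrow> 'a \<Rightarrow> 'd \<Rightarrow> 'd \<Rightarrow> ereal) \<Rightarrow> bool" where
  "rmax_valued M A \<longleftrightarrow> (\<forall>n. \<forall>\<omega>\<in>space M. \<forall>i j. A n \<omega> i j \<noteq> \<infinity>)"

text \<open>
  A two-sided stationary extension of \<open>A\<close> lives on a probability space of its own; what ties it
  to \<open>A\<close> is that its part with nonnegative indices has the same law.
\<close>

definition stationary_extension ::
    "'a measure \<Rightarrow> (nat \<Rightarrow> 'a \<Rightarrow> 'd::finite \<Rightarrow> 'd \<Rightarrow> ereal) \<Rightarrow>
     'b measure \<Rightarrow> (int \<Rightarrow> 'b \<Rightarrow> 'd \<Rightarrow> 'd \<Rightarrow> ereal) \<Rightarrow> bool" where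
  "stationary_extension M A N B \<longleftrightarrow>
     prob_space N \<and> rmax_valued N B \<and> stationary_process N B \<and>
     process_law N (\<lambda>n::nat. B (int n)) = process_law M A"


section \<open>Lyapunov exponents and the graph of a random matrix\<close>

text \<open>
  The maximal Lyapunov exponent of the blocks of \<open>A\<close> with indices in \<open>I\<close>: the almost sure limit,
  which is a constant for a stationary and ergodic sequence whose positive part is integrable.
\<close>

definition max_lyapunov ::
    "'a measure \<Rightarrow> 'd set \<Rightarrow> (nat \<Rightarrow> 'a \<Rightarrow> 'd \<Rightarrow> 'd \<Rightarrow> ereal) \<Rightarrow> ereal" where
  "max_lyapunov M I A =
     (THE \<gamma>. AE \<omega> in M.
        rmax_tendsto
          (\<lambda>n. ereal (1 / real n) * (SUP i\<in>I. SUP j\<in>I. mp_forward I (\<lambda>k. A k \<omega>) n i j)) \<gamma>)"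

definition mp_graph ::
    "'a measure \<Rightarrow> (nat \<Rightarrow> 'a \<Rightarrow> 'd \<Rightarrow> 'd \<Rightarrow> ereal) \<Rightarrow> ('d, 'd \<times> 'd) pre_digraph" where
  "mp_graph M A =
     \<lparr> verts = UNIV, arcs = {(i, j). \<P>(\<omega> in M. A 0 \<omega> i j \<noteq> -\<infinity>) > 0}, tail = fst, head = snd \<rparr>"

text \<open>A component is identified with its set of nodes, so the components index themselves.\<close>

definition components_of :: "'a measure \<Rightarrow> (nat \<Rightarrow> 'a \<Rightarrow> 'd \<Rightarrow> 'd \<Rightarrow> ereal) \<Rightarrow> 'd set set" where
  "components_of M A = pre_digraph.sccs_verts (mp_graph M A)"

definition leads_to ::
    "'a measure \<Rightarrow> (nat \<Rightarrow> 'a \<Rightarrow> 'd \<Rightarrow> 'd \<Rightarrow> ereal) \<Rightarrow> 'd set \<Rightarrow> 'd set \<Rightarrow> bool" where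
  "leads_to M A c c' \<longleftrightarrow>
     c = c' \<or> (\<exists>u\<in>c. \<exists>v\<in>c'. u \<rightarrow>\<^sup>*\<^bsub>mp_graph M A\<^esub> v)"

definition component_exponent ::
    "'a measure \<Rightarrow> (nat \<Rightarrow> 'a \<Rightarrow> 'd \<Rightarrow> 'd \<Rightarrow> ereal) \<Rightarrow> 'd set \<Rightarrow> ereal" where
  "component_exponent M A c =
     (SUP c' \<in> {c' \<in> components_of M A. leads_to M A c c'}. max_lyapunov M c' A)"

end

theory Submission
  imports Defs
begin

text \<open>
  Katznelson and Weiss' proof of Kingman's theorem gives more than the limit: if
  \<open>liminf f\<^sub>n / n < q\<close>, then \<open>f\<close> over every window \<open>[s, s + m)\<close> of the orbit is at most
  \<open>q m + o(s + m)\<close>. Uniform bounds of this kind survive the concatenation of blocks of a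
  triangular matrix, since a path changes strongly connected component at most \<open>d\<close> times and
  single entries are \<open>o(n)\<close> from above; hence the growth rate out of a node is at most the largest
  exponent among the components it leads to. Conversely, thanks to the finite diagonal, once a
  product has a finite entry it stays finite, so that almost surely some window links a node to all
  of a component it leads to. For \<open>y\<close> this window is put at the outer end of the product, where it
  costs a constant; for \<open>x\<close> the most recent window of a fixed kind is \<open>o(n)\<close> away, and the time since
  then is spent on the integrable diagonal entry.

  The products defining \<open>y\<close> are, up to transposition, forward products of the reversed process.
  It is ergodic too, and has the same exponents because the products of length \<open>n\<close> have the same law.
\<close>

section \<open>Ergodic theorems\<close>

text \<open>Entries and exponents may be \<open>-\<infinity>\<close>, so an exponent is never
  handled as a number but only through the real slopes \<open>q\<close> on either side of it, with
  separate predicates for lower and upper bounds. The error \<epsilon> * (s + m) is small relative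
  to the right end of the window, not to its length. Along a single orbit, bad stretches of
  sublinear length occur arbitrarily late, so an error in \<open>m\<close> alone would be too much
  to ask for all \<open>s\<close>. It is also enough: the pieces into which a product up to time
  \<open>n\<close> is cut are windows that end by time \<open>n\<close>. A bound from time 0 only
  would be useless for the later pieces, because subadditivity does not allow an initial piece to be
  subtracted. The asymmetry between x and y comes from the side on which the fixed node sits. In x
  it is the row index, at the latest time, which moves with \<open>n\<close>; in y, after
  transposition, it is the column index, at time 0. A random but fixed time at which connections
  exist serves all large \<open>n\<close> in the second case, whereas in the first it has to be
  found anew close to \<open>n\<close>.\<close>

definition uniform_linear_upper :: "(nat \<Rightarrow> nat \<Rightarrow> ereal) \<Rightarrow> real \<Rightarrow> bool" where
  "uniform_linear_upper u q \<longleftrightarrow>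
     (\<forall>\<epsilon>::real>0. \<exists>C. \<forall>s m. u s m \<le> ereal (q * m + \<epsilon> * (s + m) + C))"

text \<open>There is no \<epsilon> here: the failure of this bound means that \<open>u\<close> falls
  below every line of slope \<open>q\<close>, which is the event on which \<open>dichotomy\<close>
  rests.\<close>

definition linear_lower :: "(nat \<Rightarrow> ereal) \<Rightarrow> real \<Rightarrow> bool" where
  "linear_lower u q \<longleftrightarrow> (\<exists>C. \<forall>n. ereal (q * n - C) \<le> u n)"

lemma linear_lower_mono: "linear_lower u q \<Longrightarrow> q' \<le> q \<Longrightarrow> linear_lower u q'"
  unfolding linear_lower_def
  by (meson diff_right_mono ereal_less_eq(3) mult_right_mono of_nat_0_le_iff order_trans)

text \<open>The instances are laws on path spaces with the shift. Taking the whole type as space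
  lets \<open>T\<close> be iterated without membership conditions.\<close>

locale ergodic_system = prob_space M for M :: "'a measure" +
  fixes T :: "'a \<Rightarrow> 'a"
  assumes space_UNIV: "space M = UNIV"
    and measurable_T [measurable]: "T \<in> measurable M M"
    and distr_T: "distr M M T = M"
    and ergodic: "E \<in> sets M \<Longrightarrow> T -` E = E \<Longrightarrow> prob E = 0 \<or> prob E = 1"
begin

lemma sets_vimage_T [measurable]: "E \<in> sets M \<Longrightarrow> T -` E \<in> sets M"
  using measurable_sets[OF measurable_T, of E] space_UNIV by simp

lemma prob_vimage_T: "E \<in> sets M \<Longrightarrow> prob (T -` E) = prob E"
  using measure_distr[OF measurable_T, of E] space_UNIV by (simp add: distr_T)

lemma AE_T: "AE x in M. P x \<Longrightarrow> AE x in M. P (T x)"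
  using AE_distrD[OF measurable_T, of P] unfolding distr_T .

lemma AE_funpow_T:
  assumes "AE x in M. P x"
  shows "AE x in M. \<forall>n. P ((T ^^ n) x)"
proof -
  have "AE x in M. P ((T ^^ n) x)" for n
  proof (induction n)
    case (Suc n)
    from AE_T[OF this] show ?case by (simp add: funpow_swap1)
  qed (use assms in simp)
  then show ?thesis by (simp add: AE_all_countable)
qed

lemma integrable_T:
  fixes f :: "'a \<Rightarrow> real"
  shows "integrable M f \<Longrightarrow> integrable M (\<lambda>x. f (T x))"
  by (rule integrable_distr[OF measurable_T]) (simp add: distr_T)

lemma integral_T:
  fixes f :: "'a \<Rightarrow> real"
  shows "integrable M f \<Longrightarrow> (\<integral>x. f (T x) \<partial>M) = (\<integral>x. f x \<partial>M)"
  using integral_distr[OF measurable_T, of f] by (simp add: distr_T)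

text \<open>The iterated preimages of \<open>E\<close> decrease and all have the measure of
  \<open>E\<close>; their intersection has the same measure and is strictly invariant.\<close>

lemma ergodic_subinvariant:
  assumes [measurable]: "E \<in> sets M" and sub: "T -` E \<subseteq> E"
  shows "prob E = 0 \<or> prob E = 1"
proof -
  define D where "D n = (T ^^ n) -` E" for n
  have D_Suc: "D (Suc n) = T -` D n" for n
    by (auto simp: D_def funpow_swap1)
  have sets_D: "D n \<in> sets M" for n
    by (induction n) (auto simp: D_Suc, simp add: D_def)
  have prob_D: "prob (D n) = prob E" for n
    by (induction n) (auto simp: D_Suc prob_vimage_T sets_D, simp add: D_def)
  have dec: "D (Suc n) \<subseteq> D n" for n
    using sub by (auto simp: D_def)
  then have "decseq D" by (rule decseq_SucI)
  then have "(\<lambda>n. prob (D n)) \<longlonglongrightarrow> prob (\<Inter>n. D n)"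
    using sets_D by (intro finite_Lim_measure_decseq) auto
  then have "prob (\<Inter>n. D n) = prob E"
    by (simp add: prob_D LIMSEQ_const_iff)
  moreover have "T -` (\<Inter>n. D n) = (\<Inter>n. D n)"
  proof -
    have "T -` (\<Inter>n. D n) = (\<Inter>n. D (Suc n))" by (auto simp: D_Suc)
    also have "\<dots> = (\<Inter>n. D n)" using dec by auto
    finally show ?thesis .
  qed
  moreover have "(\<Inter>n. D n) \<in> sets M" using sets_D by auto
  ultimately show ?thesis using ergodic by metis
qed

text \<open>The maximum of the Birkhoff sums with 0, ..., \<open>n\<close> terms, as in the maximal
  ergodic theorem; the recursion splits off the first term of the orbit.\<close>

fun max_partial_sum :: "('a \<Rightarrow> real) \<Rightarrow> nat \<Rightarrow> 'a \<Rightarrow> real" where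
  "max_partial_sum g 0 x = 0"
| "max_partial_sum g (Suc n) x = max 0 (g x + max_partial_sum g n (T x))"

lemma sum_funpow_Suc:
  fixes g :: "'a \<Rightarrow> real"
  shows "(\<Sum>k<Suc n. g ((T ^^ k) x)) = g x + (\<Sum>k<n. g ((T ^^ k) (T x)))"
  by (simp add: sum.lessThan_Suc_shift funpow_swap1 del: sum.lessThan_Suc)

lemma partial_sum_le_max: "(\<Sum>k<n. g ((T ^^ k) x)) \<le> max_partial_sum g n x"
proof (induction n arbitrary: x)
  case (Suc n)
  show ?case unfolding sum_funpow_Suc max_partial_sum.simps
    by (rule max.coboundedI2) (rule add_left_mono[OF Suc])
qed simp

lemma max_partial_sum_nonneg: "0 \<le> max_partial_sum g n x"
  by (cases n) auto

lemma max_partial_sum_mono: "max_partial_sum g n x \<le> max_partial_sum g (Suc n) x"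
proof (induction n arbitrary: x)
  case (Suc n)
  show ?case unfolding max_partial_sum.simps(2)[of g _ x]
    by (rule max.mono[OF order_refl add_left_mono[OF Suc]])
qed simp

lemma integrable_max_partial_sum: "integrable M g \<Longrightarrow> integrable M (max_partial_sum g n)"
proof (induction n)
  case (Suc n)
  then show ?case
    using integrable_T[of "max_partial_sum g n"] unfolding max_partial_sum.simps(2)[abs_def]
    by (intro integrable_max Bochner_Integration.integrable_add) auto
qed (simp add: max_partial_sum.simps(1)[abs_def])

text \<open>On the complement of the invariant set where the maximal partial sums \<open>S\<^sub>n\<close> are bounded,
  \<open>S\<^sub>n\<close> tends to infinity, so \<open>S\<^sub>n\<^sub>+\<^sub>1 - S\<^sub>n \<circ> T = max (- S\<^sub>n \<circ> T) g\<close> tends to \<open>g\<close>, while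
  its integral is nonnegative because \<open>S\<^sub>n\<close> is increasing.\<close>

lemma partial_sums_bounded:
  fixes g :: "'a \<Rightarrow> real"
  assumes g: "integrable M g" and neg: "(\<integral>x. g x \<partial>M) < 0"
  shows "AE x in M. \<exists>C. \<forall>n. (\<Sum>k<n. g ((T ^^ k) x)) \<le> C"
proof -
  let ?S = "max_partial_sum g"
  define E where "E = {x. \<exists>C::nat. \<forall>n. ?S n x \<le> real C}"
  have [measurable]: "?S n \<in> borel_measurable M" for n
    using integrable_max_partial_sum[OF g] by blast
  have "{x \<in> space M. \<exists>C::nat. \<forall>n. ?S n x \<le> real C} \<in> sets M" by measurable
  then have E [measurable]: "E \<in> sets M" by (simp add: E_def space_UNIV)
  have Eiff: "x \<in> E \<longleftrightarrow> (\<exists>C. \<forall>n. ?S n x \<le> C)" for x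
  proof
    assume "\<exists>C. \<forall>n. ?S n x \<le> C"
    then obtain C where "\<And>n. ?S n x \<le> C" by auto
    then have "?S n x \<le> real (nat \<lceil>C\<rceil>)" for n
      using real_nat_ceiling_ge[of C] order_trans by blast
    then show "x \<in> E" unfolding E_def by blast
  qed (auto simp: E_def)
  have "T -` E = E"
  proof (intro set_eqI iffI)
    fix x assume "x \<in> T -` E"
    then obtain C where C: "\<And>n. ?S n (T x) \<le> C" by (auto simp: Eiff)
    have "?S n x \<le> max 0 (g x + C)" for n
    proof (cases n)
      case (Suc m)
      then show ?thesis using C[of m] by (simp add: le_max_iff_disj) linarith
    qed simp
    then show "x \<in> E" unfolding Eiff by blast
  next
    fix x assume "x \<in> E"
    then obtain C where "\<And>n. ?S n x \<le> C" by (auto simp: Eiff)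
    then have "?S (Suc n) x \<le> C" for n by blast
    then have "?S n (T x) \<le> C - g x" for n by (simp add: algebra_simps)
    then show "x \<in> T -` E" by (auto simp: Eiff)
  qed
  then consider "prob E = 1" | "prob E = 0" using ergodic[OF E] by auto
  then show ?thesis
  proof cases
    case 1
    then have "AE x in M. x \<in> E" by (simp add: prob_eq_1 E)
    then show ?thesis
    proof eventually_elim
      case (elim x)
      then obtain C where C: "\<And>n. ?S n x \<le> C" by (auto simp: Eiff)
      show ?case using order_trans[OF partial_sum_le_max C] by blast
    qed
  next
    case 2
    then have "AE x in M. x \<notin> E" using prob_eq_0[OF E] by simp
    from AE_T[OF this] have nE: "AE x in M. T x \<notin> E" .
    have lim: "(\<lambda>n. \<integral>x. max (- ?S n (T x)) (g x) \<partial>M) \<longlonglongrightarrow> (\<integral>x. g x \<partial>M)"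
    proof (rule integral_dominated_convergence[where w = "\<lambda>x. \<bar>g x\<bar>"])
      show "AE x in M. (\<lambda>n. max (- ?S n (T x)) (g x)) \<longlonglongrightarrow> g x"
        using nE
      proof eventually_elim
        case (elim x)
        then obtain n0 where n0: "?S n0 (T x) > - g x" unfolding Eiff using not_less by blast
        have "max (- ?S n (T x)) (g x) = g x" if "n0 \<le> n" for n
          using lift_Suc_mono_le[of "\<lambda>n. ?S n (T x)", OF max_partial_sum_mono that] n0 by simp
        then show ?case by (intro tendsto_eventually) (auto simp: eventually_at_top_linorder)
      qed
      show "AE x in M. norm (max (- ?S n (T x)) (g x)) \<le> \<bar>g x\<bar>" for n
      proof (rule AE_I2)
        fix x
        have "max (- s) r \<le> \<bar>r\<bar> \<and> - \<bar>r\<bar> \<le> max (- s) r" if "0 \<le> s" for s r :: real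
          using that by linarith
        from this[OF max_partial_sum_nonneg[of g n "T x"], of "g x"]
        show "norm (max (- ?S n (T x)) (g x)) \<le> \<bar>g x\<bar>" unfolding real_norm_def by linarith
      qed
    qed (use g in auto)
    have "0 \<le> (\<integral>x. max (- ?S n (T x)) (g x) \<partial>M)" for n
    proof -
      have eq: "max (- ?S n (T x)) (g x) = ?S (Suc n) x - ?S n (T x)" for x by simp
      have i: "integrable M (?S n)" for n by (rule integrable_max_partial_sum[OF g])
      have "(\<integral>x. max (- ?S n (T x)) (g x) \<partial>M) = (\<integral>x. ?S (Suc n) x \<partial>M) - (\<integral>x. ?S n (T x) \<partial>M)"
        unfolding eq by (rule Bochner_Integration.integral_diff[OF i integrable_T[OF i]])
      also have "(\<integral>x. ?S n (T x) \<partial>M) = (\<integral>x. ?S n x \<partial>M)" by (rule integral_T[OF i])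
      finally show ?thesis
        using integral_mono[OF i i max_partial_sum_mono, of n] by linarith
    qed
    then have "0 \<le> (\<integral>x. g x \<partial>M)" by (intro LIMSEQ_le_const[OF lim]) blast
    with neg show ?thesis by simp
  qed
qed

text \<open>Subtracting the mean and a little more makes the integral negative, so that
  \<open>partial_sums_bounded\<close> applies; doing this to \<open>g\<close> and to its negative
  gives both sides. The margins 1 / (m + 1) keep the exceptional null set independent of \<epsilon>.
  A bound valid for every \<open>n\<close>, instead of a limit, can be subtracted between two times,
  which is how sums over windows are estimated later.\<close>

theorem birkhoff:
  fixes g :: "'a \<Rightarrow> real"
  assumes g: "integrable M g"
  shows "AE x in M. \<forall>\<epsilon>::real>0. \<exists>C. \<forall>n. \<bar>(\<Sum>k<n. g ((T ^^ k) x)) - n * (\<integral>x. g x \<partial>M)\<bar> \<le> \<epsilon> * n + C"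
proof -
  let ?I = "\<integral>x. g x \<partial>M"
  have "AE x in M. \<forall>m::nat. (\<exists>C. \<forall>n. (\<Sum>k<n. g ((T ^^ k) x) - ?I - 1 / Suc m) \<le> C) \<and>
      (\<exists>C. \<forall>n. (\<Sum>k<n. ?I - g ((T ^^ k) x) - 1 / Suc m) \<le> C)" (is "AE x in M. \<forall>m. ?P m x")
    unfolding AE_all_countable
  proof
    fix m :: nat
    have "AE x in M. \<exists>C. \<forall>n. (\<Sum>k<n. g ((T ^^ k) x) - ?I - 1 / Suc m) \<le> C"
      by (rule partial_sums_bounded) (use g in \<open>auto simp: prob_space\<close>)
    moreover have "AE x in M. \<exists>C. \<forall>n. (\<Sum>k<n. ?I - g ((T ^^ k) x) - 1 / Suc m) \<le> C"
      by (rule partial_sums_bounded) (use g in \<open>auto simp: prob_space\<close>)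
    ultimately show "AE x in M. ?P m x" by eventually_elim blast
  qed
  then show ?thesis
  proof eventually_elim
    case (elim x)
    show ?case
    proof (intro allI impI)
      fix \<epsilon> :: real assume "\<epsilon> > 0"
      then obtain m where m: "1 / Suc m < \<epsilon>" using nat_approx_posE by blast
      let ?S = "\<lambda>n. \<Sum>k<n. g ((T ^^ k) x)"
      from elim obtain C D where
        "\<And>n. (\<Sum>k<n. g ((T ^^ k) x) - ?I - 1 / Suc m) \<le> C"
        "\<And>n. (\<Sum>k<n. ?I - g ((T ^^ k) x) - 1 / Suc m) \<le> D" by blast
      then have CD: "?S n - n * ?I - n * (1 / Suc m) \<le> C" "n * ?I - ?S n - n * (1 / Suc m) \<le> D" for n
        unfolding sum_subtractf sum_constant card_lessThan by auto
      have "\<bar>?S n - n * ?I\<bar> \<le> \<epsilon> * n + max C D" for n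
      proof -
        have "n * (1 / Suc m) \<le> \<epsilon> * n" using mult_left_mono[OF less_imp_le[OF m], of "real n"]
          by (simp add: mult.commute)
        with CD[of n] show ?thesis by linarith
      qed
      then show "\<exists>C. \<forall>n. \<bar>?S n - n * ?I\<bar> \<le> \<epsilon> * n + C" by blast
    qed
  qed
qed

lemma sum_funpow_add:
  fixes g :: "'a \<Rightarrow> real"
  shows "(\<Sum>k<n + m. g ((T ^^ k) x)) = (\<Sum>k<n. g ((T ^^ k) x)) + (\<Sum>k<m. g ((T ^^ k) ((T ^^ n) x)))"
proof -
  have "(\<Sum>k<n + m. g ((T ^^ k) x)) = (\<Sum>k<n. g ((T ^^ k) x)) + (\<Sum>k=n..<n + m. g ((T ^^ k) x))"
    by (simp add: lessThan_atLeast0 sum.atLeastLessThan_concat)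
  also have "(\<Sum>k=n..<n + m. g ((T ^^ k) x)) = (\<Sum>k=0..<m. g ((T ^^ (k + n)) x))"
    using sum.shift_bounds_nat_ivl[of "\<lambda>k. g ((T ^^ k) x)" 0 n m] by (simp add: add.commute)
  finally show ?thesis by (simp add: lessThan_atLeast0 funpow_add)
qed

text \<open>A single term is the difference of two consecutive Birkhoff sums, whose main parts
  differ by the mean only.\<close>

lemma orbit_sublinear:
  fixes g :: "'a \<Rightarrow> real"
  assumes "integrable M g"
  shows "AE x in M. \<forall>\<epsilon>::real>0. \<exists>C. \<forall>k. \<bar>g ((T ^^ k) x)\<bar> \<le> \<epsilon> * k + C"
  using birkhoff[OF assms]
proof eventually_elim
  case (elim x)
  let ?I = "\<integral>x. g x \<partial>M"
  show ?case
  proof (intro allI impI)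
    fix \<epsilon> :: real assume "\<epsilon> > 0"
    then obtain C where C: "\<And>n. \<bar>(\<Sum>k<n. g ((T ^^ k) x)) - n * ?I\<bar> \<le> \<epsilon> / 2 * n + C"
      using elim by (meson half_gt_zero)
    have "\<bar>g ((T ^^ k) x)\<bar> \<le> \<epsilon> * k + (\<bar>?I\<bar> + \<epsilon> / 2 + 2 * C)" for k
    proof -
      have "Suc k * ?I = k * ?I + ?I" "\<epsilon> / 2 * Suc k = \<epsilon> / 2 * k + \<epsilon> / 2" "\<epsilon> * k = 2 * (\<epsilon> / 2 * k)"
        by (simp_all add: field_simps)
      with C[of k] C[of "Suc k"] show ?thesis
        unfolding sum.lessThan_Suc by linarith
    qed
    then show "\<exists>C. \<forall>k. \<bar>g ((T ^^ k) x)\<bar> \<le> \<epsilon> * k + C" by blast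
  qed
qed

lemma AE_ex: "AE x in M. P x \<Longrightarrow> \<exists>x. P x"
  using eventually_happens'[OF ae_filter_bot] by blast

end

section \<open>Kingman's theorem for subadditive processes whose first step is dominated by an
  integrable function\<close>

locale subadditive_process = ergodic_system M T for M :: "'a measure" and T +
  fixes f :: "nat \<Rightarrow> 'a \<Rightarrow> ereal" and W :: "'a \<Rightarrow> real"
  assumes measurable_f [measurable]: "f n \<in> borel_measurable M"
    and f_0: "f 0 x = 0"
    and subadditive: "f (n + m) x \<le> f n x + f m ((T ^^ n) x)"
    and f_1_le: "f 1 x \<le> ereal (W x)"
    and W_nonneg: "0 \<le> W x"
    and integrable_W [measurable]: "integrable M W"
begin

lemma step_le:
  assumes "f n x \<le> ereal a" "f m ((T ^^ n) x) \<le> ereal b"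
  shows "f (n + m) x \<le> ereal (a + b)"
  using order_trans[OF subadditive add_mono[OF assms]] by simp

lemma f_le_sum: "f n x \<le> ereal (\<Sum>k<n. W ((T ^^ k) x))"
proof (induction n arbitrary: x)
  case (Suc n)
  have "f (1 + n) x \<le> ereal (W x + (\<Sum>k<n. W ((T ^^ k) (T x))))"
    by (rule step_le) (use f_1_le Suc in auto)
  then show ?case by (simp add: sum_funpow_Suc del: sum.lessThan_Suc)
qed (simp add: f_0)

text \<open>Katznelson and Weiss: cut the orbit into blocks of length at most \<open>K\<close> on which
  \<open>f\<close> is below slope \<open>q\<close>, and into single steps at the bad points.\<close>

definition bad_points :: "real \<Rightarrow> nat \<Rightarrow> 'a set" where
  "bad_points q K = {x. \<forall>n\<in>{1..K}. ereal (q * n) < f n x}"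

text \<open>The price charged at each point of the orbit. At a bad point it has to cover the single
  step \<open>W\<close>, and it must also be at least \<open>q\<close>, because a block that starts
  at a good point may run over bad ones; adding \<open>W x + \<bar>q\<bar>\<close> to
  \<open>q\<close> does both.\<close>

definition step_weight :: "real \<Rightarrow> nat \<Rightarrow> 'a \<Rightarrow> real" where
  "step_weight q K x = q + (W x + \<bar>q\<bar>) * indicator (bad_points q K) x"

lemma sets_bad_points [measurable]: "bad_points q K \<in> sets M"
proof -
  have "{x \<in> space M. \<forall>n\<in>{1..K}. ereal (q * n) < f n x} \<in> sets M" by measurable
  then show ?thesis by (simp add: bad_points_def space_UNIV)
qed

text \<open>Induction on the length, splitting off the first block or the first single step. Only a
  last block that sticks out of the orbit segment cannot be used; it starts among the last
  \<open>K\<close> points, and the second sum pays for these by single steps, with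
  \<open>\<bar>q\<bar>\<close> compensating weights that may be negative.\<close>

lemma f_le_step_weight_sum:
  fixes q :: real
  shows
  "f m x \<le> ereal ((\<Sum>k<m. step_weight q K ((T ^^ k) x)) + (\<Sum>k=m-K..<m. W ((T ^^ k) x) + \<bar>q\<bar>))"
proof (induction m arbitrary: x rule: less_induct)
  case (less m)
  let ?g = "step_weight q K"
  let ?h = "\<lambda>x. W x + \<bar>q\<bar>"
  have g_ge: "q \<le> ?g x" "W x \<le> ?g x + ?h x" for x
    using W_nonneg[of x] by (auto simp: step_weight_def indicator_def)
  have step: ?case if n: "1 \<le> n" "n \<le> m" and le: "f n x \<le> ereal (\<Sum>k<n. ?g ((T ^^ k) x))" for n
  proof -
    let ?y = "(T ^^ n) x"
    have "f (n + (m - n)) x \<le> ereal ((\<Sum>k<n. ?g ((T ^^ k) x)) +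
        ((\<Sum>k<m-n. ?g ((T ^^ k) ?y)) + (\<Sum>k=m-n-K..<m-n. ?h ((T ^^ k) ?y))))"
      by (rule step_le[OF le less.IH]) (use n in auto)
    also have "\<dots> \<le> ereal ((\<Sum>k<n + (m - n). ?g ((T ^^ k) x)) + (\<Sum>k=m-K..<m. ?h ((T ^^ k) x)))"
    proof -
      have "(\<Sum>k=m-n-K..<m-n. ?h ((T ^^ k) ?y)) = (\<Sum>k=m-n-K..<m-n. ?h ((T ^^ (k + n)) x))"
        by (simp add: funpow_add)
      also have "\<dots> = (\<Sum>k=m-n-K+n..<m-n+n. ?h ((T ^^ k) x))"
        by (rule sum.shift_bounds_nat_ivl[symmetric])
      \<comment> \<open>With truncated subtraction the shifted range starts at the larger of
        \<open>n\<close> and \<open>m - K\<close>, so there is an inclusion of ranges but in general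
        no equality.\<close>
      also have "\<dots> \<le> (\<Sum>k=m-K..<m. ?h ((T ^^ k) x))"
        by (rule sum_mono2) (use n W_nonneg in auto)
      finally show ?thesis by (simp add: sum_funpow_add)
    qed
    finally show ?thesis using n by simp
  qed
  show ?case
  proof (cases "m = 0")
    case False
    show ?thesis
    proof (cases "x \<in> bad_points q K")
      case True
      have "W x \<le> ?g x" using True by (simp add: step_weight_def)
      then have "f 1 x \<le> ereal (\<Sum>k<1. ?g ((T ^^ k) x))"
        using order_trans[OF f_1_le[of x]] by simp
      then show ?thesis using False by (intro step[of 1]) auto
    next
      case False
      then obtain n where n: "1 \<le> n" "n \<le> K" "f n x \<le> ereal (q * n)"
        by (auto simp: bad_points_def not_less)
      show ?thesis
      proof (cases "n \<le> m")
        case True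
        have "q * n \<le> (\<Sum>k<n. ?g ((T ^^ k) x))"
          using sum_mono[of "{..<n}" "\<lambda>_. q" "\<lambda>k. ?g ((T ^^ k) x)"] g_ge(1)
          by (simp add: mult.commute)
        then have "f n x \<le> ereal (\<Sum>k<n. ?g ((T ^^ k) x))"
          using order_trans[OF n(3)] by simp
        with n True show ?thesis by (intro step)
      next
        case False
        \<comment> \<open>The block overshoots: \<open>m < n\<close> and \<open>n \<le> K\<close>,
          so the final range is the whole segment and single steps can be used throughout.\<close>
        with n have "{m-K..<m} = {..<m}" by auto
        moreover have "(\<Sum>k<m. W ((T ^^ k) x)) \<le> (\<Sum>k<m. ?g ((T ^^ k) x) + ?h ((T ^^ k) x))"
          by (rule sum_mono) (rule g_ge)
        ultimately have "ereal (\<Sum>k<m. W ((T ^^ k) x)) \<le>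
            ereal ((\<Sum>k<m. ?g ((T ^^ k) x)) + (\<Sum>k=m-K..<m. ?h ((T ^^ k) x)))"
          by (simp only: sum.distrib ereal_less_eq)
        with f_le_sum show ?thesis by (rule order_trans)
      qed
    qed
  qed (simp add: f_0)
qed

text \<open>The mean of \<open>step_weight q K\<close> is \<open>q\<close> plus the integral of
  \<open>W + \<bar>q\<bar>\<close> over the bad points, which tends to 0 as \<open>K\<close> grows,
  since almost every point becomes good. Birkhoff's theorem controls the sum of weights over a
  window, and sublinearity along the orbit controls the last \<open>K\<close> points.\<close>

lemma uniform_upper_of_frequently_below:
  fixes q :: real
  assumes "AE x in M. \<exists>n\<ge>1. f n x \<le> ereal (q * n)"
  shows "AE x in M. uniform_linear_upper (\<lambda>s m. f m ((T ^^ s) x)) q"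
proof -
  let ?h = "\<lambda>x. W x + \<bar>q\<bar>"
  have h: "integrable M ?h" using integrable_W by simp
  define \<delta> where "\<delta> K = (\<integral>x. ?h x * indicator (bad_points q K) x \<partial>M)" for K
  have hB: "integrable M (\<lambda>x. ?h x * indicator (bad_points q K) x)" for K
    using integrable_real_mult_indicator[OF sets_bad_points h] by (simp add: mult.commute)
  then have g: "integrable M (step_weight q K)" for K
    unfolding step_weight_def[abs_def] by simp
  have int_g: "(\<integral>x. step_weight q K x \<partial>M) = q + \<delta> K" for K
    unfolding step_weight_def \<delta>_def using hB[of K] by (simp add: prob_space)
  have "\<delta> \<longlonglongrightarrow> (\<integral>x. 0 \<partial>M)"
    unfolding \<delta>_def
  proof (rule integral_dominated_convergence[where w = ?h])
    show "AE x in M. (\<lambda>K. ?h x * indicator (bad_points q K) x) \<longlonglongrightarrow> 0"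
      using assms
    proof eventually_elim
      case (elim x)
      then obtain n where n: "n \<ge> 1" "f n x \<le> ereal (q * n)" by blast
      then have "x \<notin> bad_points q K" if "K \<ge> n" for K
        using that by (auto simp: bad_points_def intro!: bexI[of _ n])
      then have "?h x * indicator (bad_points q K) x = 0" if "K \<ge> n" for K
        using that by simp
      then show ?case by (intro tendsto_eventually) (auto simp: eventually_at_top_linorder)
    qed
    show "AE x in M. norm (?h x * indicator (bad_points q K) x) \<le> ?h x" for K
      using W_nonneg by (auto intro!: AE_I2 simp: indicator_def)
  qed (use h hB in auto)
  then have \<delta>: "\<delta> \<longlonglongrightarrow> 0" by simp
  have "AE x in M. \<forall>K. \<forall>\<epsilon>::real>0. \<exists>C. \<forall>n.
      \<bar>(\<Sum>k<n. step_weight q K ((T ^^ k) x)) - n * (q + \<delta> K)\<bar> \<le> \<epsilon> * n + C"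
    unfolding AE_all_countable using birkhoff[OF g] by (simp add: int_g)
  then show ?thesis using orbit_sublinear[OF h]
  proof eventually_elim
    case (elim x)
    show ?case unfolding uniform_linear_upper_def
    proof (intro allI impI)
      fix \<epsilon> :: real assume \<epsilon>: "\<epsilon> > 0"
      then obtain K where K: "\<delta> K < \<epsilon> / 4"
        using order_tendstoD(2)[OF \<delta>, of "\<epsilon> / 4"] by (auto simp: eventually_at_top_linorder)
      \<comment> \<open>At most \<open>K\<close> boundary terms occur, each up to e * (s + m) + D;
        together they may use a quarter of the error.\<close>
      define e where "e = \<epsilon> / (4 * (real K + 1))"
      have e: "e > 0" "K * e \<le> \<epsilon> / 4" using \<epsilon> by (auto simp: e_def field_simps)
      \<comment> \<open>The sum over the window is a difference of Birkhoff sums at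
        \<open>s + m\<close> and at \<open>s\<close>, hence an eighth for each and the constant
        \<open>2 * C\<close>.\<close>
      obtain C where C: "\<And>n. \<bar>(\<Sum>k<n. step_weight q K ((T ^^ k) x)) - n * (q + \<delta> K)\<bar> \<le> \<epsilon> / 8 * n + C"
        using elim(1) \<epsilon> by (meson divide_pos_pos zero_less_numeral)
      obtain D where D: "\<And>k. \<bar>?h ((T ^^ k) x)\<bar> \<le> e * k + D"
        using elim(2) e by meson
      have D0: "0 \<le> D" using D[of 0] by simp
      have "f m ((T ^^ s) x) \<le> ereal (q * m + \<epsilon> * (s + m) + (2 * C + K * D))" for s m :: nat
      proof -
        let ?y = "(T ^^ s) x"
        have 1: "(\<Sum>k<m. step_weight q K ((T ^^ k) ?y)) \<le> m * (q + \<delta> K) + \<epsilon> / 4 * (s + m) + 2 * C"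
        proof -
          have "\<epsilon> * m \<ge> 0" using \<epsilon> by simp
          then show ?thesis
            using C[of s] C[of "s + m"] sum_funpow_add[of "step_weight q K" x s m]
            by (simp add: abs_le_iff algebra_simps add_divide_distrib)
        qed
        have "(\<Sum>k=m-K..<m. ?h ((T ^^ k) ?y)) \<le> (\<Sum>k=m-K..<m. e * (s + m) + D)"
        proof (rule sum_mono)
          fix k assume "k \<in> {m-K..<m}"
          then have "e * (k + s) \<le> e * (s + m)" using e by (intro mult_left_mono) auto
          then show "?h ((T ^^ k) ?y) \<le> e * (s + m) + D"
            using D[of "k + s"] by (simp add: funpow_add)
        qed
        also have "\<dots> = real (m - (m - K)) * (e * (s + m) + D)" by simp
        also have "\<dots> \<le> K * (e * (s + m) + D)"
          using e D0 by (intro mult_right_mono) auto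
        also have "\<dots> = (K * e) * (s + m) + K * D" by (simp add: algebra_simps)
        also have "\<dots> \<le> \<epsilon> / 4 * (s + m) + K * D"
          using e(2) by (intro add_right_mono mult_right_mono) auto
        finally have 2: "(\<Sum>k=m-K..<m. ?h ((T ^^ k) ?y)) \<le> \<epsilon> / 4 * (s + m) + K * D" .
        have 3: "m * \<delta> K \<le> \<epsilon> / 4 * (s + m)"
        proof -
          have "m * \<delta> K \<le> m * (\<epsilon> / 4)" using K by (intro mult_left_mono) auto
          also have "\<dots> \<le> (s + m) * (\<epsilon> / 4)" using \<epsilon> by (intro mult_right_mono) auto
          finally show ?thesis by (simp add: mult.commute)
        qed
        have 4: "0 \<le> \<epsilon> / 4 * (s + m)" using \<epsilon> by simp
        have "(\<Sum>k<m. step_weight q K ((T ^^ k) ?y)) + (\<Sum>k=m-K..<m. ?h ((T ^^ k) ?y))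
            \<le> q * m + \<epsilon> * (s + m) + (2 * C + K * D)"
        proof -
          have "m * (q + \<delta> K) = q * m + m * \<delta> K" "\<epsilon> * (s + m) = 4 * (\<epsilon> / 4 * (s + m))"
            by (simp_all add: algebra_simps)
          with 1 2 3 4 show ?thesis by linarith
        qed
        then show ?thesis using order_trans[OF f_le_step_weight_sum[of m ?y q K]] by simp
      qed
      then show "\<exists>C. \<forall>s m. f m ((T ^^ s) x) \<le> ereal (q * m + \<epsilon> * (s + m) + C)" by blast
    qed
  qed
qed

text \<open>Prepending one step costs at most \<open>W x\<close> plus a change of line by
  \<open>q\<close>, so falling below all lines of slope \<open>q\<close> at \<open>T x\<close>
  implies the same at \<open>x\<close>. Subadditivity gives this one inclusion, and
  \<open>ergodic_subinvariant\<close> makes it suffice for a zero-one law.\<close>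

lemma dichotomy:
  fixes q :: real
  shows
  "(AE x in M. linear_lower (\<lambda>n. f n x) q) \<or>
   (AE x in M. uniform_linear_upper (\<lambda>s m. f m ((T ^^ s) x)) q)"
proof -
  define G where "G = {x. \<forall>C::nat. \<exists>n. f n x \<le> ereal (q * n - C)}"
  have "{x \<in> space M. \<forall>C::nat. \<exists>n. f n x \<le> ereal (q * n - C)} \<in> sets M" by measurable
  then have G: "G \<in> sets M" by (simp add: G_def space_UNIV)
  have "T -` G \<subseteq> G"
  proof
    fix x assume "x \<in> T -` G"
    then have x: "\<exists>n. f n (T x) \<le> ereal (q * n - real C)" for C :: nat by (simp add: G_def)
    have "\<exists>n. f n x \<le> ereal (q * n - real C)" for C :: nat
    proof -
      obtain C' :: nat where C': "C + W x + \<bar>q\<bar> \<le> C'" using real_arch_simple by blast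
      obtain n where n: "f n (T x) \<le> ereal (q * n - C')" using x by blast
      have "f (1 + n) x \<le> ereal (W x + (q * n - C'))"
        by (rule step_le) (use f_1_le n in auto)
      also have "\<dots> \<le> ereal (q * real (1 + n) - C)"
        using C' by (simp add: algebra_simps)
      finally show ?thesis by blast
    qed
    then show "x \<in> G" by (simp add: G_def)
  qed
  then consider "prob G = 0" | "prob G = 1" using ergodic_subinvariant[OF G] by blast
  then show ?thesis
  proof cases
    case 1
    then have "AE x in M. x \<notin> G" using prob_eq_0[OF G] by simp
    then have "AE x in M. linear_lower (\<lambda>n. f n x) q"
      by eventually_elim (auto simp: G_def linear_lower_def not_le intro: less_imp_le)
    then show ?thesis ..
  next
    case 2
    then have "AE x in M. x \<in> G" by (simp add: prob_eq_1 G)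
    then have "AE x in M. \<exists>n\<ge>1. f n x \<le> ereal (q * n)"
    proof eventually_elim
      case (elim x)
      \<comment> \<open>The constant 1 rules out \<open>n = 0\<close>, where \<open>f\<close>
        vanishes.\<close>
      then obtain n where n: "f n x \<le> ereal (q * n - real 1)" unfolding G_def by blast
      then have "n \<noteq> 0" using f_0[of x] by (auto intro: ccontr)
      moreover have "f n x \<le> ereal (q * n)" using order_trans[OF n] by simp
      ultimately show ?case by (intro exI[of _ n]) auto
    qed
    from uniform_upper_of_frequently_below[OF this] show ?thesis ..
  qed
qed

text \<open>The constant is the supremum of the slopes that are almost sure lower bounds; above it
  the dichotomy leaves only the upper bound. An empty supremum is the case
  \<open>\<gamma> = -\<infinity>\<close>, and domination by the sums of \<open>W\<close> excludes
  \<open>\<infinity>\<close>.\<close>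

theorem kingman:
  obtains \<gamma> where "\<gamma> \<noteq> \<infinity>"
    and "\<And>q. ereal q < \<gamma> \<Longrightarrow> AE x in M. linear_lower (\<lambda>n. f n x) q"
    and "\<And>q. \<gamma> < ereal q \<Longrightarrow> AE x in M. uniform_linear_upper (\<lambda>s m. f m ((T ^^ s) x)) q"
proof
  let ?L = "\<lambda>q. AE x in M. linear_lower (\<lambda>n. f n x) q"
  let ?\<gamma> = "SUP q \<in> Collect ?L. ereal q"
  let ?I = "\<integral>x. W x \<partial>M"
  have "q \<le> ?I + 1" if Lq: "?L q" for q
  proof (rule ccontr)
    assume q: "\<not> q \<le> ?I + 1"
    obtain x where x: "linear_lower (\<lambda>n. f n x) q"
      "\<forall>\<epsilon>>0. \<exists>C. \<forall>n. \<bar>(\<Sum>k<n. W ((T ^^ k) x)) - n * ?I\<bar> \<le> \<epsilon> * n + C"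
      using AE_ex[OF eventually_conj[OF Lq birkhoff[OF integrable_W]]] by auto
    obtain C where C: "\<And>n. ereal (q * n - C) \<le> f n x" using x(1) by (auto simp: linear_lower_def)
    \<comment> \<open>The choice \<epsilon> = 1 is crude, and it is the origin of the summand 1 in
      \<open>?I + 1\<close>.\<close>
    obtain D where D: "\<And>n. \<bar>(\<Sum>k<n. W ((T ^^ k) x)) - n * ?I\<bar> \<le> 1 * real n + D"
      using x(2) zero_less_one by blast
    have "real n * (q - ?I - 1) \<le> C + D" for n
    proof -
      have "ereal (q * n - C) \<le> ereal (\<Sum>k<n. W ((T ^^ k) x))" using C f_le_sum order_trans by blast
      then show ?thesis using D[of n] by (simp add: algebra_simps)
    qed
    moreover obtain n where "C + D < real n * (q - ?I - 1)"
      using reals_Archimedean3[of "q - ?I - 1"] q by (auto simp: mult.commute)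
    ultimately show False by (meson not_less)
  qed
  then have "?\<gamma> \<le> ereal (?I + 1)" by (intro SUP_least) auto
  then show "?\<gamma> \<noteq> \<infinity>" by auto
  show "?L q" if "ereal q < ?\<gamma>" for q
  proof -
    from that obtain q' where "?L q'" "q < q'" by (auto simp: less_SUP_iff)
    then show ?thesis by (auto intro: linear_lower_mono elim!: eventually_mono)
  qed
  show "AE x in M. uniform_linear_upper (\<lambda>s m. f m ((T ^^ s) x)) q" if "?\<gamma> < ereal q" for q
  proof -
    have "\<not> ?L q"
    proof
      assume "?L q"
      then have "ereal q \<le> ?\<gamma>" by (intro SUP_upper) auto
      with that show False by simp
    qed
    then show ?thesis using dichotomy by blast
  qed
qed

end

section \<open>Max-plus products along a sequence of matrices\<close>

lemma finite_SUP_attained: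
  fixes f :: "'a \<Rightarrow> 'b::complete_linorder"
  assumes "finite I" "I \<noteq> {}"
  obtains k where "k \<in> I" "(SUP k\<in>I. f k) = f k"
proof -
  have "(SUP k\<in>I. f k) \<in> f ` I"
    using assms Max_in[of "f ` I"] by (simp add: Max_Sup)
  then show ?thesis using that by auto
qed

definition mp_max :: "'d set \<Rightarrow> (nat \<Rightarrow> 'd \<Rightarrow> 'd \<Rightarrow> ereal) \<Rightarrow> nat \<Rightarrow> ereal" where
  "mp_max I Z n = (SUP i\<in>I. SUP j\<in>I. mp_forward I Z n i j)"

lemma mp_forward_le_max: "i \<in> I \<Longrightarrow> j \<in> I \<Longrightarrow> mp_forward I Z n i j \<le> mp_max I Z n"
  unfolding mp_max_def by (intro SUP_upper2[of i] SUP_upper) auto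

lemma mp_max_leI: "(\<And>i j. i \<in> I \<Longrightarrow> j \<in> I \<Longrightarrow> mp_forward I Z n i j \<le> b) \<Longrightarrow> mp_max I Z n \<le> b"
  unfolding mp_max_def by (intro SUP_least)

lemma mp_forward_Suc_ge:
  "l \<in> I \<Longrightarrow> Z n i l + mp_forward I Z n l j \<le> mp_forward I Z (Suc n) i j"
  unfolding mp_forward.simps mp_mult_def by (rule SUP_upper)

lemma mp_forward_Suc_attained:
  assumes "finite I" "I \<noteq> {}"
  obtains l where "l \<in> I" "mp_forward I Z (Suc n) i j = Z n i l + mp_forward I Z n l j"
  using finite_SUP_attained[OF assms, of "\<lambda>l. Z n i l + mp_forward I Z n l j"]
  by (auto simp: mp_mult_def)

lemma mp_forward_mono_set: "I \<subseteq> J \<Longrightarrow> mp_forward I Z n i j \<le> mp_forward J Z n i j"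
proof (induction n arbitrary: i)
  case (Suc n)
  then show ?case by (auto simp: mp_mult_def intro!: SUP_subset_mono add_left_mono)
qed simp

text \<open>On \<open>ereal\<close> the sum of \<open>-\<infinity>\<close> and
  \<open>\<infinity>\<close> is \<open>\<infinity>\<close>; only without \<open>\<infinity>\<close>
  is \<open>-\<infinity>\<close> absorbing, as the zero of the max-plus semiring must be. Hence the
  exclusion of \<open>\<infinity>\<close> that accompanies all products below.\<close>

lemma MInf_add: "a = -\<infinity> \<or> b = -\<infinity> \<Longrightarrow> a \<noteq> \<infinity> \<Longrightarrow> b \<noteq> \<infinity> \<Longrightarrow> a + b = (-\<infinity>::ereal)"
  by (cases a; cases b) auto

section \<open>Deterministic products: splitting in time and along closed sets of nodes\<close>

locale mp_sequence =
  fixes Z :: "nat \<Rightarrow> 'd::finite \<Rightarrow> 'd \<Rightarrow> ereal"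
  assumes not_PInf: "Z k i j \<noteq> \<infinity>"
begin

lemma mp_sequence_shift: "mp_sequence (\<lambda>k. Z (k + s))"
  by unfold_locales (rule not_PInf)

lemma mp_forward_not_PInf: "mp_forward I Z n i j \<noteq> \<infinity>"
proof (induction n arbitrary: i)
  case (Suc n)
  show ?case
  proof (cases "I = {}")
    case False
    then obtain l where "mp_forward I Z (Suc n) i j = Z n i l + mp_forward I Z n l j"
      using mp_forward_Suc_attained[OF finite] by blast
    then show ?thesis using not_PInf Suc by simp
  qed (simp add: mp_mult_def bot_ereal_def)
qed (simp add: mp_one_def)

text \<open>One half of associativity: a path may be prescribed to be at \<open>k\<close> at time
  \<open>n\<close>. The factors after time \<open>n\<close> stand on the left.\<close>

lemma mp_forward_add_ge:
  assumes k: "k \<in> I"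
  shows "mp_forward I (\<lambda>l. Z (l + n)) m i k + mp_forward I Z n k j \<le> mp_forward I Z (m + n) i j"
proof (induction m arbitrary: i)
  case 0
  show ?case using mp_forward_not_PInf[of I n k j] by (simp add: mp_one_def MInf_add)
next
  case (Suc m)
  let ?G = "mp_forward I (\<lambda>l. Z (l + n))"
  obtain l where l: "l \<in> I" "?G (Suc m) i k = Z (m + n) i l + ?G m l k"
    using mp_forward_Suc_attained[OF finite, of I "\<lambda>l. Z (l + n)" m i k] k by blast
  have "?G (Suc m) i k + mp_forward I Z n k j = Z (m + n) i l + (?G m l k + mp_forward I Z n k j)"
    unfolding l(2) by (rule add.assoc)
  also have "\<dots> \<le> Z (m + n) i l + mp_forward I Z (m + n) l j"
    by (rule add_left_mono[OF Suc])
  also have "\<dots> \<le> mp_forward I Z (Suc m + n) i j"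
    using mp_forward_Suc_ge[OF l(1), of Z "m + n" i j] by simp
  finally show ?case .
qed

text \<open>The other half: an optimal path is somewhere at time \<open>n\<close>. For
  \<open>m = 0\<close> that place is its row index, whence \<open>i \<in> I\<close>. Working with a
  witness avoids distributing sums over suprema in \<open>ereal\<close>.\<close>

lemma mp_forward_add_le:
  assumes "i \<in> I"
  obtains k where "k \<in> I"
    "mp_forward I Z (m + n) i j \<le> mp_forward I (\<lambda>l. Z (l + n)) m i k + mp_forward I Z n k j"
  using assms
proof (induction m arbitrary: i thesis)
  case 0
  from 0(1)[of i] 0(2) show ?case by (simp add: mp_one_def)
next
  case (Suc m)
  let ?G = "mp_forward I (\<lambda>l. Z (l + n))"
  obtain l where l: "l \<in> I" "mp_forward I Z (Suc (m + n)) i j = Z (m + n) i l + mp_forward I Z (m + n) l j"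
    using mp_forward_Suc_attained[OF finite, of I Z "m + n" i j] Suc.prems(2) by blast
  obtain k where k: "k \<in> I" "mp_forward I Z (m + n) l j \<le> ?G m l k + mp_forward I Z n k j"
    using Suc.IH[OF _ l(1)] by blast
  have "mp_forward I Z (Suc m + n) i j \<le> Z (m + n) i l + (?G m l k + mp_forward I Z n k j)"
    using l(2) add_left_mono[OF k(2)] by simp
  also have "\<dots> = (Z (m + n) i l + ?G m l k) + mp_forward I Z n k j" by (simp only: add.assoc)
  also have "\<dots> \<le> ?G (Suc m) i k + mp_forward I Z n k j"
    by (intro add_right_mono) (rule mp_forward_Suc_ge[OF l(1), of "\<lambda>l. Z (l + n)"])
  finally show ?case using Suc.prems(1)[OF k(1)] by blast
qed

lemma mp_max_subadditive: "mp_max I Z (n + m) \<le> mp_max I Z n + mp_max I (\<lambda>k. Z (k + n)) m"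
proof (rule mp_max_leI)
  fix i j assume ij: "i \<in> I" "j \<in> I"
  obtain k where k: "k \<in> I"
    "mp_forward I Z (m + n) i j \<le> mp_forward I (\<lambda>l. Z (l + n)) m i k + mp_forward I Z n k j"
    using mp_forward_add_le[OF ij(1)] by blast
  note k(2)
  also have "mp_forward I (\<lambda>l. Z (l + n)) m i k + mp_forward I Z n k j
      \<le> mp_max I (\<lambda>k. Z (k + n)) m + mp_max I Z n"
    by (intro add_mono mp_forward_le_max ij k)
  finally show "mp_forward I Z (n + m) i j \<le> mp_max I Z n + mp_max I (\<lambda>k. Z (k + n)) m"
    by (simp add: add.commute)
qed

lemma mp_max_0: "I \<noteq> {} \<Longrightarrow> mp_max I Z 0 = 0"
  by (intro antisym mp_max_leI) (auto simp: mp_one_def intro!: order_trans[OF _ mp_forward_le_max])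

lemma mp_max_1_le:
  assumes "\<And>i j. Z 0 i j \<le> w"
  shows "mp_max I Z 1 \<le> w"
proof (rule mp_max_leI)
  fix i j
  have "Z 0 i k + mp_one k j \<le> w" for k
    using assms[of i k] not_PInf[of 0 i k] by (auto simp: mp_one_def MInf_add)
  then show "mp_forward I Z 1 i j \<le> w" by (auto simp: mp_mult_def intro!: SUP_least)
qed

text \<open>No arc leaves \<open>J\<close>, so a path that starts there never gets out.\<close>

lemma mp_forward_closed_rows:
  assumes closed: "\<And>k i l. i \<in> J \<Longrightarrow> l \<in> U - J \<Longrightarrow> Z k i l = -\<infinity>" and i: "i \<in> J"
  shows "mp_forward U Z n i j \<le> (if j \<in> J then mp_forward J Z n i j else -\<infinity>)"
  using i
proof (induction n arbitrary: i)
  case 0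
  then show ?case by (auto simp: mp_one_def)
next
  case (Suc n)
  have "Z n i l + mp_forward U Z n l j \<le> (if j \<in> J then mp_forward J Z (Suc n) i j else -\<infinity>)"
    if "l \<in> U" for l
  proof (cases "l \<in> J")
    case True
    have le: "Z n i l + mp_forward U Z n l j \<le> Z n i l + (if j \<in> J then mp_forward J Z n l j else -\<infinity>)"
      by (rule add_left_mono[OF Suc.IH[OF True]])
    also have "\<dots> \<le> (if j \<in> J then mp_forward J Z (Suc n) i j else -\<infinity>)"
      using mp_forward_Suc_ge[OF True, of Z n i j] not_PInf[of n i l]
      by (auto simp: MInf_add)
    finally show ?thesis .
  next
    case False
    then have "Z n i l + mp_forward U Z n l j = -\<infinity>"
      using closed[OF Suc.prems, of l n] that mp_forward_not_PInf by (intro MInf_add) auto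
    then show ?thesis by (simp only: ereal_less_eq)
  qed
  then show ?case by (simp add: mp_mult_def[of U] SUP_le_iff)
qed

text \<open>Dually, no arc enters \<open>I\<close> from outside, so a path that ends in
  \<open>I\<close> has been there all along.\<close>

lemma mp_forward_closed_columns:
  assumes closed: "\<And>k i l. i \<in> U - I \<Longrightarrow> l \<in> I \<Longrightarrow> Z k i l = -\<infinity>" and j: "j \<in> I" and i: "i \<in> U"
  shows "mp_forward U Z n i j \<le> (if i \<in> I then mp_forward I Z n i j else -\<infinity>)"
  using i
proof (induction n arbitrary: i)
  case 0
  then show ?case using j by (auto simp: mp_one_def)
next
  case (Suc n)
  have "Z n i l + mp_forward U Z n l j \<le> (if i \<in> I then mp_forward I Z (Suc n) i j else -\<infinity>)"
    if l: "l \<in> U" for l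
  proof (cases "i \<notin> I \<and> l \<in> I")
    case True
    then have "Z n i l + mp_forward U Z n l j = -\<infinity>"
      using closed[of i l n] Suc.prems mp_forward_not_PInf by (intro MInf_add) auto
    then show ?thesis by (simp only: ereal_less_eq)
  next
    case False
    have "Z n i l + mp_forward U Z n l j \<le> Z n i l + (if l \<in> I then mp_forward I Z n l j else -\<infinity>)"
      by (rule add_left_mono[OF Suc.IH[OF l]])
    also have "\<dots> \<le> (if i \<in> I then mp_forward I Z (Suc n) i j else -\<infinity>)"
      using mp_forward_Suc_ge[of l I Z n i j] not_PInf[of n i l] False by (auto simp: MInf_add)
    finally show ?thesis .
  qed
  then show ?case by (simp add: mp_mult_def[of U] SUP_le_iff)
qed

text \<open>The single arc from \<open>I\<close> to \<open>J\<close> is used at time \<open>k\<close>; time runs from right to left in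
  the product, so the \<open>J\<close>-part of the path comes first.\<close>

lemma mp_forward_crossing:
  assumes disj: "I \<inter> J = {}" and no: "\<And>k i j. i \<in> J \<Longrightarrow> j \<in> I \<Longrightarrow> Z k i j = -\<infinity>"
    and i: "i \<in> I" and j: "j \<in> J"
  shows "mp_forward (I \<union> J) Z m i j = -\<infinity> \<or> (\<exists>k<m. \<exists>u\<in>I. \<exists>v\<in>J.
     mp_forward (I \<union> J) Z m i j \<le> mp_forward I (\<lambda>l. Z (l + Suc k)) (m - Suc k) i u
       + (Z k u v + mp_forward J Z k v j))"
  using i
proof (induction m arbitrary: i)
  case 0
  then show ?case using disj j by (auto simp: mp_one_def)
next
  case (Suc m)
  let ?F = "mp_forward (I \<union> J) Z"
  obtain l where l: "l \<in> I \<union> J" "?F (Suc m) i j = Z m i l + ?F m l j"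
    using mp_forward_Suc_attained[OF finite, of "I \<union> J" Z m i j] j by blast
  show ?case
  proof (cases "l \<in> I")
    case True
    from Suc.IH[OF True] show ?thesis
    proof (elim disjE exE bexE conjE)
      assume "?F m l j = -\<infinity>"
      then show ?thesis using l(2) not_PInf by (simp add: MInf_add)
    next
      fix k u v assume k: "k < m" "u \<in> I" "v \<in> J"
        and le: "?F m l j \<le> mp_forward I (\<lambda>l. Z (l + Suc k)) (m - Suc k) l u + (Z k u v + mp_forward J Z k v j)"
      let ?G = "mp_forward I (\<lambda>l. Z (l + Suc k))"
      have "Suc m - Suc k = Suc (m - Suc k)" using k by simp
      moreover have "Z m i l + ?G (m - Suc k) l u \<le> ?G (Suc (m - Suc k)) i u"
        using mp_forward_Suc_ge[OF True, of "\<lambda>l. Z (l + Suc k)" "m - Suc k" i u] k by simp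
      ultimately have "Z m i l + ?G (m - Suc k) l u \<le> ?G (Suc m - Suc k) i u" by simp
      then have "?F (Suc m) i j \<le> ?G (Suc m - Suc k) i u + (Z k u v + mp_forward J Z k v j)"
        using add_left_mono[OF le, of "Z m i l"] add_right_mono
        unfolding l(2) add.assoc[symmetric] by (meson order_trans)
      then show ?thesis using k less_Suc_eq by blast
    qed
  next
    case False
    then have lJ: "l \<in> J" using l by auto
    have "?F m l j \<le> mp_forward J Z m l j"
      using mp_forward_closed_rows[of J "I \<union> J" l m j] no lJ j disj by auto
    \<comment> \<open>The crossing uses the leftmost factor, at time \<open>m\<close>; the part in
      \<open>I\<close> is the empty product, whose diagonal entry is 0.\<close>
    then have "?F (Suc m) i j \<le> mp_forward I (\<lambda>l. Z (l + Suc m)) (Suc m - Suc m) i i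
        + (Z m i l + mp_forward J Z m l j)"
      using l(2) by (simp add: mp_one_def add_left_mono)
    then show ?thesis using Suc.prems lJ by blast
  qed
qed

end

abbreviation mp_upper :: "'d set \<Rightarrow> (nat \<Rightarrow> 'd \<Rightarrow> 'd \<Rightarrow> ereal) \<Rightarrow> real \<Rightarrow> bool" where
  "mp_upper I Z q \<equiv> uniform_linear_upper (\<lambda>s m. mp_max I (\<lambda>k. Z (k + s)) m) q"

section \<open>Upper bounds for block triangular sequences\<close>

locale sublinear_mp_sequence = mp_sequence Z for Z :: "nat \<Rightarrow> 'd::finite \<Rightarrow> 'd \<Rightarrow> ereal" +
  assumes sublinear: "\<epsilon> > 0 \<Longrightarrow> \<exists>C. \<forall>k i j. Z k i j \<le> ereal (\<epsilon> * real k + C)"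
begin

text \<open>A path in the union stays in one block or passes exactly once from \<open>I\<close> to
  \<open>J\<close>. In the latter case it consists of a window in \<open>J\<close>, one arc and a
  window in \<open>I\<close>, and all three lie in the time interval from \<open>s\<close> to
  \<open>s + m\<close>.\<close>

lemma mp_upper_Un:
  assumes disj: "I \<inter> J = {}" and no: "\<And>k i j. i \<in> J \<Longrightarrow> j \<in> I \<Longrightarrow> Z k i j = -\<infinity>"
    and I: "mp_upper I Z q" and J: "mp_upper J Z q"
  shows "mp_upper (I \<union> J) Z q"
  unfolding uniform_linear_upper_def
proof (intro allI impI)
  fix \<epsilon> :: real assume \<epsilon>: "\<epsilon> > 0"
  \<comment> \<open>One third for each of the two windows and one for the crossing arc.\<close>
  define e where "e = \<epsilon> / 3"
  have e: "e > 0" using \<epsilon> by (simp add: e_def)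
  obtain A where A: "\<And>s m. mp_max I (\<lambda>k. Z (k + s)) m \<le> ereal (q * m + e * (s + m) + A)"
    using I e unfolding uniform_linear_upper_def by blast
  obtain B where B: "\<And>s m. mp_max J (\<lambda>k. Z (k + s)) m \<le> ereal (q * m + e * (s + m) + B)"
    using J e unfolding uniform_linear_upper_def by blast
  obtain D where D: "\<And>k i j. Z k i j \<le> ereal (e * k + D)"
    using sublinear[OF e] by blast
  define C where "C = \<bar>A\<bar> + \<bar>B\<bar> + \<bar>D\<bar> + \<bar>q\<bar>"
  have "mp_max (I \<union> J) (\<lambda>k. Z (k + s)) m \<le> ereal (q * m + \<epsilon> * (s + m) + C)" for s m :: nat
  proof (rule mp_max_leI)
    interpret S: mp_sequence "\<lambda>k. Z (k + s)" by (rule mp_sequence_shift)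
    fix i j assume i: "i \<in> I \<union> J" and j: "j \<in> I \<union> J"
    let ?F = "mp_forward (I \<union> J) (\<lambda>k. Z (k + s)) m i j"
    let ?R = "ereal (q * m + \<epsilon> * (s + m) + C)"
    have esm: "0 \<le> e * (s + m)" "\<epsilon> * (s + m) = 3 * (e * (s + m))" using e by (auto simp: e_def)
    have bI: "ereal (q * m + e * (s + m) + A) \<le> ?R" and bJ: "ereal (q * m + e * (s + m) + B) \<le> ?R"
      using esm by (auto simp: C_def)
    consider "i \<in> J" | "i \<in> I" "j \<in> I" | "i \<in> I" "j \<in> J" using i j by blast
    then show "?F \<le> ?R"
    proof cases
      case 1
      have "?F \<le> (if j \<in> J then mp_forward J (\<lambda>k. Z (k + s)) m i j else -\<infinity>)"
        using no by (intro S.mp_forward_closed_rows 1) auto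
      also have "\<dots> \<le> ereal (q * m + e * (s + m) + B)"
        using order_trans[OF mp_forward_le_max B] 1 by simp
      also note bJ
      finally show ?thesis .
    next
      case 2
      have "?F \<le> (if i \<in> I then mp_forward I (\<lambda>k. Z (k + s)) m i j else -\<infinity>)"
        using no 2 by (intro S.mp_forward_closed_columns) auto
      also have "\<dots> \<le> ereal (q * m + e * (s + m) + A)"
        using order_trans[OF mp_forward_le_max A] 2 by simp
      also note bI
      finally show ?thesis .
    next
      case 3
      have "?F = -\<infinity> \<or> (\<exists>k<m. \<exists>u\<in>I. \<exists>v\<in>J. ?F \<le> mp_forward I (\<lambda>l. Z (l + Suc k + s)) (m - Suc k) i u
         + (Z (k + s) u v + mp_forward J (\<lambda>k. Z (k + s)) k v j))"
        using S.mp_forward_crossing[OF disj no 3] .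
      then show ?thesis
      proof (elim disjE exE bexE conjE)
        fix k u v assume k: "k < m" "u \<in> I" "v \<in> J"
          and le: "?F \<le> mp_forward I (\<lambda>l. Z (l + Suc k + s)) (m - Suc k) i u
            + (Z (k + s) u v + mp_forward J (\<lambda>k. Z (k + s)) k v j)"
        \<comment> \<open>This window starts late, at \<open>Suc k + s\<close>, but ends at
          \<open>s + m\<close>; the uniform form of the bound makes its error at most e * (s + m)
          with the same constant \<open>A\<close> for every \<open>k\<close>.\<close>
        have "mp_forward I (\<lambda>l. Z (l + (Suc k + s))) (m - Suc k) i u
            \<le> ereal (q * real (m - Suc k) + e * real (Suc k + s + (m - Suc k)) + A)"
          using order_trans[OF mp_forward_le_max A] 3 k by blast
        then have 1: "mp_forward I (\<lambda>l. Z (l + Suc k + s)) (m - Suc k) i u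
            \<le> ereal (q * real (m - Suc k) + e * (s + m) + A)"
          using k by (simp add: add.assoc)
        have ek: "e * (k + s) \<le> e * (s + m)" using e k by (intro mult_left_mono) auto
        have 2: "mp_forward J (\<lambda>k. Z (k + s)) k v j \<le> ereal (q * k + e * (s + k) + B)"
          using order_trans[OF mp_forward_le_max B] 3 k by blast
        note le
        also have "mp_forward I (\<lambda>l. Z (l + Suc k + s)) (m - Suc k) i u
            + (Z (k + s) u v + mp_forward J (\<lambda>k. Z (k + s)) k v j)
            \<le> ereal (q * real (m - Suc k) + e * (s + m) + A) +
              (ereal (e * real (k + s) + D) + ereal (q * k + e * (s + k) + B))"
          by (intro add_mono 1 2 D)
        also have "\<dots> \<le> ?R"
        proof -
          \<comment> \<open>The crossing arc uses up one time unit, so one \<open>q\<close> is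
            missing; this is the summand \<open>\<bar>q\<bar>\<close> in \<open>C\<close>.\<close>
          have "q * real (m - Suc k) + q * k = q * m - q"
            using k by (simp add: of_nat_diff algebra_simps)
          moreover have "e * (s + k) = e * real (k + s)" by (simp add: add.commute)
          ultimately have "q * real (m - Suc k) + e * (s + m) + A +
              (e * real (k + s) + D + (q * k + e * (s + k) + B)) \<le> q * m + \<epsilon> * (s + m) + C"
            using esm ek unfolding C_def by linarith
          then show ?thesis by (simp only: plus_ereal.simps ereal_less_eq)
        qed
        finally show ?thesis .
      qed simp
    qed
  qed
  then show "\<exists>C. \<forall>s m. mp_max (I \<union> J) (\<lambda>k. Z (k + s)) m \<le> ereal (q * m + \<epsilon> * (s + m) + C)"
    by blast
qed

text \<open>Strongly connected classes are removed one by one, always one that no remaining node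
  outside of it leads to.\<close>

lemma mp_upper_classes:
  assumes arcs: "\<And>k i j. \<not> R i j \<Longrightarrow> Z k i j = -\<infinity>"
    and "\<And>i. i \<in> F \<Longrightarrow> {j. R\<^sup>*\<^sup>* i j \<and> R\<^sup>*\<^sup>* j i} \<subseteq> F"
    and "\<And>i. i \<in> F \<Longrightarrow> mp_upper {j. R\<^sup>*\<^sup>* i j \<and> R\<^sup>*\<^sup>* j i} Z q"
  shows "mp_upper F Z q"
  using assms(2,3)
proof (induction "card F" arbitrary: F rule: less_induct)
  case less
  show ?case
  proof (cases "F = {}")
    case True
    then show ?thesis by (auto simp: uniform_linear_upper_def mp_max_def bot_ereal_def)
  next
    case False
    \<comment> \<open>The class of a node that reaches most nodes of \<open>F\<close> receives no
      arc from the rest: a node of \<open>F\<close> with an arc into it reaches all that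
      \<open>i\<close> reaches, by maximality nothing more, so \<open>i\<close> reaches it
      back.\<close>
    define r where "r i = card ({j. R\<^sup>*\<^sup>* i j} \<inter> F)" for i
    define i where "i = (ARG_MAX r i. i \<in> F)"
    have i: "i \<in> F" and max: "r k \<le> r i" if "k \<in> F" for k
    proof -
      have bounded: "\<forall>k. k \<in> F \<longrightarrow> r k < Suc (card F)"
        by (auto simp: r_def less_Suc_eq_le intro!: card_mono)
      show "i \<in> F" unfolding i_def by (rule arg_max_natI[OF that bounded])
      show "r k \<le> r i" unfolding i_def by (rule arg_max_nat_le[OF that bounded])
    qed
    have iF: "i \<in> F" using False i by blast
    let ?c = "{j. R\<^sup>*\<^sup>* i j \<and> R\<^sup>*\<^sup>* j i}"
    have c: "?c \<subseteq> F" "mp_upper ?c Z q" using less.prems[OF iF] by auto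
    have "mp_upper (?c \<union> (F - ?c)) Z q"
    proof (rule mp_upper_Un)
      show "?c \<inter> (F - ?c) = {}" by auto
      show "mp_upper ?c Z q" by fact
      show "mp_upper (F - ?c) Z q"
      proof (rule less.hyps)
        show "card (F - ?c) < card F" using iF by (intro psubset_card_mono) auto
      next
        fix k assume k: "k \<in> F - ?c"
        then show "mp_upper {j. R\<^sup>*\<^sup>* k j \<and> R\<^sup>*\<^sup>* j k} Z q" using less.prems by blast
        show "{j. R\<^sup>*\<^sup>* k j \<and> R\<^sup>*\<^sup>* j k} \<subseteq> F - ?c"
        proof
          fix j assume j: "j \<in> {j. R\<^sup>*\<^sup>* k j \<and> R\<^sup>*\<^sup>* j k}"
          then have "j \<in> F" using less.prems(1)[of k] k by blast
          moreover have "j \<notin> ?c" using j k by (auto intro: rtranclp_trans)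
          ultimately show "j \<in> F - ?c" by blast
        qed
      qed
    next
      fix n k l assume k: "k \<in> F - ?c" and l: "l \<in> ?c"
      show "Z n k l = -\<infinity>"
      proof (rule arcs, rule notI)
        assume "R k l"
        then have ki: "R\<^sup>*\<^sup>* k i" using l by (auto intro: converse_rtranclp_into_rtranclp)
        then have sub: "{j. R\<^sup>*\<^sup>* i j} \<inter> F \<subseteq> {j. R\<^sup>*\<^sup>* k j} \<inter> F" by (auto intro: rtranclp_trans)
        have "{j. R\<^sup>*\<^sup>* i j} \<inter> F = {j. R\<^sup>*\<^sup>* k j} \<inter> F"
          using max[of k] k by (intro card_seteq[OF _ sub]) (auto simp: r_def)
        then have "R\<^sup>*\<^sup>* i k" using k by auto
        with ki k show False by auto
      qed
    qed
    moreover have "?c \<union> (F - ?c) = F" using c by auto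
    ultimately show ?thesis by simp
  qed
qed

end

section \<open>Growth of max-plus products over an ergodic system\<close>

lemma ereal_less_real_between:
  assumes "ereal q < \<gamma>"
  obtains r where "q < r" "ereal r < \<gamma>"
proof -
  obtain r where "ereal q < ereal r" "ereal r < \<gamma>" using ereal_dense2[OF assms] by blast
  then show ?thesis using that by simp
qed

lemma ereal_less_real_between':
  assumes "\<gamma> < ereal q"
  obtains r where "r < q" "\<gamma> < ereal r"
proof -
  obtain r where "\<gamma> < ereal r" "ereal r < ereal q" using ereal_dense2[OF assms] by blast
  then show ?thesis using that by simp
qed

lemma eventually_linear_le:
  fixes a b C :: real
  assumes "a < b"
  shows "\<forall>\<^sub>F n in sequentially. a * real n + C \<le> b * real n"
proof -
  obtain N :: nat where N: "C / (b - a) \<le> real N" using real_arch_simple by blast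
  have "a * real n + C \<le> b * real n" if "N \<le> n" for n
  proof -
    have "C / (b - a) \<le> real n" using N that by linarith
    then have "C \<le> real n * (b - a)" using assms by (simp add: pos_divide_le_eq)
    then show ?thesis by (simp add: algebra_simps)
  qed
  then show ?thesis by (auto simp: eventually_at_top_linorder)
qed

lemma eventually_linear_lower:
  assumes "linear_lower u q'" "q < q'"
  shows "\<forall>\<^sub>F n in sequentially. ereal (q * real n) \<le> u n"
proof -
  obtain C where C: "\<And>n. ereal (q' * n - C) \<le> u n" using assms(1) by (auto simp: linear_lower_def)
  show ?thesis using eventually_linear_le[OF assms(2), of C]
    by eventually_elim (auto intro: order_trans[OF _ C])
qed

lemma eventually_uniform_linear_upper:
  assumes "uniform_linear_upper u q'" "q' < q"
  shows "\<forall>\<^sub>F n in sequentially. u 0 n \<le> ereal (q * real n)"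
proof -
  define e where "e = (q - q') / 2"
  have e: "0 < e" "q' + e < q" using assms(2) by (auto simp: e_def field_simps)
  obtain C where "\<And>s m. u s m \<le> ereal (q' * m + e * (s + m) + C)"
    using assms(1) e(1) unfolding uniform_linear_upper_def by blast
  from this[of 0] have C: "u 0 m \<le> ereal ((q' + e) * m + C)" for m by (simp add: algebra_simps)
  show ?thesis using eventually_linear_le[OF e(2), of C]
    by eventually_elim (auto intro: order_trans[OF C])
qed

lemma rmax_tendsto_if_eventually_between:
  assumes "\<gamma> \<noteq> \<infinity>"
    and lower: "\<And>q. q \<in> \<rat> \<Longrightarrow> ereal q < \<gamma> \<Longrightarrow> \<forall>\<^sub>F n in sequentially. ereal (q * real n) \<le> u n"
    and upper: "\<And>q. q \<in> \<rat> \<Longrightarrow> \<gamma> < ereal q \<Longrightarrow> \<forall>\<^sub>F n in sequentially. u n \<le> ereal (q * real n)"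
  shows "rmax_tendsto (\<lambda>n. ereal (1 / real n) * u n) \<gamma>"
  unfolding rmax_tendsto_def
proof (intro conjI order_tendstoI)
  have scale: "ereal (1 / real n) * ereal (q * real n) = ereal q" if "0 < n" for q n
    using that by simp
  fix a :: ereal
  {
    assume "a < \<gamma>"
    then obtain r s where "a < ereal r" "r < s" "ereal s < \<gamma>"
      by (metis ereal_dense2 ereal_less_real_between)
    moreover from \<open>r < s\<close> obtain q where "q \<in> \<rat>" "r < q" "q < s" using Rats_dense_in_real by blast
    ultimately have q: "q \<in> \<rat>" "a < ereal q" "ereal q < \<gamma>"
      by (auto intro: less_trans[of a "ereal r"] less_trans[of _ "ereal s"])
    show "\<forall>\<^sub>F n in sequentially. a < ereal (1 / real n) * u n"
      using lower[OF q(1,3)] eventually_gt_at_top[of 0]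
    proof eventually_elim
      case (elim n)
      have "a < ereal (1 / real n) * ereal (q * real n)" using scale elim q(2) by simp
      also have "\<dots> \<le> ereal (1 / real n) * u n" by (rule ereal_mult_left_mono[OF elim(1)]) simp
      finally show ?case .
    qed
  next
    assume "\<gamma> < a"
    then obtain r s where "\<gamma> < ereal r" "r < s" "ereal s < a"
      by (metis ereal_dense2 ereal_less_real_between)
    moreover from \<open>r < s\<close> obtain q where "q \<in> \<rat>" "r < q" "q < s" using Rats_dense_in_real by blast
    ultimately have q: "q \<in> \<rat>" "\<gamma> < ereal q" "ereal q < a"
      by (auto intro: less_trans[of \<gamma> "ereal r"] less_trans[of _ "ereal s"])
    show "\<forall>\<^sub>F n in sequentially. ereal (1 / real n) * u n < a"
      using upper[OF q(1,2)] eventually_gt_at_top[of 0]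
    proof eventually_elim
      case (elim n)
      have "ereal (1 / real n) * u n \<le> ereal (1 / real n) * ereal (q * real n)"
        by (rule ereal_mult_left_mono[OF elim(1)]) simp
      also have "\<dots> < a" using scale elim q(3) by simp
      finally show ?case .
    qed
  }
qed (fact assms(1))

text \<open>Rational slopes are dense and countable, so that the null sets of the separate bounds
  can be united.\<close>

lemma AE_rmax_tendsto:
  assumes "\<gamma> \<noteq> \<infinity>"
    and "\<And>q. ereal q < \<gamma> \<Longrightarrow> AE x in M. \<forall>\<^sub>F n in sequentially. ereal (q * real n) \<le> u x n"
    and "\<And>q. \<gamma> < ereal q \<Longrightarrow> AE x in M. \<forall>\<^sub>F n in sequentially. u x n \<le> ereal (q * real n)"
  shows "AE x in M. rmax_tendsto (\<lambda>n. ereal (1 / real n) * u x n) \<gamma>"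
proof -
  have "AE x in M. \<forall>q\<in>\<rat>. (ereal q < \<gamma> \<longrightarrow> (\<forall>\<^sub>F n in sequentially. ereal (q * real n) \<le> u x n)) \<and>
      (\<gamma> < ereal q \<longrightarrow> (\<forall>\<^sub>F n in sequentially. u x n \<le> ereal (q * real n)))"
    using assms(2,3) by (intro AE_ball_countable[THEN iffD2] countable_rat ballI)
      (smt (verit, best) AE_mp AE_I2 not_less_iff_gr_or_eq)
  then show ?thesis
    by eventually_elim (rule rmax_tendsto_if_eventually_between[OF assms(1)], auto)
qed

section \<open>Time averages and the times of visits to an event\<close>

context ergodic_system
begin

lemma birkhoff_tendsto:
  fixes g :: "'a \<Rightarrow> real"
  assumes "integrable M g"
  shows "AE x in M. (\<lambda>n. (\<Sum>k<n. g ((T ^^ k) x)) / n) \<longlonglongrightarrow> (\<integral>x. g x \<partial>M)"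
  using birkhoff[OF assms]
proof eventually_elim
  case (elim x)
  let ?S = "\<lambda>n. \<Sum>k<n. g ((T ^^ k) x)"
  let ?I = "\<integral>x. g x \<partial>M"
  show ?case
  proof (rule tendstoI)
    fix r :: real assume "0 < r"
    then obtain C where C: "\<And>n. \<bar>?S n - n * ?I\<bar> \<le> r / 4 * n + C" using elim by (meson divide_pos_pos zero_less_numeral)
    have "\<forall>\<^sub>F n in sequentially. r / 4 * real n + C \<le> r / 2 * real n"
      by (rule eventually_linear_le) (use \<open>0 < r\<close> in simp)
    then show "\<forall>\<^sub>F n in sequentially. dist (?S n / n) ?I < r"
      using eventually_gt_at_top[of 0]
    proof eventually_elim
      case (elim n)
      have "dist (?S n / n) ?I = \<bar>?S n - n * ?I\<bar> / n"
        using elim(2) by (simp add: dist_real_def field_simps)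
      also have "\<dots> \<le> r / 2"
        using C[of n] elim by (simp add: divide_le_eq)
      also have "\<dots> < r" using \<open>0 < r\<close> by simp
      finally show ?case .
    qed
  qed
qed

text \<open>Without a visit in the last stretch of length about \<open>\<delta> * n\<close>, the
  numbers of visits before its beginning and before \<open>n\<close> would coincide, although
  Birkhoff's theorem makes them differ by a positive multiple of \<open>n\<close>.\<close>

lemma recent_visit:
  assumes E [measurable]: "E \<in> sets M" and pos: "0 < prob E"
  shows "AE x in M. \<forall>\<delta>::real>0. \<forall>\<^sub>F n in sequentially. \<exists>k<n. real n \<le> real k + \<delta> * real n \<and> (T ^^ k) x \<in> E"
proof -
  let ?i = "indicator E :: 'a \<Rightarrow> real"
  have "integrable M ?i" using E by (intro integrable_real_indicator) (auto simp: less_top[symmetric])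
  from birkhoff[OF this] show ?thesis
  proof eventually_elim
    case (elim x)
    let ?S = "\<lambda>n. \<Sum>k<n. ?i ((T ^^ k) x)"
    show ?case
    proof (intro allI impI)
      fix \<delta> :: real assume \<delta>: "\<delta> > 0"
      \<comment> \<open>The cap at 1 keeps \<open>(1 - d) * n\<close> nonnegative, so that rounding
        it up to a natural number changes it by at most 1.\<close>
      define d where "d = min \<delta> 1"
      have d: "0 < d" "d \<le> 1" "d \<le> \<delta>" using \<delta> by (auto simp: d_def)
      define e where "e = prob E * d / 4"
      have e: "e > 0" using pos d by (simp add: e_def)
      obtain C where C: "\<And>n. \<bar>?S n - n * prob E\<bar> \<le> e * n + C" using elim e by auto
      have "0 < prob E * d" using pos d by simp
      then have "2 * e < prob E * d" unfolding e_def by linarith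
      \<comment> \<open>The stretch gains \<open>prob E * d * n\<close>. The two Birkhoff errors
        take \<open>2 * e * n + 2 * C\<close>, the rounding of \<open>m\<close> takes
        \<open>prob E\<close>, and 1 makes the inequality strict.\<close>
      from eventually_linear_le[OF this, of "prob E + 2 * C + 1"]
      show "\<forall>\<^sub>F n in sequentially. \<exists>k<n. real n \<le> real k + \<delta> * real n \<and> (T ^^ k) x \<in> E"
      proof eventually_elim
        case (elim n)
        define m where "m = nat \<lceil>(1 - d) * real n\<rceil>"
        have "(1 - d) * real n \<le> 1 * real n" using d by (intro mult_right_mono) auto
        then have mn: "m \<le> n" unfolding m_def by (simp add: ceiling_le_iff nat_le_iff)
        have m_ge: "(1 - d) * real n \<le> m" unfolding m_def by (rule real_nat_ceiling_ge)
        have "0 \<le> (1 - d) * real n" using d by simp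
        then have m_le: "m \<le> (1 - d) * real n + 1" unfolding m_def by linarith
        have "prob E * (real m) \<le> prob E * ((1 - d) * real n + 1)"
          using m_le by (intro mult_left_mono) auto
        moreover have "e * real m \<le> e * real n" using e mn by simp
        ultimately have "?S m < ?S n"
          using C[of n] C[of m] elim by (simp add: abs_le_iff algebra_simps)
        moreover have "?S n = ?S m + (\<Sum>k=m..<n. ?i ((T ^^ k) x))"
          unfolding lessThan_atLeast0 using mn by (intro sum.atLeastLessThan_concat[symmetric]) auto
        ultimately have "(\<Sum>k=m..<n. ?i ((T ^^ k) x)) \<noteq> 0" by simp
        then have "\<exists>k\<in>{m..<n}. ?i ((T ^^ k) x) \<noteq> 0" by (meson sum.neutral)
        then obtain k where k: "m \<le> k" "k < n" "(T ^^ k) x \<in> E"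
          by (auto split: split_indicator_asm)
        have "real n \<le> m + d * real n" using m_ge by (simp add: algebra_simps)
        also have "\<dots> \<le> k + \<delta> * real n" using k d by (intro add_mono mult_right_mono) auto
        finally show ?case using k by blast
      qed
    qed
  qed
qed

lemma frequent_visits:
  assumes "E \<in> sets M" "0 < prob E"
  shows "AE x in M. \<forall>L. \<exists>k\<ge>L. (T ^^ k) x \<in> E"
  using recent_visit[OF assms]
proof eventually_elim
  case (elim x)
  have ev: "\<forall>\<^sub>F n in sequentially. \<exists>k<n. real n \<le> real k + 1 / 2 * real n \<and> (T ^^ k) x \<in> E"
    using elim[rule_format, of "1 / 2"] by simp
  show ?case
  proof
    fix L :: nat
    obtain n k where "2 * L \<le> n" "real n \<le> real k + 1 / 2 * real n" "(T ^^ k) x \<in> E"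
      using eventually_happens'[OF _ eventually_conj[OF eventually_ge_at_top[of "2 * L"] ev]] by auto
    then have "L \<le> k" by linarith
    with \<open>(T ^^ k) x \<in> E\<close> show "\<exists>k\<ge>L. (T ^^ k) x \<in> E" by blast
  qed
qed

end

lemma finite_uniform_nat:
  assumes "finite c" "\<And>j. j \<in> c \<Longrightarrow> \<exists>L::nat. \<forall>n\<ge>L. P j n"
  obtains L where "\<And>j n. j \<in> c \<Longrightarrow> n \<ge> L \<Longrightarrow> P j n"
proof -
  have "\<forall>j\<in>c. \<forall>\<^sub>F n in sequentially. P j n"
    using assms(2) by (auto simp: eventually_at_top_linorder)
  then have "\<forall>\<^sub>F n in sequentially. \<forall>j\<in>c. P j n" using assms(1) by (simp add: eventually_ball_finite)
  then show ?thesis using that by (auto simp: eventually_at_top_linorder)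
qed

lemma finite_lower_bound:
  fixes u :: "'d \<Rightarrow> ereal"
  assumes "finite c" "\<And>j. j \<in> c \<Longrightarrow> u j \<noteq> -\<infinity>"
  obtains C :: nat where "\<And>j. j \<in> c \<Longrightarrow> ereal (- real C) \<le> u j"
proof -
  have "\<exists>L::nat. \<forall>n\<ge>L. ereal (- real n) \<le> u j" if "j \<in> c" for j
  proof (cases "u j")
    case (real r)
    obtain L :: nat where "- r \<le> L" using real_arch_simple by blast
    then show ?thesis using real by (intro exI[of _ L]) auto
  qed (use assms(2)[OF that] in auto)
  then obtain L where "\<And>j n. j \<in> c \<Longrightarrow> n \<ge> L \<Longrightarrow> ereal (- real n) \<le> u j"
    using finite_uniform_nat[OF assms(1), of "\<lambda>j n. ereal (- real n) \<le> u j"] by blast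
  then show ?thesis using that by blast
qed

section \<open>Exponents of diagonal blocks and upper growth rates of rows and columns\<close>

locale mp_system = ergodic_system M T for M :: "'a measure" and T +
  fixes A :: "'a \<Rightarrow> 'd::finite \<Rightarrow> 'd \<Rightarrow> ereal" and W :: "'a \<Rightarrow> real"
  assumes measurable_A [measurable]: "(\<lambda>x. A x i j) \<in> borel_measurable M"
    and A_not_PInf: "A x i j \<noteq> \<infinity>"
    and A_le: "A x i j \<le> ereal (W x)"
    and W_nonneg: "0 \<le> W x"
    and integrable_W: "integrable M W"
    and diagonal: "AE x in M. A x i i \<noteq> -\<infinity>"
begin

definition Z :: "'a \<Rightarrow> nat \<Rightarrow> 'd \<Rightarrow> 'd \<Rightarrow> ereal" where
  "Z x k = A ((T ^^ k) x)"

lemma Z_shift: "(\<lambda>k. Z x (k + s)) = Z ((T ^^ s) x)"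
  by (simp add: Z_def[abs_def] funpow_add)

lemma mp_sequence_Z: "mp_sequence (Z x)"
  by unfold_locales (simp add: Z_def A_not_PInf)

lemma measurable_Z [measurable]: "(\<lambda>x. Z x k i j) \<in> borel_measurable M"
  unfolding Z_def by measurable

lemma measurable_mp_forward_Z [measurable]: "(\<lambda>x. mp_forward I (Z x) n i j) \<in> borel_measurable M"
  by (induction n arbitrary: i) (auto simp: mp_mult_def intro!: borel_measurable_SUP countable_finite)

lemma measurable_mp_max_Z: "(\<lambda>x. mp_max I (Z x) n) \<in> borel_measurable M"
  unfolding mp_max_def by (intro borel_measurable_SUP countable_finite finite measurable_mp_forward_Z)

lemma subadditive_mp_max:
  assumes "I \<noteq> {}"
  shows "subadditive_process M T (\<lambda>n x. mp_max I (Z x) n) W"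
proof
  fix n m x
  interpret mp_sequence "Z x" by (rule mp_sequence_Z)
  show "(\<lambda>x. mp_max I (Z x) n) \<in> borel_measurable M"
    by (rule measurable_mp_max_Z)
  show "mp_max I (Z x) 0 = 0" by (rule mp_max_0[OF assms])
  show "mp_max I (Z x) (n + m) \<le> mp_max I (Z x) n + mp_max I (Z ((T ^^ n) x)) m"
    using mp_max_subadditive[of I n m] by (simp add: Z_shift)
  show "mp_max I (Z x) 1 \<le> ereal (W x)"
    by (rule mp_max_1_le) (simp add: Z_def A_le)
qed (rule W_nonneg integrable_W)+

text \<open>Specified by the two bounds of Kingman's theorem, which are what the estimates use; the
  agreement with the limit \<open>max_lyapunov\<close> follows afterwards from uniqueness of
  limits.\<close>

definition exponent :: "'d set \<Rightarrow> ereal" where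
  "exponent I = (SOME \<gamma>. \<gamma> \<noteq> \<infinity> \<and>
     (\<forall>q. ereal q < \<gamma> \<longrightarrow> (AE x in M. linear_lower (mp_max I (Z x)) q)) \<and>
     (\<forall>q. \<gamma> < ereal q \<longrightarrow> (AE x in M. mp_upper I (Z x) q)))"

lemma exponent:
  assumes "I \<noteq> {}"
  shows exponent_not_PInf: "exponent I \<noteq> \<infinity>"
    and exponent_lower: "ereal q < exponent I \<Longrightarrow> AE x in M. linear_lower (mp_max I (Z x)) q"
    and exponent_upper: "exponent I < ereal q \<Longrightarrow> AE x in M. mp_upper I (Z x) q"
proof -
  interpret subadditive_process M T "\<lambda>n x. mp_max I (Z x) n" W
    by (rule subadditive_mp_max[OF assms])
  have "\<exists>\<gamma>. \<gamma> \<noteq> \<infinity> \<and>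
     (\<forall>q. ereal q < \<gamma> \<longrightarrow> (AE x in M. linear_lower (mp_max I (Z x)) q)) \<and>
     (\<forall>q. \<gamma> < ereal q \<longrightarrow> (AE x in M. mp_upper I (Z x) q))"
    unfolding Z_shift by (rule kingman) blast
  from someI_ex[OF this, folded exponent_def]
  show "exponent I \<noteq> \<infinity>"
    and "ereal q < exponent I \<Longrightarrow> AE x in M. linear_lower (mp_max I (Z x)) q"
    and "exponent I < ereal q \<Longrightarrow> AE x in M. mp_upper I (Z x) q" by auto
qed

lemma mp_max_tendsto_exponent:
  assumes "I \<noteq> {}"
  shows "AE x in M. rmax_tendsto (\<lambda>n. ereal (1 / real n) * mp_max I (Z x) n) (exponent I)"
proof (rule AE_rmax_tendsto[OF exponent_not_PInf[OF assms]])
  fix q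
  {
    assume "ereal q < exponent I"
    then obtain q' where "q < q'" "ereal q' < exponent I" by (rule ereal_less_real_between)
    with exponent_lower[OF assms, of q']
    show "AE x in M. \<forall>\<^sub>F n in sequentially. ereal (q * real n) \<le> mp_max I (Z x) n"
      by (auto elim: eventually_mono intro: eventually_linear_lower)
  next
    assume "exponent I < ereal q"
    then obtain q' where q': "q' < q" "exponent I < ereal q'" by (rule ereal_less_real_between')
    from exponent_upper[OF assms q'(2)]
    show "AE x in M. \<forall>\<^sub>F n in sequentially. mp_max I (Z x) n \<le> ereal (q * real n)"
      by eventually_elim (drule eventually_uniform_linear_upper[OF _ q'(1)], simp)
  }
qed

definition edge :: "'d \<Rightarrow> 'd \<Rightarrow> bool" where
  "edge i j \<longleftrightarrow> 0 < prob {x. A x i j \<noteq> -\<infinity>}"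

definition scc :: "'d \<Rightarrow> 'd set" where
  "scc i = {j. edge\<^sup>*\<^sup>* i j \<and> edge\<^sup>*\<^sup>* j i}"

lemma scc_nonempty: "scc i \<noteq> {}" "i \<in> scc i"
  by (auto simp: scc_def)

lemma scc_subset_successors: "edge\<^sup>*\<^sup>* i k \<Longrightarrow> scc k \<subseteq> {j. edge\<^sup>*\<^sup>* i j}"
  and scc_subset_predecessors: "edge\<^sup>*\<^sup>* k i \<Longrightarrow> scc k \<subseteq> {j. edge\<^sup>*\<^sup>* j i}"
  unfolding scc_def by (auto dest: rtranclp_trans[of edge i k] rtranclp_trans[of edge _ k i])

lemma sets_edge [measurable]: "{x. A x i j \<noteq> -\<infinity>} \<in> sets M"
proof -
  have "{x \<in> space M. A x i j \<noteq> -\<infinity>} \<in> sets M" by measurable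
  then show ?thesis by (simp add: space_UNIV)
qed

lemma AE_no_edge: "AE x in M. \<forall>k i j. \<not> edge i j \<longrightarrow> Z x k i j = -\<infinity>"
proof -
  have "AE x in M. \<not> edge i j \<longrightarrow> A x i j = -\<infinity>" for i j
  proof (cases "edge i j")
    case False
    then have "prob {x. A x i j \<noteq> -\<infinity>} = 0" by (simp add: edge_def zero_less_measure_iff)
    then show ?thesis using prob_eq_0[OF sets_edge] by auto
  qed simp
  from AE_funpow_T[OF this] show ?thesis
    unfolding Z_def by (simp add: AE_all_countable AE_finite_all[of UNIV, simplified])
qed

lemma AE_diagonal: "AE x in M. \<forall>k i. Z x k i i \<noteq> -\<infinity>"
  using AE_funpow_T[OF diagonal] unfolding Z_def AE_all_countable by blast

lemma AE_sublinear: "AE x in M. sublinear_mp_sequence (Z x)"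
  using orbit_sublinear[OF integrable_W]
proof eventually_elim
  case (elim x)
  interpret mp_sequence "Z x" by (rule mp_sequence_Z)
  show ?case
  proof
    fix \<epsilon> :: real assume "\<epsilon> > 0"
    then obtain C where C: "\<And>k. \<bar>W ((T ^^ k) x)\<bar> \<le> \<epsilon> * k + C" using elim by blast
    have "Z x k i j \<le> ereal (\<epsilon> * real k + C)" for k i j
      using C[of k] A_le[of "(T ^^ k) x" i j] by (auto simp: Z_def elim: order_trans)
    then show "\<exists>C. \<forall>k i j. Z x k i j \<le> ereal (\<epsilon> * real k + C)" by blast
  qed
qed

text \<open>Here randomness is left behind: almost every orbit satisfies the hypotheses of the
  deterministic \<open>mp_upper_classes\<close>.\<close>

lemma AE_upper_sccs:
  assumes "\<And>i. i \<in> F \<Longrightarrow> scc i \<subseteq> F" "\<And>i. i \<in> F \<Longrightarrow> exponent (scc i) < ereal q"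
  shows "AE x in M. mp_upper F (Z x) q"
proof -
  have "AE x in M. \<forall>i\<in>F. mp_upper (scc i) (Z x) q"
    using assms(2) scc_nonempty by (intro AE_finite_allI exponent_upper) auto
  with AE_no_edge AE_sublinear show ?thesis
  proof eventually_elim
    case (elim x)
    interpret sublinear_mp_sequence "Z x" by fact
    show ?case
      by (rule mp_upper_classes[where R = edge]) (use elim assms(1) in \<open>auto simp: scc_def\<close>)
  qed
qed

text \<open>The successors of \<open>i\<close> form a union of classes that no path from
  \<open>i\<close> leaves, so the row of the full product lives in that block.\<close>

lemma AE_upper_row:
  assumes "\<And>j. edge\<^sup>*\<^sup>* i j \<Longrightarrow> exponent (scc j) < ereal q'" "q' < q"
  shows "AE x in M. \<forall>\<^sub>F n in sequentially. (SUP j. mp_forward UNIV (Z x) n i j) \<le> ereal (q * real n)"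
proof -
  let ?F = "{j. edge\<^sup>*\<^sup>* i j}"
  have "AE x in M. mp_upper ?F (Z x) q'"
  proof (rule AE_upper_sccs)
    fix k assume "k \<in> ?F"
    then show "scc k \<subseteq> ?F" "exponent (scc k) < ereal q'"
      by (simp_all only: mem_Collect_eq scc_subset_successors assms(1))
  qed
  with AE_no_edge show ?thesis
  proof eventually_elim
    case (elim x)
    interpret mp_sequence "Z x" by (rule mp_sequence_Z)
    have "(SUP j. mp_forward UNIV (Z x) n i j) \<le> mp_max ?F (Z x) n" for n
    proof (rule SUP_least)
      fix j
      have "mp_forward UNIV (Z x) n i j \<le> (if j \<in> ?F then mp_forward ?F (Z x) n i j else -\<infinity>)"
        using elim(1) by (intro mp_forward_closed_rows) (auto dest: rtranclp.rtrancl_into_rtrancl)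
      also have "\<dots> \<le> mp_max ?F (Z x) n" by (auto intro: mp_forward_le_max)
      finally show "mp_forward UNIV (Z x) n i j \<le> mp_max ?F (Z x) n" .
    qed
    with eventually_uniform_linear_upper[OF elim(2) assms(2)] show ?case
      by (auto elim!: eventually_mono intro: order_trans)
  qed
qed

text \<open>The same with predecessors, a union of classes that no path ending in \<open>i\<close>
  can enter from outside.\<close>

lemma AE_upper_column:
  assumes "\<And>j. edge\<^sup>*\<^sup>* j i \<Longrightarrow> exponent (scc j) < ereal q'" "q' < q"
  shows "AE x in M. \<forall>\<^sub>F n in sequentially. (SUP j. mp_forward UNIV (Z x) n j i) \<le> ereal (q * real n)"
proof -
  let ?F = "{j. edge\<^sup>*\<^sup>* j i}"
  have "AE x in M. mp_upper ?F (Z x) q'"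
  proof (rule AE_upper_sccs)
    fix k assume "k \<in> ?F"
    then show "scc k \<subseteq> ?F" "exponent (scc k) < ereal q'"
      by (simp_all only: mem_Collect_eq scc_subset_predecessors assms(1))
  qed
  with AE_no_edge show ?thesis
  proof eventually_elim
    case (elim x)
    interpret mp_sequence "Z x" by (rule mp_sequence_Z)
    have "(SUP j. mp_forward UNIV (Z x) n j i) \<le> mp_max ?F (Z x) n" for n
    proof (rule SUP_least)
      fix j
      have "mp_forward UNIV (Z x) n j i \<le> (if j \<in> ?F then mp_forward ?F (Z x) n j i else -\<infinity>)"
      proof (rule mp_forward_closed_columns)
        fix n k l assume "k \<in> UNIV - ?F" "l \<in> ?F"
        then have "\<not> edge k l" using converse_rtranclp_into_rtranclp[of edge k l i] by blast
        then show "Z x n k l = -\<infinity>" using elim(1) by blast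
      qed auto
      also have "\<dots> \<le> mp_max ?F (Z x) n" by (auto intro: mp_forward_le_max)
      finally show "mp_forward UNIV (Z x) n j i \<le> mp_max ?F (Z x) n" .
    qed
    with eventually_uniform_linear_upper[OF elim(2) assms(2)] show ?case
      by (auto elim!: eventually_mono intro: order_trans)
  qed
qed

section \<open>Connections of finite weight and lower growth rates\<close>

lemma mp_forward_finite_Suc:
  assumes "Z x n i i \<noteq> -\<infinity>" "mp_forward UNIV (Z x) n i j \<noteq> -\<infinity>"
  shows "mp_forward UNIV (Z x) (Suc n) i j \<noteq> -\<infinity>"
  using assms mp_forward_Suc_ge[of i UNIV "Z x" n i j] by auto

text \<open>Later factors stand on the left, so the path is built from its far end. Once
  \<open>u\<close> is linked to \<open>j\<close> for good, the arc from \<open>i\<close> to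
  \<open>u\<close> appears at some later time almost surely, and from then on the path can wait at
  \<open>i\<close> on the diagonal.\<close>

lemma AE_connected:
  assumes "edge\<^sup>*\<^sup>* i j"
  shows "AE x in M. \<exists>L. \<forall>n\<ge>L. mp_forward UNIV (Z x) n i j \<noteq> -\<infinity>"
  using assms
proof (induction rule: converse_rtranclp_induct)
  case base
  show ?case using AE_diagonal
  proof eventually_elim
    case (elim x)
    have "mp_forward UNIV (Z x) n j j \<noteq> -\<infinity>" for n
    proof (induction n)
      case (Suc n)
      with elim show ?case by (intro mp_forward_finite_Suc) auto
    qed (simp add: mp_one_def)
    then show ?case by blast
  qed
next
  case (step i u)
  from \<open>edge i u\<close> have "AE x in M. \<forall>L. \<exists>k\<ge>L. (T ^^ k) x \<in> {x. A x i u \<noteq> -\<infinity>}"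
    unfolding edge_def by (intro frequent_visits sets_edge)
  with step.IH AE_diagonal show ?case
  proof eventually_elim
    case (elim x)
    then obtain L where L: "\<And>n. n \<ge> L \<Longrightarrow> mp_forward UNIV (Z x) n u j \<noteq> -\<infinity>" by blast
    obtain k where k: "k \<ge> L" "Z x k i u \<noteq> -\<infinity>" using elim(3) unfolding Z_def by blast
    have "mp_forward UNIV (Z x) n i j \<noteq> -\<infinity>" if "Suc k \<le> n" for n
      using that
    proof (induction n rule: dec_induct)
      case base
      show ?case using mp_forward_Suc_ge[of u UNIV "Z x" k i j] L[OF k(1)] k(2) by auto
    next
      case (step n)
      with elim(2) show ?case by (intro mp_forward_finite_Suc) auto
    qed
    then show ?case by blast
  qed
qed

lemma mp_max_attained:
  assumes "c \<noteq> {}"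
  obtains i j where "i \<in> c" "j \<in> c" "mp_max c (Z x) n = mp_forward c (Z x) n i j"
proof -
  obtain i where i: "i \<in> c" "mp_max c (Z x) n = (SUP j\<in>c. mp_forward c (Z x) n i j)"
    unfolding mp_max_def using finite_SUP_attained[OF finite assms] by blast
  obtain j where "j \<in> c" "(SUP j\<in>c. mp_forward c (Z x) n i j) = mp_forward c (Z x) n i j"
    using finite_SUP_attained[OF finite assms] by blast
  with i that show ?thesis by metis
qed

text \<open>The first \<open>L\<close> factors link the class to \<open>i\<close>, and the remaining
  ones are left to the growth of the class. Every node of the class has to be linked, because the
  end \<open>v\<close> of the best path inside it varies with \<open>n\<close>; \<open>L\<close>,
  \<open>C\<close> and \<open>D\<close> depend on the orbit only.\<close>

lemma AE_lower_column:
  assumes path: "edge\<^sup>*\<^sup>* j i" and q: "ereal q < exponent (scc j)"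
  shows "AE x in M. \<forall>\<^sub>F n in sequentially. ereal (q * real n) \<le> (SUP j. mp_forward UNIV (Z x) n j i)"
proof -
  let ?c = "scc j"
  obtain q' where q': "q < q'" "ereal q' < exponent ?c" using q by (rule ereal_less_real_between)
  have "AE x in M. \<forall>k\<in>?c. \<exists>L. \<forall>n\<ge>L. mp_forward UNIV (Z x) n k i \<noteq> -\<infinity>"
    using path by (intro AE_finite_allI AE_connected) (auto simp: scc_def elim: rtranclp_trans)
  moreover have "AE x in M. linear_lower (mp_max ?c (Z x)) q'"
    by (rule exponent_lower[OF scc_nonempty(1) q'(2)])
  \<comment> \<open>The length \<open>L\<close> of the connecting part depends on \<open>x\<close>,
    so the bound must hold after all shifts at once.\<close>
  then have "AE x in M. \<forall>s. linear_lower (mp_max ?c (Z ((T ^^ s) x))) q'"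
    by (rule AE_funpow_T)
  ultimately show ?thesis
  proof eventually_elim
    case (elim x)
    interpret mp_sequence "Z x" by (rule mp_sequence_Z)
    obtain L where L: "\<And>k n. k \<in> ?c \<Longrightarrow> n \<ge> L \<Longrightarrow> mp_forward UNIV (Z x) n k i \<noteq> -\<infinity>"
      using finite_uniform_nat[of ?c "\<lambda>k n. mp_forward UNIV (Z x) n k i \<noteq> -\<infinity>"] elim(1) finite by blast
    obtain C :: nat where C: "\<And>k. k \<in> ?c \<Longrightarrow> ereal (- real C) \<le> mp_forward UNIV (Z x) L k i"
      using finite_lower_bound[of ?c "\<lambda>k. mp_forward UNIV (Z x) L k i", OF finite] L by blast
    obtain D where D: "\<And>n. ereal (q' * n - D) \<le> mp_max ?c (Z ((T ^^ L) x)) n"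
      using elim(2) unfolding linear_lower_def by blast
    have le: "ereal (q' * real n - q' * L - D - C) \<le> (SUP j. mp_forward UNIV (Z x) n j i)"
      if "L \<le> n" for n
    proof -
      let ?y = "(T ^^ L) x"
      obtain u v where uv: "u \<in> ?c" "v \<in> ?c" "mp_max ?c (Z ?y) (n - L) = mp_forward ?c (Z ?y) (n - L) u v"
        using mp_max_attained[OF scc_nonempty(1)] by blast
      have "ereal (q' * real n - q' * L - D - C) = ereal (q' * real (n - L) - D) + ereal (- real C)"
        using that by (simp add: of_nat_diff algebra_simps)
      also have "\<dots> \<le> mp_forward UNIV (Z ?y) (n - L) u v + mp_forward UNIV (Z x) L v i"
        using order_trans[OF D[of "n - L", unfolded uv(3)] mp_forward_mono_set[OF subset_UNIV]] C[OF uv(2)]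
        by (rule add_mono)
      also have "\<dots> \<le> mp_forward UNIV (Z x) n u i"
        using mp_forward_add_ge[of v UNIV L "n - L" u i] that by (simp add: Z_shift)
      also have "\<dots> \<le> (SUP j. mp_forward UNIV (Z x) n j i)" by (rule SUP_upper) simp
      finally show ?thesis .
    qed
    have "\<forall>\<^sub>F n in sequentially. q * real n + (q' * L + D + C) \<le> q' * real n"
      by (rule eventually_linear_le[OF q'(1)])
    then show ?case using eventually_ge_at_top[of L]
    proof eventually_elim
      case (elim n)
      then have "ereal (q * real n) \<le> ereal (q' * real n - q' * L - D - C)" by simp
      with le[OF elim(2)] show ?case by (rule order_trans[rotated])
    qed
  qed
qed

lemma mp_forward_wait:
  assumes "\<And>l. Z x l i i = ereal (d l)"
  shows "ereal (\<Sum>l=k..<k + r. d l) + mp_forward UNIV (Z x) k i j \<le> mp_forward UNIV (Z x) (k + r) i j"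
proof (induction r)
  case (Suc r)
  have "ereal (\<Sum>l=k..<k + Suc r. d l) + mp_forward UNIV (Z x) k i j
      = Z x (k + r) i i + (ereal (\<Sum>l=k..<k + r. d l) + mp_forward UNIV (Z x) k i j)"
    by (simp add: assms add.assoc[symmetric] add.commute)
  also have "\<dots> \<le> Z x (k + r) i i + mp_forward UNIV (Z x) (k + r) i j"
    by (rule add_left_mono[OF Suc])
  also have "\<dots> \<le> mp_forward UNIV (Z x) (k + Suc r) i j"
    using mp_forward_Suc_ge[of i UNIV "Z x" "k + r" i j] by simp
  finally show ?case .
qed simp

text \<open>A path from \<open>i\<close> waits at \<open>i\<close> until the most recent time at which a window of fixed
  length \<open>L\<close> links \<open>i\<close> to all of the component with weight at least \<open>- C\<close>; the waiting
  time is sublinear, and so is its cost because the diagonal is integrable.\<close>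

lemma AE_lower_row:
  assumes int: "integrable M (\<lambda>x. real_of_ereal (A x i i))"
    and path: "edge\<^sup>*\<^sup>* i j" and q: "ereal q < exponent (scc j)"
  shows "AE x in M. \<forall>\<^sub>F n in sequentially. ereal (q * real n) \<le> (SUP j. mp_forward UNIV (Z x) n i j)"
proof -
  let ?c = "scc j"
  let ?d = "\<lambda>x. real_of_ereal (A x i i)"
  define a where "a = (\<integral>x. ?d x \<partial>M)"
  obtain q' where q': "q < q'" "ereal q' < exponent ?c" using q by (rule ereal_less_real_between)
  define V where "V L C = {x. \<forall>k\<in>?c. ereal (- real C) \<le> mp_forward UNIV (Z x) L i k}" for L C :: nat
  have V: "V L C \<in> sets M" for L C
  proof -
    have "{x \<in> space M. \<forall>k\<in>?c. ereal (- real C) \<le> mp_forward UNIV (Z x) L i k} \<in> sets M"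
      by measurable
    then show ?thesis by (simp add: V_def space_UNIV)
  qed
  have "AE x in M. \<forall>k\<in>?c. \<exists>L. \<forall>n\<ge>L. mp_forward UNIV (Z x) n i k \<noteq> -\<infinity>"
    using path by (intro AE_finite_allI AE_connected) (auto simp: scc_def intro: rtranclp_trans)
  then have AE_V: "AE x in M. \<exists>L C. x \<in> V L C"
  proof eventually_elim
    case (elim x)
    obtain L where L: "\<And>k n. k \<in> ?c \<Longrightarrow> n \<ge> L \<Longrightarrow> mp_forward UNIV (Z x) n i k \<noteq> -\<infinity>"
      using finite_uniform_nat[of ?c "\<lambda>k n. mp_forward UNIV (Z x) n i k \<noteq> -\<infinity>"] elim finite by blast
    obtain C :: nat where "\<And>k. k \<in> ?c \<Longrightarrow> ereal (- real C) \<le> mp_forward UNIV (Z x) L i k"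
      using finite_lower_bound[of ?c "\<lambda>k. mp_forward UNIV (Z x) L i k", OF finite] L by blast
    then show ?case by (auto simp: V_def)
  qed
  \<comment> \<open>Visits can be counted only for one fixed event, whereas \<open>L\<close> and
    \<open>C\<close> depend on the point so far; one of these countably many events has positive
    probability.\<close>
  obtain L C where LC: "0 < prob (V L C)"
  proof (rule ccontr)
    assume "\<not> thesis"
    then have "prob (V L C) = 0" for L C using that by (meson zero_less_measure_iff)
    then have "AE x in M. x \<notin> V L C" for L C using prob_eq_0[OF V] by blast
    then have "AE x in M. \<forall>L C. x \<notin> V L C" by (simp add: AE_all_countable)
    with AE_V have "AE x in M. False" by eventually_elim blast
    then show False using AE_ex by blast
  qed
  show ?thesis
    using recent_visit[OF V LC] exponent_lower[OF scc_nonempty(1) q'(2)] birkhoff[OF int, folded a_def]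
      AE_diagonal
  proof eventually_elim
    case (elim x)
    interpret mp_sequence "Z x" by (rule mp_sequence_Z)
    have diag: "Z x l i i = ereal (?d ((T ^^ l) x))" for l
      using elim(4)[rule_format, of l i] not_PInf[of l i i] by (cases "Z x l i i") (auto simp: Z_def)
    obtain D where D: "\<And>n. ereal (q' * n - D) \<le> mp_max ?c (Z x) n"
      using elim(2) unfolding linear_lower_def by blast
    \<comment> \<open>Waiting for up to \<open>\<delta> * n\<close> steps costs the mean
      \<open>a\<close> per step and forgoes the growth \<open>q'\<close>; \<delta> keeps this below
      a quarter of the gap \<open>q' - q\<close>. The waiting cost is a difference of two Birkhoff
      sums with error \<open>e\<close> each, another quarter. Half of the gap remains for the
      constants.\<close>
    define \<delta> where "\<delta> = (q' - q) / (4 * (\<bar>a\<bar> + \<bar>q'\<bar> + 1))"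
    define e where "e = (q' - q) / 8"
    have \<delta>: "\<delta> > 0" and e: "e > 0" using q' by (auto simp: \<delta>_def e_def intro!: divide_pos_pos)
    have "(\<bar>a\<bar> + \<bar>q'\<bar> + 1) * \<delta> = (q' - q) / 4"
      by (simp add: \<delta>_def divide_simps) (auto simp: abs_if)
    then have \<delta>_le: "(\<bar>a\<bar> + \<bar>q'\<bar>) * \<delta> \<le> (q' - q) / 4" using \<delta> by (simp add: algebra_simps)
    obtain B where B: "\<And>n. \<bar>(\<Sum>l<n. ?d ((T ^^ l) x)) - n * a\<bar> \<le> e * n + B" using elim(3) e by blast
    \<comment> \<open>The summands stem from the growth forgone during the window, the two Birkhoff
      sums, the weight of the window and the lower bound for the class.\<close>
    define K where "K = \<bar>q'\<bar> * L + 2 * B + C + D"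
    have lower: "ereal (q' * real n - (\<bar>a\<bar> + \<bar>q'\<bar>) * \<delta> * real n - 2 * e * real n - K)
        \<le> (SUP j. mp_forward UNIV (Z x) n i j)"
      if "L \<le> n" and k: "k < n - L" "real (n - L) \<le> real k + \<delta> * real (n - L)" "(T ^^ k) x \<in> V L C" for n k
    proof -
      \<comment> \<open>The time up to \<open>n\<close> consists of \<open>k\<close> steps of growth
        in the class, the window of length \<open>L\<close>, and \<open>r\<close> steps of waiting
        at \<open>i\<close>.\<close>
      define r where "r = n - (L + k)"
      have n: "n = L + k + r" using k by (simp add: r_def)
      let ?y = "(T ^^ k) x"
      let ?s = "\<Sum>l=L + k..<n. ?d ((T ^^ l) x)"
      obtain u v where uv: "u \<in> ?c" "v \<in> ?c" "mp_max ?c (Z x) k = mp_forward ?c (Z x) k u v"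
        using mp_max_attained[OF scc_nonempty(1)] by blast
      have "real r \<le> \<delta> * real (n - L)" using k(2) by (simp add: n)
      also have "\<dots> \<le> \<delta> * real n" using \<delta> by (intro mult_left_mono) auto
      finally have r: "real r \<le> \<delta> * real n" .
      have s: "- (\<bar>a\<bar> * \<delta> * n) - 2 * e * n - 2 * B \<le> ?s"
      proof -
        have "(\<Sum>l<L + k. ?d ((T ^^ l) x)) + ?s = (\<Sum>l<n. ?d ((T ^^ l) x))"
          unfolding lessThan_atLeast0 by (rule sum.atLeastLessThan_concat) (auto simp: n)
        moreover have "e * real (L + k) \<le> e * real n" using e by (auto simp: n)
        moreover have "real n * a = real (L + k) * a + real r * a" by (simp add: n algebra_simps)
        moreover have "- (real r * a) \<le> \<bar>a\<bar> * \<delta> * n"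
        proof -
          have "- (real r * a) \<le> \<bar>a\<bar> * real r" using abs_ge_minus_self[of "real r * a"] by (simp add: abs_mult mult.commute)
          also have "\<dots> \<le> \<bar>a\<bar> * (\<delta> * n)" by (rule mult_left_mono[OF r]) simp
          finally show ?thesis by (simp add: mult.assoc)
        qed
        ultimately show ?thesis using B[of n] B[of "L + k"] by (simp only: abs_le_iff) linarith
      qed
      have qk: "q' * n - \<bar>q'\<bar> * \<delta> * n - \<bar>q'\<bar> * L \<le> q' * k"
      proof -
        have "q' * n - q' * k = q' * (L + r)" by (simp add: n algebra_simps)
        also have "\<dots> \<le> \<bar>q'\<bar> * (L + r)" by (intro mult_right_mono) auto
        also have "\<dots> = \<bar>q'\<bar> * L + \<bar>q'\<bar> * r" by (simp add: algebra_simps)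
        also have "\<bar>q'\<bar> * r \<le> \<bar>q'\<bar> * (\<delta> * n)" by (rule mult_left_mono[OF r]) simp
        finally show ?thesis by (simp add: mult.assoc)
      qed
      have "ereal (q' * real n - (\<bar>a\<bar> + \<bar>q'\<bar>) * \<delta> * real n - 2 * e * real n - K)
          \<le> ereal ?s + (ereal (- real C) + ereal (q' * k - D))"
        using s qk by (simp add: K_def algebra_simps)
      also have "\<dots> \<le> ereal ?s + (mp_forward UNIV (Z ?y) L i u + mp_forward UNIV (Z x) k u v)"
      proof (intro add_mono order_refl)
        show "ereal (- real C) \<le> mp_forward UNIV (Z ?y) L i u" using k(3) uv(1) by (auto simp: V_def)
        show "ereal (q' * k - D) \<le> mp_forward UNIV (Z x) k u v"
          by (rule order_trans[OF D[of k, unfolded uv(3)] mp_forward_mono_set[OF subset_UNIV]])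
      qed
      also have "\<dots> \<le> ereal ?s + mp_forward UNIV (Z x) (L + k) i v"
        using mp_forward_add_ge[of u UNIV k L i v] by (intro add_left_mono) (simp add: Z_shift)
      also have "\<dots> \<le> mp_forward UNIV (Z x) n i v"
        using mp_forward_wait[OF diag, of "L + k" r v] by (simp add: n)
      also have "\<dots> \<le> (SUP j. mp_forward UNIV (Z x) n i j)" by (rule SUP_upper) simp
      finally show ?thesis .
    qed
    have "\<forall>\<^sub>F n in sequentially. \<exists>k<n - L. real (n - L) \<le> real k + \<delta> * real (n - L) \<and> (T ^^ k) x \<in> V L C"
    proof -
      \<comment> \<open>The visit is sought before \<open>n - L\<close>, so that the window starting
        there is complete by time \<open>n\<close>.\<close>
      have "filterlim (\<lambda>n. n - L) sequentially sequentially" by (rule filterlim_minus_const_nat_at_top)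
      then show ?thesis
        by (rule eventually_compose_filterlim[rotated]) (use elim(1) \<delta> in blast)
    qed
    moreover have "\<forall>\<^sub>F n in sequentially. q * real n + K \<le> (q' - (q' - q) / 2) * real n"
      by (rule eventually_linear_le) (use q' in \<open>simp add: field_simps\<close>)
    ultimately show ?case using eventually_ge_at_top[of L]
    proof eventually_elim
      case (elim n)
      then obtain k where k: "k < n - L" "real (n - L) \<le> real k + \<delta> * real (n - L)" "(T ^^ k) x \<in> V L C"
        by blast
      have "(\<bar>a\<bar> + \<bar>q'\<bar>) * \<delta> * real n \<le> (q' - q) / 4 * real n"
        using \<delta>_le by (rule mult_right_mono) simp
      moreover have "2 * e * real n = (q' - q) / 4 * real n" by (simp add: e_def)
      moreover have "(q' - (q' - q) / 2) * real n = q' * real n - 2 * ((q' - q) / 4 * real n)"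
        by (simp add: field_simps)
      ultimately have "q * real n \<le> q' * real n - (\<bar>a\<bar> + \<bar>q'\<bar>) * \<delta> * real n - 2 * e * real n - K"
        using elim(2) by linarith
      then have "ereal (q * real n) \<le> ereal (q' * real n - (\<bar>a\<bar> + \<bar>q'\<bar>) * \<delta> * real n - 2 * e * real n - K)"
        by simp
      with lower[OF elim(3) k] show ?case by (rule order_trans[rotated])
    qed
  qed
qed

lemma SUP_exponent_not_PInf:
  assumes "J \<noteq> {}"
  shows "(SUP j\<in>J. exponent (scc j)) \<noteq> \<infinity>"
proof -
  obtain j where "(SUP j\<in>J. exponent (scc j)) = exponent (scc j)"
    using finite_SUP_attained[OF finite assms] by blast
  then show ?thesis using exponent_not_PInf[OF scc_nonempty(1)] by simp
qed

theorem row_limit: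
  assumes "integrable M (\<lambda>x. real_of_ereal (A x i i))"
  shows "AE x in M. rmax_tendsto (\<lambda>n. ereal (1 / real n) * (SUP j. mp_forward UNIV (Z x) n i j))
    (SUP j\<in>{j. edge\<^sup>*\<^sup>* i j}. exponent (scc j))"
proof (rule AE_rmax_tendsto)
  show "(SUP j\<in>{j. edge\<^sup>*\<^sup>* i j}. exponent (scc j)) \<noteq> \<infinity>"
    by (rule SUP_exponent_not_PInf) auto
next
  fix q assume "ereal q < (SUP j\<in>{j. edge\<^sup>*\<^sup>* i j}. exponent (scc j))"
  then obtain j where "edge\<^sup>*\<^sup>* i j" "ereal q < exponent (scc j)" by (auto simp: less_SUP_iff)
  then show "AE x in M. \<forall>\<^sub>F n in sequentially. ereal (q * real n) \<le> (SUP j. mp_forward UNIV (Z x) n i j)"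
    by (rule AE_lower_row[OF assms])
next
  fix q assume "(SUP j\<in>{j. edge\<^sup>*\<^sup>* i j}. exponent (scc j)) < ereal q"
  then obtain q' where q': "q' < q" "(SUP j\<in>{j. edge\<^sup>*\<^sup>* i j}. exponent (scc j)) < ereal q'"
    by (rule ereal_less_real_between')
  show "AE x in M. \<forall>\<^sub>F n in sequentially. (SUP j. mp_forward UNIV (Z x) n i j) \<le> ereal (q * real n)"
  proof (rule AE_upper_row[OF _ q'(1)])
    fix j assume "edge\<^sup>*\<^sup>* i j"
    then show "exponent (scc j) < ereal q'"
      by (intro le_less_trans[OF SUP_upper q'(2)]) simp
  qed
qed

theorem column_limit:
  "AE x in M. rmax_tendsto (\<lambda>n. ereal (1 / real n) * (SUP j. mp_forward UNIV (Z x) n j i))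
    (SUP j\<in>{j. edge\<^sup>*\<^sup>* j i}. exponent (scc j))"
proof (rule AE_rmax_tendsto)
  show "(SUP j\<in>{j. edge\<^sup>*\<^sup>* j i}. exponent (scc j)) \<noteq> \<infinity>"
    by (rule SUP_exponent_not_PInf) auto
next
  fix q assume "ereal q < (SUP j\<in>{j. edge\<^sup>*\<^sup>* j i}. exponent (scc j))"
  then obtain j where "edge\<^sup>*\<^sup>* j i" "ereal q < exponent (scc j)" by (auto simp: less_SUP_iff)
  then show "AE x in M. \<forall>\<^sub>F n in sequentially. ereal (q * real n) \<le> (SUP j. mp_forward UNIV (Z x) n j i)"
    by (rule AE_lower_column)
next
  fix q assume "(SUP j\<in>{j. edge\<^sup>*\<^sup>* j i}. exponent (scc j)) < ereal q"
  then obtain q' where q': "q' < q" "(SUP j\<in>{j. edge\<^sup>*\<^sup>* j i}. exponent (scc j)) < ereal q'"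
    by (rule ereal_less_real_between')
  show "AE x in M. \<forall>\<^sub>F n in sequentially. (SUP j. mp_forward UNIV (Z x) n j i) \<le> ereal (q * real n)"
  proof (rule AE_upper_column[OF _ q'(1)])
    fix j assume "edge\<^sup>*\<^sup>* j i"
    then show "exponent (scc j) < ereal q'"
      by (intro le_less_trans[OF SUP_upper q'(2)]) simp
  qed
qed

end

section \<open>Reversal of stationary ergodic processes\<close>

abbreviation path_space :: "('i \<Rightarrow> 'b::topological_space) measure" where
  "path_space \<equiv> \<Pi>\<^sub>M n\<in>UNIV. borel"

lemma space_path_space: "space path_space = UNIV"
  by (simp add: space_PiM)

text \<open>Shifts, time reversal and restriction to the nonnegative coordinates are all of this
  form.\<close>

lemma measurable_reindex [measurable]: "(\<lambda>x j. x (g j)) \<in> path_space \<rightarrow>\<^sub>M path_space"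
  by (rule measurable_PiM_single') auto

lemma measurable_path:
  assumes "\<And>n. X n \<in> borel_measurable M"
  shows "(\<lambda>\<omega> n. X n \<omega>) \<in> M \<rightarrow>\<^sub>M path_space"
  by (rule measurable_PiM_single') (simp_all add: assms PiE_def extensional_def)

lemma sets_process_law [measurable_cong]: "sets (process_law M X) = sets path_space"
  by (simp add: process_law_def)

lemma measurable_reindex_process_law:
  "(\<lambda>x j. x (g j)) \<in> process_law M X \<rightarrow>\<^sub>M process_law N Y"
  by (subst measurable_cong_sets[OF sets_process_law sets_process_law]) (rule measurable_reindex)

lemma space_process_law: "space (process_law M X) = UNIV"
  by (simp add: process_law_def space_path_space)

lemma prob_space_process_law:
  "prob_space M \<Longrightarrow> (\<And>n. X n \<in> borel_measurable M) \<Longrightarrow> prob_space (process_law M X)"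
  unfolding process_law_def by (intro prob_space.prob_space_distr measurable_path)

lemma distr_reindex_process_law:
  assumes "\<And>n. X n \<in> borel_measurable M"
  shows "distr (process_law M X) path_space (\<lambda>x j. x (g j)) = process_law M (\<lambda>j. X (g j))"
  unfolding process_law_def
  by (subst distr_distr[OF measurable_reindex measurable_path[OF assms]]) (simp add: comp_def)

lemma process_law_reindex_eq:
  assumes "\<And>n. X n \<in> borel_measurable M" "\<And>n. Y n \<in> borel_measurable N"
    and "process_law M X = process_law N Y"
  shows "process_law M (\<lambda>j. X (g j)) = process_law N (\<lambda>j. Y (g j))"
proof -
  have "process_law M (\<lambda>j. X (g j)) = distr (process_law M X) path_space (\<lambda>x j. x (g j))"
    by (rule distr_reindex_process_law[OF assms(1), symmetric])
  also have "\<dots> = process_law N (\<lambda>j. Y (g j))"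
    unfolding assms(3) by (rule distr_reindex_process_law[OF assms(2)])
  finally show ?thesis .
qed

lemma funpow_shift: "((\<lambda>x n. x (n + 1)) ^^ k) x = (\<lambda>n::nat. x (n + k))"
  by (induction k arbitrary: x) (auto simp: funpow_swap1)

text \<open>A stationary process need not come with a transformation of its probability space; on
  path space the shift is one.\<close>

lemma ergodic_system_process_law:
  fixes X :: "nat \<Rightarrow> 'a \<Rightarrow> 'b::topological_space"
  assumes M: "prob_space M" and st: "stationary_process M X" and er: "ergodic_process M X"
  shows "ergodic_system (process_law M X) (\<lambda>x n. x (n + 1))"
proof -
  let ?P = "process_law M X"
  have X: "\<And>n. X n \<in> borel_measurable M" using st unfolding stationary_process_def by blast
  interpret P: prob_space ?P by (rule prob_space_process_law[OF M X])
  show ?thesis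
  proof
    show "space ?P = UNIV" by (rule space_process_law)
    show "(\<lambda>x n. x (n + 1)) \<in> ?P \<rightarrow>\<^sub>M ?P" by (rule measurable_reindex_process_law)
    have "distr ?P ?P (\<lambda>x n. x (n + 1)) = distr ?P path_space (\<lambda>x n. x (n + 1))"
      by (rule distr_cong) (simp_all add: sets_process_law)
    also have "\<dots> = process_law M (\<lambda>n. X (n + 1))"
      by (rule distr_reindex_process_law[OF X])
    also have "\<dots> = ?P" using st unfolding stationary_process_def by blast
    finally show "distr ?P ?P (\<lambda>x n. x (n + 1)) = ?P" .
  next
    fix E assume E: "E \<in> sets ?P" "(\<lambda>x n. x (n + 1)) -` E = E"
    then have "P.prob E = \<P>(\<omega> in M. (\<lambda>n. X n \<omega>) \<in> E)"
      unfolding process_law_def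
      by (subst measure_distr[OF measurable_path[OF X]]) (auto intro!: arg_cong[where f = "measure M"])
    then show "P.prob E = 0 \<or> P.prob E = 1"
      using er E unfolding ergodic_process_def sets_process_law by auto
  qed
qed

text \<open>Stationarity is stated for one step forward; a shift to the left is compared with the
  shift to the right that undoes it.\<close>

lemma stationary_process_shift:
  fixes B :: "int \<Rightarrow> 'a \<Rightarrow> 'b::topological_space"
  assumes st: "stationary_process N B"
  shows "process_law N (\<lambda>k. B (k + m)) = process_law N B"
proof -
  have B: "\<And>n. B n \<in> borel_measurable N" and eq: "process_law N (\<lambda>k. B (k + 1)) = process_law N B"
    using st unfolding stationary_process_def by blast+
  have nat: "process_law N (\<lambda>k. B (k + int n)) = process_law N B" for n
  proof (induction n)
    case (Suc n)
    have "process_law N (\<lambda>k. B (k + int n + 1)) = process_law N (\<lambda>k. B (k + int n))"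
      by (rule process_law_reindex_eq[OF B B eq, of "\<lambda>k. k + int n"])
    also have "\<dots> = process_law N B" by (rule Suc)
    also have "(\<lambda>k. B (k + int n + 1)) = (\<lambda>k. B (k + int (Suc n)))" by (simp add: ac_simps)
    finally show ?case .
  qed simp
  show ?thesis
  proof (cases "0 \<le> m")
    case True
    with nat[of "nat m"] show ?thesis by simp
  next
    case False
    have "process_law N (\<lambda>k. B (k + m + int (nat (- m)))) = process_law N (\<lambda>k. B (k + m))"
      by (rule process_law_reindex_eq[OF B B nat, of "\<lambda>k. k + m"])
    with False show ?thesis by simp
  qed
qed

lemma stationary_process_reverse:
  fixes B :: "int \<Rightarrow> 'a \<Rightarrow> 'b::topological_space"
  assumes st: "stationary_process N B"
  shows "stationary_process N (\<lambda>n::nat. B (- int n - 1))"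
proof -
  have B: "\<And>n. B n \<in> borel_measurable N" using st unfolding stationary_process_def by blast
  have shift: "- int n - 1 + (- 1) = - int (n + 1) - 1" for n by simp
  have "process_law N (\<lambda>n::nat. B (- int n - 1 + (- 1))) = process_law N (\<lambda>n::nat. B (- int n - 1))"
    by (rule process_law_reindex_eq[OF B B stationary_process_shift[OF st], of "\<lambda>n. - int n - 1"])
  then show ?thesis using B unfolding stationary_process_def shift by blast
qed

text \<open>An event \<open>D\<close> that is invariant under the two-sided shift is independent of the
  nonnegative coordinates by Birkhoff's theorem for the one-sided process, hence, shifting, of
  every cylinder event, hence of itself.\<close>

lemma ergodic_process_reverse:
  fixes B :: "int \<Rightarrow> 'a \<Rightarrow> 'b::topological_space"
  assumes N: "prob_space N" and st: "stationary_process N B"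
    and er: "ergodic_process N (\<lambda>n::nat. B (int n))"
  shows "ergodic_process N (\<lambda>n::nat. B (- int n - 1))"
  unfolding ergodic_process_def
proof (intro ballI impI)
  fix E :: "(nat \<Rightarrow> 'b) set"
  assume E: "E \<in> sets path_space" and inv: "(\<lambda>x n. x (n + 1)) -` E = E"
  have B: "\<And>n. B n \<in> borel_measurable N" using st unfolding stationary_process_def by blast
  define Q where "Q = process_law N B"
  interpret Q: prob_space Q unfolding Q_def by (rule prob_space_process_law[OF N B])
  have sets_Q [measurable_cong]: "sets Q = sets path_space" by (simp add: Q_def sets_process_law)
  have space_Q: "space Q = UNIV" by (simp add: Q_def space_process_law)
  define pos :: "(int \<Rightarrow> 'b) \<Rightarrow> nat \<Rightarrow> 'b" where "pos x n = x (int n)" for x n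
  define sh :: "int \<Rightarrow> (int \<Rightarrow> 'b) \<Rightarrow> int \<Rightarrow> 'b" where "sh m x k = x (k + m)" for m x k
  define \<mu> where "\<mu> = process_law N (\<lambda>n::nat. B (int n))"
  have sh_meas [measurable]: "sh m \<in> Q \<rightarrow>\<^sub>M Q" for m
    unfolding sh_def[abs_def] Q_def by (rule measurable_reindex_process_law)
  have distr_sh: "distr Q Q (sh m) = Q" for m
  proof -
    have "distr Q Q (sh m) = distr Q path_space (\<lambda>x k. x (k + m))"
      by (rule distr_cong) (simp_all add: sets_Q sh_def fun_eq_iff)
    also have "\<dots> = process_law N (\<lambda>k. B (k + m))"
      unfolding Q_def by (rule distr_reindex_process_law[OF B])
    also have "\<dots> = Q" unfolding Q_def by (rule stationary_process_shift[OF st])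
    finally show ?thesis .
  qed
  have st_pos: "stationary_process N (\<lambda>n::nat. B (int n))"
  proof -
    have shift: "int n + 1 = int (n + 1)" for n by simp
    have "process_law N (\<lambda>n::nat. B (int n + 1)) = process_law N (\<lambda>n::nat. B (int n))"
      by (rule process_law_reindex_eq[OF B B stationary_process_shift[OF st], of int])
    then show ?thesis using B unfolding stationary_process_def shift by blast
  qed
  interpret \<mu>: ergodic_system \<mu> "\<lambda>x n. x (n + 1)"
    unfolding \<mu>_def by (rule ergodic_system_process_law[OF N st_pos er])
  have sets_\<mu> [measurable_cong]: "sets \<mu> = sets path_space" by (simp add: \<mu>_def sets_process_law)
  have pos_meas [measurable]: "pos \<in> Q \<rightarrow>\<^sub>M \<mu>"
    unfolding pos_def[abs_def] Q_def \<mu>_def by (rule measurable_reindex_process_law)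
  have distr_pos: "distr Q \<mu> pos = \<mu>"
  proof -
    have "distr Q \<mu> pos = distr Q path_space (\<lambda>x n. x (int n))"
      by (rule distr_cong) (simp_all add: sets_\<mu> pos_def fun_eq_iff)
    also have "\<dots> = \<mu>"
      unfolding Q_def \<mu>_def by (rule distr_reindex_process_law[OF B])
    finally show ?thesis .
  qed
  \<comment> \<open>The event \<open>E\<close> for the reversed process, read off the negative
    coordinates.\<close>
  define D where "D = {x :: int \<Rightarrow> 'b. (\<lambda>n::nat. x (- int n - 1)) \<in> E}"
  have D [measurable]: "D \<in> sets Q"
  proof -
    have "(\<lambda>x (n::nat). x (- int n - 1)) -` E \<inter> space path_space \<in> sets path_space"
      by (rule measurable_sets[OF measurable_reindex E])
    then show ?thesis by (simp add: D_def sets_Q space_path_space vimage_def)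
  qed
  have D_sh1: "sh 1 x \<in> D \<longleftrightarrow> x \<in> D" for x
  proof -
    have "sh 1 x \<in> D \<longleftrightarrow> (\<lambda>n::nat. x (- int n)) \<in> E" by (simp add: D_def sh_def)
    \<comment> \<open>The shifted path shows the coordinates 0, -1, -2, ...; invariance of
      \<open>E\<close> allows coordinate 0 to be dropped.\<close>
    also have "\<dots> \<longleftrightarrow> (\<lambda>n::nat. x (- int (n + 1))) \<in> E"
      by (subst (1) inv[symmetric]) (simp add: vimage_def)
    also have "(\<lambda>n::nat. x (- int (n + 1))) = (\<lambda>n. x (- int n - 1))" by (intro ext arg_cong[where f = x]) simp
    finally show ?thesis by (simp add: D_def)
  qed
  have D_sh: "sh (int k) x \<in> D \<longleftrightarrow> x \<in> D" for k x
  proof (induction k)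
    case (Suc k)
    have "sh (int (Suc k)) x = sh 1 (sh (int k) x)" by (simp add: sh_def fun_eq_iff algebra_simps)
    then show ?case using D_sh1 Suc by simp
  qed (simp add: sh_def)
  \<comment> \<open>\<open>D\<close> and \<open>Q\<close> are shift invariant, so each shifted copy
    of the future event meets \<open>D\<close> with the same probability; averaging over the copies
    replaces its indicator by the constant \<open>\<mu>.prob G\<close> in the limit.\<close>
  have indep_pos: "Q.prob (D \<inter> pos -` G) = Q.prob D * \<mu>.prob G" if G [measurable]: "G \<in> sets \<mu>" for G
  proof -
    have pG [measurable]: "pos -` G \<in> sets Q"
      using measurable_sets[OF pos_meas G] by (simp add: space_Q)
    let ?S = "\<lambda>n x. (\<Sum>k<n. indicator (pos -` G) (sh (int k) x)) / n :: real"
    have "integrable \<mu> (indicator G :: _ \<Rightarrow> real)"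
      by (intro integrable_real_indicator G) (simp add: less_top[symmetric])
    then have "AE y in \<mu>. (\<lambda>n. (\<Sum>k<n. indicator G (((\<lambda>x n. x (n + 1)) ^^ k) y)) / n) \<longlonglongrightarrow> \<mu>.prob G"
      using \<mu>.birkhoff_tendsto[of "indicator G"] \<mu>.space_UNIV by simp
    then have "AE y in distr Q \<mu> pos. (\<lambda>n. (\<Sum>k<n. indicator G (((\<lambda>x n. x (n + 1)) ^^ k) y)) / n) \<longlonglongrightarrow> \<mu>.prob G"
      by (simp only: distr_pos)
    from AE_distrD[OF pos_meas this]
    have avg: "AE x in Q. (\<lambda>n. ?S n x) \<longlonglongrightarrow> \<mu>.prob G"
      unfolding funpow_shift by (simp add: pos_def[abs_def] sh_def[abs_def] indicator_def)
    have "(\<lambda>n. \<integral>x. indicator D x * ?S n x \<partial>Q) \<longlonglongrightarrow> (\<integral>x. indicator D x * \<mu>.prob G \<partial>Q)"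
    proof (rule integral_dominated_convergence[where w = "\<lambda>_. 1"])
      show "AE x in Q. (\<lambda>n. indicator D x * ?S n x) \<longlonglongrightarrow> indicator D x * \<mu>.prob G"
        using avg by eventually_elim (rule tendsto_mult_left)
      show "AE x in Q. norm (indicator D x * ?S n x) \<le> 1" for n
      proof (rule AE_I2)
        fix x
        have "(\<Sum>k<n. indicator (pos -` G) (sh (int k) x) :: real) \<le> (\<Sum>k<n. 1)"
          by (rule sum_mono) (simp add: indicator_def)
        then have "?S n x \<le> 1" by (cases "n = 0") (simp_all add: divide_le_eq)
        moreover have "0 \<le> ?S n x" by (intro divide_nonneg_nonneg sum_nonneg) auto
        ultimately show "norm (indicator D x * ?S n x) \<le> 1" by (simp add: indicator_def)
      qed
    qed auto
    moreover have "(\<integral>x. indicator D x * ?S n x \<partial>Q) = Q.prob (D \<inter> pos -` G)" if "0 < n" for n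
    proof -
      have single: "(\<integral>x. indicator D x * indicator (pos -` G) (sh (int k) x) \<partial>Q) = Q.prob (D \<inter> pos -` G)" for k
      proof -
        have "(\<integral>x. indicator D x * indicator (pos -` G) (sh (int k) x) \<partial>Q :: real)
            = (\<integral>x. indicator (D \<inter> pos -` G) (sh (int k) x) \<partial>Q)"
          by (intro Bochner_Integration.integral_cong refl) (simp add: indicator_def D_sh)
        also have "\<dots> = (\<integral>x. indicator (D \<inter> pos -` G) x \<partial>distr Q Q (sh (int k)))"
          by (rule integral_distr[symmetric]) auto
        also have "\<dots> = Q.prob (D \<inter> pos -` G)" by (simp add: distr_sh space_Q)
        finally show ?thesis .
      qed
      have ti: "integrable Q (\<lambda>x. indicator D x * indicator (pos -` G) (sh (int k) x) :: real)" for k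
        by (rule Q.integrable_const_bound[where B = 1]) (auto simp: indicator_def)
      have "(\<integral>x. indicator D x * ?S n x \<partial>Q)
          = (\<integral>x. (\<Sum>k<n. indicator D x * indicator (pos -` G) (sh (int k) x)) / n \<partial>Q)"
        by (simp add: sum_distrib_left)
      also have "\<dots> = (\<Sum>k<n. \<integral>x. indicator D x * indicator (pos -` G) (sh (int k) x) \<partial>Q) / n"
        by (subst integral_divide_zero) (subst Bochner_Integration.integral_sum[OF ti], simp)
      also have "\<dots> = Q.prob (D \<inter> pos -` G)" using that by (simp only: single) simp
      finally show ?thesis .
    qed
    then have "\<forall>\<^sub>F n in sequentially. (\<integral>x. indicator D x * ?S n x \<partial>Q) = Q.prob (D \<inter> pos -` G)"
      by (rule eventually_mono[OF eventually_gt_at_top[of 0]])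
    then have "(\<lambda>n. \<integral>x. indicator D x * ?S n x \<partial>Q) \<longlonglongrightarrow> Q.prob (D \<inter> pos -` G)"
      by (rule tendsto_eventually)
    ultimately have "Q.prob (D \<inter> pos -` G) = (\<integral>x. indicator D x * \<mu>.prob G \<partial>Q)"
      using LIMSEQ_unique by blast
    then show ?thesis by (simp add: space_Q)
  qed
  \<comment> \<open>Finite measures that agree on cylinders are equal; evaluated at \<open>D\<close>
    itself, this equality says that \<open>Q.prob D\<close> is its own square.\<close>
  have "density Q (indicator D) = scale_measure (emeasure Q D) Q"
  proof (rule measure_eqI_PiM_infinite)
    show "sets (density Q (indicator D)) = sets path_space"
      "sets (scale_measure (emeasure Q D) Q) = sets path_space" by (simp_all add: sets_Q)
    show "finite_measure (density Q (indicator D))"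
      by (rule finite_measureI) (simp add: emeasure_restricted)
  next
    fix F :: "int \<Rightarrow> 'b set" and J assume J: "finite J" "\<And>i. i \<in> J \<Longrightarrow> F i \<in> sets borel"
    let ?cyl = "prod_emb UNIV (\<lambda>_. borel) J (Pi\<^sub>E J F)"
    have cyl_eq: "?cyl = {x. \<forall>j\<in>J. x j \<in> F j}"
      by (auto simp: prod_emb_def space_PiM)
    have cyl [measurable]: "?cyl \<in> sets Q" unfolding sets_Q by (rule sets_PiM_I) (use J in auto)
    \<comment> \<open>A shift that moves all coordinates of the cylinder into the future; the sum of
      absolute values also works for empty \<open>J\<close>.\<close>
    obtain m :: nat where m: "\<And>j. j \<in> J \<Longrightarrow> 0 \<le> j + int m"
    proof
      fix j assume "j \<in> J"
      then have "\<bar>j\<bar> \<le> (\<Sum>j\<in>J. \<bar>j\<bar>)" using J by (intro member_le_sum) auto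
      then show "0 \<le> j + int (nat (\<Sum>j\<in>J. \<bar>j\<bar>))" by linarith
    qed
    define G where "G = {y :: nat \<Rightarrow> 'b. \<forall>j\<in>J. y (nat (j + int m)) \<in> F j}"
    have G: "G \<in> sets \<mu>"
    proof -
      have "{y \<in> space path_space. \<forall>j\<in>J. y (nat (j + int m)) \<in> F j} \<in> sets (path_space :: (nat \<Rightarrow> 'b) measure)"
        using J by (intro sets.sets_Collect_finite_All measurable_sets_Collect[OF measurable_component_singleton]) auto
      then show ?thesis by (simp add: G_def sets_\<mu> space_path_space)
    qed
    have sh_cyl: "sh (int m) -` ?cyl = pos -` G"
      using m by (auto simp: cyl_eq sh_def pos_def G_def)
    have prob_sh: "Q.prob (sh (int m) -` H) = Q.prob H" if "H \<in> sets Q" for H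
      using measure_distr[OF sh_meas that, of "int m"] by (simp add: distr_sh space_Q)
    have "Q.prob (D \<inter> ?cyl) = Q.prob (sh (int m) -` (D \<inter> ?cyl))" by (rule prob_sh[symmetric]) auto
    also have "sh (int m) -` (D \<inter> ?cyl) = D \<inter> pos -` G" using D_sh sh_cyl by auto
    also have "Q.prob (D \<inter> pos -` G) = Q.prob D * \<mu>.prob G" by (rule indep_pos[OF G])
    also have "\<mu>.prob G = Q.prob (pos -` G)"
      using measure_distr[OF pos_meas G] by (simp add: distr_pos space_Q)
    also have "\<dots> = Q.prob ?cyl" using prob_sh[OF cyl] by (simp add: sh_cyl)
    finally have "Q.prob (D \<inter> ?cyl) = Q.prob D * Q.prob ?cyl" .
    then show "emeasure (density Q (indicator D)) ?cyl = emeasure (scale_measure (emeasure Q D) Q) ?cyl"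
      by (simp add: emeasure_restricted Q.emeasure_eq_measure ennreal_mult)
  qed
  then have "emeasure Q D = emeasure Q D * emeasure Q D"
    using emeasure_restricted[OF D D] by simp
  then have "Q.prob D = Q.prob D * Q.prob D"
    by (simp add: Q.emeasure_eq_measure ennreal_mult[symmetric])
  then have "Q.prob D \<in> {0, 1}" by auto
  moreover have "Q.prob D = \<P>(\<omega> in N. (\<lambda>n. B (- int n - 1) \<omega>) \<in> E)"
  proof -
    have "Q.prob D = measure N ((\<lambda>\<omega> n. B n \<omega>) -` D \<inter> space N)"
      unfolding Q_def process_law_def
      by (rule measure_distr[OF measurable_path[OF B]]) (use D in \<open>simp add: sets_Q\<close>)
    also have "(\<lambda>\<omega> n. B n \<omega>) -` D \<inter> space N = {\<omega> \<in> space N. (\<lambda>n. B (- int n - 1) \<omega>) \<in> E}"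
      by (auto simp: D_def)
    finally show ?thesis .
  qed
  ultimately show "\<P>(\<omega> in N. (\<lambda>n. B (- int n - 1) \<omega>) \<in> E) \<in> {0, 1}" by simp
qed

section \<open>Max-plus products of a process and of its reversal\<close>

lemma integral_indicator_Collect:
  "(\<integral>x. indicat_real {x \<in> space M. P x} x \<partial>M) = \<P>(x in M. P x)"
  unfolding Bochner_Integration.integral_indicator by (rule arg_cong[where f = "measure M"]) blast

text \<open>For \<open>c\<close> strictly between \<open>b\<close> and \<open>a\<close>, the
  probability of being below \<open>c\<close> would tend to 0 on one space and to 1 on the other.
  Only the laws for each single \<open>n\<close> are compared, so the two sequences may live on
  different spaces.\<close>

lemma AE_limit_le_of_equal_laws:
  fixes u :: "nat \<Rightarrow> 'a \<Rightarrow> ereal" and v :: "nat \<Rightarrow> 'b \<Rightarrow> ereal"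
  assumes M: "prob_space M" and N: "prob_space N"
    and um: "\<And>n. u n \<in> borel_measurable M" and vm: "\<And>n. v n \<in> borel_measurable N"
    and law: "\<And>n c. measure M {x \<in> space M. u n x < c} = measure N {x \<in> space N. v n x < c}"
    and u: "AE x in M. (\<lambda>n. u n x) \<longlonglongrightarrow> a" and v: "AE x in N. (\<lambda>n. v n x) \<longlonglongrightarrow> b"
  shows "a \<le> b"
proof (rule ccontr)
  interpret M: prob_space M by fact
  interpret N: prob_space N by fact
  assume "\<not> a \<le> b"
  then obtain c where c: "b < c" "c < a" using dense[of b a] by (auto simp: not_le)
  have M_lim: "(\<lambda>n. \<integral>x. indicator {x \<in> space M. u n x < c} x \<partial>M) \<longlonglongrightarrow> (\<integral>x. 0 \<partial>M :: real)"
  proof (rule integral_dominated_convergence[where w = "\<lambda>_. 1"])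
    show "AE x in M. (\<lambda>n. indicator {x \<in> space M. u n x < c} x :: real) \<longlonglongrightarrow> 0"
      using u
    proof eventually_elim
      case (elim x)
      from order_tendstoD(1)[OF this c(2)] show ?case
        by (intro tendsto_eventually) (auto elim!: eventually_mono simp: indicator_def)
    qed
    show "indicator {x \<in> space M. u n x < c} \<in> borel_measurable M" for n
      by (intro borel_measurable_indicator borel_measurable_less[OF um borel_measurable_const])
    show "AE x in M. norm (indicator {x \<in> space M. u n x < c} x :: real) \<le> 1" for n
      by (rule AE_I2) (simp add: indicator_def)
  qed simp_all
  have N_lim: "(\<lambda>n. \<integral>x. indicator {x \<in> space N. v n x < c} x \<partial>N) \<longlonglongrightarrow> (\<integral>x. 1 \<partial>N :: real)"
  proof (rule integral_dominated_convergence[where w = "\<lambda>_. 1"])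
    show "AE x in N. (\<lambda>n. indicator {x \<in> space N. v n x < c} x :: real) \<longlonglongrightarrow> 1"
      using v AE_space
    proof eventually_elim
      case (elim x)
      from order_tendstoD(2)[OF elim(1) c(1)] elim(2) show ?case
        by (intro tendsto_eventually) (auto elim!: eventually_mono simp: indicator_def)
    qed
    show "indicator {x \<in> space N. v n x < c} \<in> borel_measurable N" for n
      by (intro borel_measurable_indicator borel_measurable_less[OF vm borel_measurable_const])
    show "AE x in N. norm (indicator {x \<in> space N. v n x < c} x :: real) \<le> 1" for n
      by (rule AE_I2) (simp add: indicator_def)
  qed simp_all
  have "(\<integral>x. indicat_real {x \<in> space M. u n x < c} x \<partial>M)
      = (\<integral>x. indicat_real {x \<in> space N. v n x < c} x \<partial>N)" for n
    unfolding integral_indicator_Collect by (rule law)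
  then have "(\<integral>x. 0 \<partial>M :: real) = (\<integral>x. 1 \<partial>N)"
    by (intro LIMSEQ_unique[OF M_lim]) (simp only: N_lim)
  then show False by (simp add: N.prob_space)
qed

text \<open>Transposition reverses the order of the factors. Integer times spare the truncated
  subtraction in \<open>n - 1 - k\<close>; the induction removes the factor at time 0, leaving the
  same statement for the sequence shifted by one.\<close>

lemma mp_forward_transpose_reverse:
  fixes V :: "int \<Rightarrow> 'd::finite \<Rightarrow> 'd \<Rightarrow> ereal"
  assumes V: "\<And>k i j. V k i j \<noteq> \<infinity>" and "i \<in> I" "j \<in> I"
  shows "mp_forward I (\<lambda>k i j. V (int n - 1 - int k) j i) n j i = mp_forward I (\<lambda>k. V (int k)) n i j"
  using assms
proof (induction n arbitrary: V j)
  case 0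
  then show ?case by (simp add: mp_one_def)
next
  case (Suc n)
  interpret mp_sequence "\<lambda>k. V (int k)" by unfold_locales (rule Suc.prems(1))
  let ?G = "mp_forward I (\<lambda>k. V (int (k + 1)))"
  have "mp_forward I (\<lambda>k i j. V (int (Suc n) - 1 - int k) j i) (Suc n) j i
      = (SUP l\<in>I. V 0 l j + mp_forward I (\<lambda>k i j. V (int n - 1 - int k + 1) j i) n l i)"
    by (simp add: mp_mult_def)
  also have "\<dots> = (SUP l\<in>I. ?G n i l + V 0 l j)"
  proof (rule SUP_cong[OF refl])
    fix l assume "l \<in> I"
    then have "mp_forward I (\<lambda>k i j. V (int n - 1 - int k + 1) j i) n l i = mp_forward I (\<lambda>k. V (int k + 1)) n i l"
      using Suc.prems by (intro Suc.IH[of "\<lambda>k. V (k + 1)"]) auto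
    then show "V 0 l j + mp_forward I (\<lambda>k i j. V (int n - 1 - int k + 1) j i) n l i = ?G n i l + V 0 l j"
      by (simp add: ac_simps)
  qed
  also have "\<dots> = mp_forward I (\<lambda>k. V (int k)) (n + 1) i j"
  proof (rule antisym)
    have V0: "mp_forward I (\<lambda>k. V (int k)) 1 l j = V 0 l j" for l
    proof (rule antisym)
      show "mp_forward I (\<lambda>k. V (int k)) 1 l j \<le> V 0 l j"
        using Suc.prems(1) by (auto simp: mp_mult_def mp_one_def MInf_add intro!: SUP_least)
      show "V 0 l j \<le> mp_forward I (\<lambda>k. V (int k)) 1 l j"
        using mp_forward_Suc_ge[of j I "\<lambda>k. V (int k)" 0 l j] Suc.prems(3) by (simp add: mp_one_def)
    qed
    show "(SUP l\<in>I. ?G n i l + V 0 l j) \<le> mp_forward I (\<lambda>k. V (int k)) (n + 1) i j"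
    proof (rule SUP_least)
      fix l assume "l \<in> I"
      then show "?G n i l + V 0 l j \<le> mp_forward I (\<lambda>k. V (int k)) (n + 1) i j"
        using mp_forward_add_ge[of l I 1 n i j] unfolding V0 by blast
    qed
    obtain l where "l \<in> I" "mp_forward I (\<lambda>k. V (int k)) (n + 1) i j \<le> ?G n i l + mp_forward I (\<lambda>k. V (int k)) 1 l j"
      using mp_forward_add_le[OF Suc.prems(2), of n 1 j] by blast
    then show "mp_forward I (\<lambda>k. V (int k)) (n + 1) i j \<le> (SUP l\<in>I. ?G n i l + V 0 l j)"
      unfolding V0 by (intro SUP_upper2)
  qed
  finally show ?case by simp
qed

text \<open>New factors of \<open>mp_backward\<close> are attached on the right, hence on the left
  after transposition.\<close>

lemma mp_backward_eq_forward:
  "mp_backward I B n i j = mp_forward I (\<lambda>k i j. B (- int k - 1) j i) n j i"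
proof (induction n arbitrary: j)
  case (Suc n)
  have "- int (Suc n) = - int n - 1" by simp
  then show ?case using Suc by (simp only: mp_backward.simps mp_forward.simps mp_mult_def add.commute)
qed (simp add: mp_one_def)

text \<open>Path spaces contain the value \<open>\<infinity>\<close>, which the processes do not take; it is replaced
  by \<open>0\<close>.\<close>

definition cutoff :: "('d \<Rightarrow> 'd \<Rightarrow> ereal) \<Rightarrow> 'd \<Rightarrow> 'd \<Rightarrow> ereal" where
  "cutoff a i j = (if a i j = \<infinity> then 0 else a i j)"

definition max_pos_entry :: "('d::finite \<Rightarrow> 'd \<Rightarrow> ereal) \<Rightarrow> real" where
  "max_pos_entry a = real_of_ereal (SUP i. SUP j. max (cutoff a i j) 0)"

lemma cutoff_not_PInf: "cutoff a i j \<noteq> \<infinity>"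
  by (simp add: cutoff_def)

lemma cutoff_id: "(\<And>i j. a i j \<noteq> \<infinity>) \<Longrightarrow> cutoff a = a"
  by (auto simp: cutoff_def fun_eq_iff)

lemma measurable_cutoff [measurable]:
  "(\<lambda>a. cutoff a i j) \<in> borel_measurable (borel :: ('d::finite \<Rightarrow> 'd \<Rightarrow> ereal) measure)"
proof -
  have "(\<lambda>a :: 'd \<Rightarrow> 'd \<Rightarrow> ereal. a i) \<in> borel_measurable borel"
    "(\<lambda>f :: 'd \<Rightarrow> ereal. f j) \<in> borel_measurable borel"
    by (intro borel_measurable_continuous_onI continuous_on_product_coordinates)+
  from measurable_compose[OF this]
  have entry: "(\<lambda>a :: 'd \<Rightarrow> 'd \<Rightarrow> ereal. a i j) \<in> borel_measurable borel" .
  have "(\<lambda>t :: ereal. if t = \<infinity> then 0 else t) \<in> borel_measurable borel" by measurable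
  from measurable_compose[OF entry this] show ?thesis unfolding cutoff_def .
qed

lemma max_pos_entry_ereal: "ereal (max_pos_entry a) = (SUP i. SUP j. max (cutoff a i j) 0)"
proof -
  let ?s = "SUP i. SUP j. max (cutoff a i j) 0"
  obtain i where "?s = (SUP j. max (cutoff a i j) 0)"
    using finite_SUP_attained[of UNIV "\<lambda>i. SUP j. max (cutoff a i j) 0"] by auto
  moreover obtain j where "(SUP j. max (cutoff a i j) 0) = max (cutoff a i j) 0"
    using finite_SUP_attained[of UNIV "\<lambda>j. max (cutoff a i j) 0"] by auto
  ultimately have "?s = max (cutoff a i j) 0" by simp
  then have "?s \<noteq> \<infinity>" "?s \<noteq> -\<infinity>" using cutoff_not_PInf[of a i j] by (auto simp: max_def)
  then show ?thesis unfolding max_pos_entry_def by (intro ereal_real') auto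
qed

lemma cutoff_le_max_pos_entry: "max (cutoff a i j) 0 \<le> ereal (max_pos_entry a)"
  unfolding max_pos_entry_ereal by (intro SUP_upper2[of i] SUP_upper2[of j]) auto

lemma max_pos_entry_nonneg: "0 \<le> max_pos_entry a"
proof -
  have "0 \<le> ereal (max_pos_entry a)" by (rule order_trans[OF max.cobounded2 cutoff_le_max_pos_entry])
  then show ?thesis by simp
qed

lemma measurable_max_pos_entry [measurable]: "max_pos_entry \<in> borel_measurable borel"
  unfolding max_pos_entry_def[abs_def]
  by (intro borel_measurable_real_of_ereal borel_measurable_SUP countable_finite finite
      borel_measurable_max measurable_cutoff borel_measurable_const)

lemma measurable_entry_path:
  fixes n :: 'i and i j :: "'d::finite"
  shows "(\<lambda>x. cutoff (x n) i j) \<in> borel_measurable path_space"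
    and "(\<lambda>x. max_pos_entry (x n :: 'd \<Rightarrow> 'd \<Rightarrow> ereal)) \<in> borel_measurable path_space"
proof -
  have "(\<lambda>x. x n) \<in> path_space \<rightarrow>\<^sub>M (borel :: ('d \<Rightarrow> 'd \<Rightarrow> ereal) measure)"
    by (rule measurable_component_singleton) simp
  from measurable_compose[OF this measurable_cutoff] measurable_compose[OF this measurable_max_pos_entry]
  show "(\<lambda>x. cutoff (x n) i j) \<in> borel_measurable path_space"
    and "(\<lambda>x. max_pos_entry (x n :: 'd \<Rightarrow> 'd \<Rightarrow> ereal)) \<in> borel_measurable path_space" .
qed

lemma sets_entry:
  fixes i j :: "'d::finite"
  shows "{x. cutoff (x n) i j \<noteq> -\<infinity>} \<in> sets (path_space :: (nat \<Rightarrow> 'd \<Rightarrow> 'd \<Rightarrow> ereal) measure)"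
proof -
  have "{x \<in> space path_space. cutoff (x n) i j \<noteq> -\<infinity>} \<in> sets (path_space :: (nat \<Rightarrow> 'd \<Rightarrow> 'd \<Rightarrow> ereal) measure)"
    by (intro borel_measurable_neq borel_measurable_const measurable_entry_path)
  then show ?thesis by (simp add: space_path_space)
qed

text \<open>This matches the integrability hypothesis, whose supremum runs over the finite entries.
  Any finite entry already brings in the value 0 that the other entries contribute; without one, the
  supremum is \<open>-\<infinity>\<close>, which \<open>real_of_ereal\<close> sends to 0 as
  well.\<close>

lemma max_pos_entry_eq:
  fixes a :: "'d::finite \<Rightarrow> 'd \<Rightarrow> ereal"
  assumes "\<And>i j. a i j \<noteq> \<infinity>"
  shows "max_pos_entry a = real_of_ereal (SUP (i, j) \<in> {(i, j). a i j \<noteq> -\<infinity>}. max (a i j) 0)"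
proof (cases "\<exists>i j. a i j \<noteq> -\<infinity>")
  case True
  then obtain k l where kl: "a k l \<noteq> -\<infinity>" by blast
  have "(SUP (i, j) \<in> {(i, j). a i j \<noteq> -\<infinity>}. max (a i j) 0) = ereal (max_pos_entry a)"
  proof (rule antisym)
    show "(SUP (i, j) \<in> {(i, j). a i j \<noteq> -\<infinity>}. max (a i j) 0) \<le> ereal (max_pos_entry a)"
      using cutoff_le_max_pos_entry[of a] cutoff_id[of a] assms by (intro SUP_least) auto
    show "ereal (max_pos_entry a) \<le> (SUP (i, j) \<in> {(i, j). a i j \<noteq> -\<infinity>}. max (a i j) 0)"
      unfolding max_pos_entry_ereal cutoff_id[OF assms]
    proof (intro SUP_least)
      fix i j
      show "max (a i j) 0 \<le> (SUP (i, j) \<in> {(i, j). a i j \<noteq> -\<infinity>}. max (a i j) 0)"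
      proof (cases "a i j = -\<infinity>")
        case True
        then have "max (a i j) 0 \<le> (case (k, l) of (i, j) \<Rightarrow> max (a i j) 0)" by simp
        then show ?thesis using kl by (intro SUP_upper2[of "(k, l)"]) auto
      next
        case False
        then show ?thesis by (intro SUP_upper2[of "(i, j)"]) auto
      qed
    qed
  qed
  then show ?thesis by simp
next
  case False
  then have "cutoff a i j = -\<infinity>" for i j by (simp add: cutoff_def)
  then show ?thesis using False by (simp add: max_pos_entry_def bot_ereal_def)
qed

lemma mp_system_process:
  fixes X :: "nat \<Rightarrow> 'a \<Rightarrow> 'd::finite \<Rightarrow> 'd \<Rightarrow> ereal"
  assumes M: "prob_space M" and st: "stationary_process M X" and er: "ergodic_process M X"
    and int: "integrable M (\<lambda>\<omega>. max_pos_entry (X 0 \<omega>))"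
    and diag: "\<And>i. AE \<omega> in M. cutoff (X 0 \<omega>) i i \<noteq> -\<infinity>"
  shows "mp_system (process_law M X) (\<lambda>x n. x (n + 1)) (\<lambda>x. cutoff (x 0)) (\<lambda>x. max_pos_entry (x 0))"
proof -
  have X: "\<And>n. X n \<in> borel_measurable M" using st unfolding stationary_process_def by blast
  note path = measurable_path[of X, OF X]
  interpret ergodic_system "process_law M X" "\<lambda>x n. x (n + 1)"
    by (rule ergodic_system_process_law[OF M st er])
  show ?thesis
  proof
    fix x :: "nat \<Rightarrow> 'd \<Rightarrow> 'd \<Rightarrow> ereal" and i j
    show "(\<lambda>x. cutoff (x 0) i j) \<in> borel_measurable (process_law M X)"
      unfolding measurable_cong_sets[OF sets_process_law refl]
      by (rule measurable_entry_path)
    show "cutoff (x 0) i j \<noteq> \<infinity>" by (rule cutoff_not_PInf)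
    show "cutoff (x 0) i j \<le> ereal (max_pos_entry (x 0))"
      using cutoff_le_max_pos_entry[of "x 0" i j] by simp
    show "0 \<le> max_pos_entry (x 0)" by (rule max_pos_entry_nonneg)
    show "integrable (process_law M X) (\<lambda>x. max_pos_entry (x 0))"
      unfolding process_law_def
      by (subst integrable_distr_eq[OF path measurable_entry_path(2)]) (rule int)
    have "{x \<in> space path_space. cutoff (x 0) i i \<noteq> -\<infinity>} \<in> sets path_space"
      by (intro borel_measurable_neq borel_measurable_const measurable_entry_path)
    from AE_distr_iff[OF path this] diag
    show "AE x in process_law M X. cutoff (x 0) i i \<noteq> -\<infinity>"
      unfolding process_law_def by blast
  qed
qed

lemma (in mp_system) mp_system_transpose: "mp_system M T (\<lambda>x i j. A x j i) W"
  by unfold_locales (rule measurable_A A_not_PInf A_le W_nonneg integrable_W diagonal)+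

section \<open>Transfer between path space and the original probability space\<close>

lemma measure_process_law:
  assumes "\<And>n. X n \<in> borel_measurable M" and "{x. P x} \<in> sets path_space"
  shows "measure (process_law M X) {x. P x} = \<P>(\<omega> in M. P (\<lambda>n. X n \<omega>))"
  unfolding process_law_def
  by (subst measure_distr[OF measurable_path[of X, OF assms(1)] assms(2)]) (auto simp: vimage_def Int_def conj_commute)

lemma AE_process_law_iff:
  assumes "\<And>n. X n \<in> borel_measurable M" and "{x. P x} \<in> sets path_space"
  shows "(AE x in process_law M X. P x) \<longleftrightarrow> (AE \<omega> in M. P (\<lambda>n. X n \<omega>))"
  unfolding process_law_def
  by (rule AE_distr_iff[OF measurable_path[of X, OF assms(1)]]) (use assms(2) in \<open>simp add: space_path_space\<close>)

lemma AE_process_lawD: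
  assumes "\<And>n. X n \<in> borel_measurable M" and "AE x in process_law M X. P x"
  shows "AE \<omega> in M. P (\<lambda>n. X n \<omega>)"
  using assms(2) unfolding process_law_def by (rule AE_distrD[OF measurable_path[of X, OF assms(1)]])

lemma integrable_process_law_iff:
  fixes g :: "_ \<Rightarrow> real"
  assumes "\<And>n. X n \<in> borel_measurable M" and "g \<in> borel_measurable path_space"
  shows "integrable (process_law M X) g \<longleftrightarrow> integrable M (\<lambda>\<omega>. g (\<lambda>n. X n \<omega>))"
  unfolding process_law_def by (rule integrable_distr_eq[OF measurable_path[of X, OF assms(1)] assms(2)])

lemma reachable_mp_graph: "u \<rightarrow>\<^sup>*\<^bsub>mp_graph M A\<^esub> v \<longleftrightarrow> (\<lambda>i j. \<P>(\<omega> in M. A 0 \<omega> i j \<noteq> -\<infinity>) > 0)\<^sup>*\<^sup>* u v"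
  (is "_ \<longleftrightarrow> ?R\<^sup>*\<^sup>* u v")
proof
  have ends: "(i, j) \<in> arcs_ends (mp_graph M A) \<longleftrightarrow> ?R i j" for i j
    by (auto simp: arcs_ends_conv mp_graph_def)
  {
    assume "u \<rightarrow>\<^sup>*\<^bsub>mp_graph M A\<^esub> v"
    then have "(u, v) \<in> rtrancl_on (verts (mp_graph M A)) (arcs_ends (mp_graph M A))"
      by (simp add: reachable_def)
    then show "?R\<^sup>*\<^sup>* u v"
      by (induction rule: rtrancl_on_induct) (auto simp: ends intro: rtranclp.rtrancl_into_rtrancl)
  next
    assume "?R\<^sup>*\<^sup>* u v"
    then have "(u, v) \<in> rtrancl_on (verts (mp_graph M A)) (arcs_ends (mp_graph M A))"
    proof (induction rule: rtranclp_induct)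
      case (step y z)
      then show ?case
        by (intro rtrancl_on_into_rtrancl_on[OF step.IH]) (auto simp: ends, simp add: mp_graph_def)
    qed (simp add: mp_graph_def)
    then show "u \<rightarrow>\<^sup>*\<^bsub>mp_graph M A\<^esub> v" by (simp add: reachable_def)
  }
qed

section \<open>The one-sided process: graph, components and the limit of x\<close>

locale mp_process =
  fixes M :: "'a measure" and A :: "nat \<Rightarrow> 'a \<Rightarrow> 'd::finite \<Rightarrow> 'd \<Rightarrow> ereal"
  assumes prob_space_M: "prob_space M"
    and rmax: "rmax_valued M A"
    and stationary: "stationary_process M A"
    and ergodic: "ergodic_process M A"
    and integrable_pos: "integrable M (\<lambda>\<omega>. real_of_ereal
           (SUP (i, j) \<in> {(i, j). A 0 \<omega> i j \<noteq> -\<infinity>}. max (A 0 \<omega> i j) 0))"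
    and finite_diag: "\<P>(\<omega> in M. A 0 \<omega> i i = -\<infinity>) = 0"
begin

lemma measurable_process: "A n \<in> borel_measurable M"
  using stationary unfolding stationary_process_def by blast

lemma not_PInf: "\<omega> \<in> space M \<Longrightarrow> A n \<omega> i j \<noteq> \<infinity>"
  using rmax by (simp add: rmax_valued_def)

lemma cutoff_A: "\<omega> \<in> space M \<Longrightarrow> cutoff (A n \<omega>) = A n \<omega>"
  by (rule cutoff_id) (rule not_PInf)

lemma integrable_max_pos_entry: "integrable M (\<lambda>\<omega>. max_pos_entry (A 0 \<omega>))"
proof -
  have "integrable M (\<lambda>\<omega>. max_pos_entry (A 0 \<omega>)) \<longleftrightarrow> integrable M (\<lambda>\<omega>. real_of_ereal
           (SUP (i, j) \<in> {(i, j). A 0 \<omega> i j \<noteq> -\<infinity>}. max (A 0 \<omega> i j) 0))"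
    by (intro Bochner_Integration.integrable_cong refl max_pos_entry_eq not_PInf)
  with integrable_pos show ?thesis by blast
qed

lemma AE_diag: "AE \<omega> in M. cutoff (A 0 \<omega>) i i \<noteq> -\<infinity>"
proof -
  interpret prob_space M by (rule prob_space_M)
  have meas: "(\<lambda>\<omega>. cutoff (A 0 \<omega>) i i) \<in> borel_measurable M"
    by (rule measurable_compose[OF measurable_process measurable_cutoff])
  have "{\<omega> \<in> space M. cutoff (A 0 \<omega>) i i = -\<infinity>} = {\<omega> \<in> space M. A 0 \<omega> i i = -\<infinity>}"
    by (auto simp: cutoff_A)
  with finite_diag have "prob {\<omega> \<in> space M. cutoff (A 0 \<omega>) i i = -\<infinity>} = 0" by metis
  moreover have "{\<omega> \<in> space M. cutoff (A 0 \<omega>) i i = -\<infinity>} \<in> events"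
    by (intro borel_measurable_eq meas borel_measurable_const)
  ultimately have "AE \<omega> in M. \<omega> \<notin> {\<omega> \<in> space M. cutoff (A 0 \<omega>) i i = -\<infinity>}"
    using prob_eq_0 by blast
  then show ?thesis using AE_space by eventually_elim blast
qed

sublocale S: mp_system "process_law M A" "\<lambda>x n. x (n + 1)" "\<lambda>x. cutoff (x 0)" "\<lambda>x. max_pos_entry (x 0)"
  by (rule mp_system_process[OF prob_space_M stationary ergodic integrable_max_pos_entry AE_diag])

lemma Z_path: "S.Z x = (\<lambda>k. cutoff (x k))"
  unfolding S.Z_def[abs_def] funpow_shift by simp

lemma Z_process: "\<omega> \<in> space M \<Longrightarrow> S.Z (\<lambda>n. A n \<omega>) = (\<lambda>k. A k \<omega>)"
  unfolding Z_path by (simp add: cutoff_A)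

lemma edge_iff: "S.edge i j \<longleftrightarrow> 0 < \<P>(\<omega> in M. A 0 \<omega> i j \<noteq> -\<infinity>)"
proof -
  have "S.edge i j \<longleftrightarrow> 0 < \<P>(\<omega> in M. cutoff (A 0 \<omega>) i j \<noteq> -\<infinity>)"
    unfolding S.edge_def by (subst measure_process_law[OF measurable_process sets_entry]) (rule refl)
  also have "{\<omega> \<in> space M. cutoff (A 0 \<omega>) i j \<noteq> -\<infinity>} = {\<omega> \<in> space M. A 0 \<omega> i j \<noteq> -\<infinity>}"
    by (auto simp: cutoff_A)
  finally show ?thesis .
qed

lemma reachable_iff: "u \<rightarrow>\<^sup>*\<^bsub>mp_graph M A\<^esub> v \<longleftrightarrow> S.edge\<^sup>*\<^sup>* u v"
  unfolding reachable_mp_graph edge_iff[abs_def] ..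

lemma in_components_iff: "c \<in> components_of M A \<longleftrightarrow> c \<noteq> {} \<and> (\<forall>u\<in>c. \<forall>v\<in>c. S.edge\<^sup>*\<^sup>* u v) \<and>
    (\<forall>u\<in>c. \<forall>v. v \<notin> c \<longrightarrow> \<not> S.edge\<^sup>*\<^sup>* u v \<or> \<not> S.edge\<^sup>*\<^sup>* v u)"
  unfolding components_of_def pre_digraph.sccs_verts_def reachable_iff by simp

lemma component_eq_scc:
  assumes "c \<in> components_of M A" "i \<in> c"
  shows "c = S.scc i"
proof (intro set_eqI iffI)
  fix j assume "j \<in> c"
  then show "j \<in> S.scc i" using assms unfolding in_components_iff S.scc_def by simp
next
  fix j assume "j \<in> S.scc i"
  then show "j \<in> c" using assms unfolding in_components_iff S.scc_def mem_Collect_eq by metis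
qed

lemma scc_in_components: "S.scc i \<in> components_of M A"
  unfolding in_components_iff
proof (intro conjI ballI allI impI)
  show "S.scc i \<noteq> {}" by (rule S.scc_nonempty)
next
  fix u v assume "u \<in> S.scc i" "v \<in> S.scc i"
  then show "S.edge\<^sup>*\<^sup>* u v" unfolding S.scc_def using rtranclp_trans[of S.edge u i v] by simp
next
  fix u v assume "u \<in> S.scc i" "v \<notin> S.scc i"
  then show "\<not> S.edge\<^sup>*\<^sup>* u v \<or> \<not> S.edge\<^sup>*\<^sup>* v u"
    unfolding S.scc_def using rtranclp_trans[of S.edge i u v] rtranclp_trans[of S.edge v u i] by blast
qed

text \<open>Two almost sure limits agree at some point of a probability space, so the definite
  description denotes the value known to be a limit.\<close>

lemma max_lyapunov_eq:
  assumes "I \<noteq> {}"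
  shows "max_lyapunov M I A = S.exponent I"
proof -
  interpret prob_space M by (rule prob_space_M)
  let ?P = "\<lambda>\<gamma>. AE \<omega> in M. rmax_tendsto
    (\<lambda>n. ereal (1 / real n) * (SUP i\<in>I. SUP j\<in>I. mp_forward I (\<lambda>k. A k \<omega>) n i j)) \<gamma>"
  have lim: "?P (S.exponent I)"
    using AE_process_lawD[OF measurable_process S.mp_max_tendsto_exponent[OF assms]] AE_space
    by eventually_elim (simp only: Z_process mp_max_def)
  have unique: "\<gamma> = S.exponent I" if "?P \<gamma>" for \<gamma>
  proof -
    from that lim have "AE \<omega> in M. \<gamma> = S.exponent I"
      by eventually_elim (auto simp: rmax_tendsto_def intro: LIMSEQ_unique)
    then show ?thesis using eventually_happens'[OF ae_filter_bot] by blast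
  qed
  show ?thesis unfolding max_lyapunov_def by (rule the_equality[of ?P, OF lim unique])
qed

text \<open>Indexing by the nodes reachable from one representative lists a component once for each
  of its nodes, which a supremum does not see.\<close>

lemma component_exponent_eq:
  assumes c: "c \<in> components_of M A" "i \<in> c"
  shows "component_exponent M A c = (SUP j\<in>{j. S.edge\<^sup>*\<^sup>* i j}. S.exponent (S.scc j))"
proof -
  have ci: "c = S.scc i" by (rule component_eq_scc[OF c])
  have "{c' \<in> components_of M A. leads_to M A c c'} = S.scc ` {j. S.edge\<^sup>*\<^sup>* i j}"
  proof (intro set_eqI iffI)
    fix c' assume "c' \<in> {c' \<in> components_of M A. leads_to M A c c'}"
    then have c': "c' \<in> components_of M A" and "c = c' \<or> (\<exists>u\<in>c. \<exists>v\<in>c'. S.edge\<^sup>*\<^sup>* u v)"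
      by (auto simp: leads_to_def reachable_iff)
    then obtain v where v: "v \<in> c'" "S.edge\<^sup>*\<^sup>* i v"
    proof (elim disjE bexE)
      assume "c = c'"
      then show ?thesis using c(2) that[of i] by simp
    next
      fix u v assume "u \<in> c" "v \<in> c'" "S.edge\<^sup>*\<^sup>* u v"
      moreover from \<open>u \<in> c\<close> have "S.edge\<^sup>*\<^sup>* i u" by (simp add: ci S.scc_def)
      ultimately show ?thesis using that[of v] by (blast intro: rtranclp_trans)
    qed
    then show "c' \<in> S.scc ` {j. S.edge\<^sup>*\<^sup>* i j}" using component_eq_scc[OF c' v(1)] by blast
  next
    fix c' assume "c' \<in> S.scc ` {j. S.edge\<^sup>*\<^sup>* i j}"
    then obtain j where j: "S.edge\<^sup>*\<^sup>* i j" "c' = S.scc j" by blast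
    then show "c' \<in> {c' \<in> components_of M A. leads_to M A c c'}"
      using c(2) S.scc_nonempty(2)[of j] scc_in_components[of j]
      by (auto simp: leads_to_def reachable_iff)
  qed
  then show ?thesis
    unfolding component_exponent_def by (simp only: image_image max_lyapunov_eq[OF S.scc_nonempty(1)])
qed

lemma seq_x_limit:
  assumes diag: "integrable M (\<lambda>\<omega>. real_of_ereal (A 0 \<omega> i i))" and c: "c \<in> components_of M A" "i \<in> c"
  shows "AE \<omega> in M. rmax_tendsto (\<lambda>n. ereal (1 / real n) * seq_x (\<lambda>k. A k \<omega>) n i) (component_exponent M A c)"
proof -
  have "integrable M (\<lambda>\<omega>. real_of_ereal (cutoff (A 0 \<omega>) i i)) \<longleftrightarrow> integrable M (\<lambda>\<omega>. real_of_ereal (A 0 \<omega> i i))"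
    by (intro Bochner_Integration.integrable_cong) (simp_all add: cutoff_A)
  then have "integrable (process_law M A) (\<lambda>x. real_of_ereal (cutoff (x 0) i i))"
    using diag by (subst integrable_process_law_iff[OF measurable_process
          borel_measurable_real_of_ereal[OF measurable_entry_path(1)]]) blast
  from AE_process_lawD[OF measurable_process S.row_limit[OF this]] AE_space
  show ?thesis
    by eventually_elim (simp only: Z_process seq_x_def mp_apply_def component_exponent_eq[OF c] add_0_right)
qed

end

section \<open>The two-sided extension, its reversal and the limit of y\<close>

locale mp_process_extension = mp_process M A
  for M :: "'a measure" and A :: "nat \<Rightarrow> 'a \<Rightarrow> 'd::finite \<Rightarrow> 'd \<Rightarrow> ereal" +
  fixes N :: "'b measure" and B :: "int \<Rightarrow> 'b \<Rightarrow> 'd \<Rightarrow> 'd \<Rightarrow> ereal"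
  assumes extension: "stationary_extension M A N B"
begin

lemma prob_space_N: "prob_space N"
  and stationary_B: "stationary_process N B"
  and law_B: "process_law N (\<lambda>n::nat. B (int n)) = process_law M A"
  and B_not_PInf: "\<omega> \<in> space N \<Longrightarrow> B n \<omega> i j \<noteq> \<infinity>"
  using extension unfolding stationary_extension_def rmax_valued_def by blast+

lemma measurable_B: "B n \<in> borel_measurable N"
  using stationary_B unfolding stationary_process_def by blast

lemma law_B_shift: "process_law N (\<lambda>k::nat. B (int k + m)) = process_law M A"
proof -
  have "process_law N (\<lambda>k::nat. B (int k + m)) = process_law N (\<lambda>k::nat. B (int k))"
    by (rule process_law_reindex_eq[OF measurable_B measurable_B stationary_process_shift[OF stationary_B]])
  also note law_B
  finally show ?thesis .
qed

text \<open>The offset makes \<open>C 0\<close>, ..., \<open>C (n - 1)\<close> the factors at times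
  -1, ..., -n of y.\<close>

definition C :: "nat \<Rightarrow> 'b \<Rightarrow> 'd \<Rightarrow> 'd \<Rightarrow> ereal" where
  "C n = B (- int n - 1)"

lemma measurable_C: "C n \<in> borel_measurable N"
  unfolding C_def by (rule measurable_B)

lemma stationary_C: "stationary_process N C"
  unfolding C_def[abs_def] by (rule stationary_process_reverse[OF stationary_B])

text \<open>Ergodicity is a property of the law, so the nonnegative half of the extension inherits
  it from the given process.\<close>

lemma ergodic_C: "ergodic_process N C"
  unfolding C_def[abs_def]
proof (rule ergodic_process_reverse[OF prob_space_N stationary_B])
  show "ergodic_process N (\<lambda>n::nat. B (int n))"
    unfolding ergodic_process_def
  proof (intro ballI impI)
    fix E :: "(nat \<Rightarrow> 'd \<Rightarrow> 'd \<Rightarrow> ereal) set"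
    assume E: "E \<in> sets path_space" "(\<lambda>x n. x (n + 1)) -` E = E"
    have "{x. x \<in> E} \<in> sets path_space" using E(1) by simp
    from measure_process_law[of "\<lambda>n. B (int n)", OF measurable_B this]
      measure_process_law[of A, OF measurable_process this]
    have eq: "\<P>(\<omega> in N. (\<lambda>n. B (int n) \<omega>) \<in> E) = \<P>(\<omega> in M. (\<lambda>n. A n \<omega>) \<in> E)"
      unfolding law_B by metis
    show "\<P>(\<omega> in N. (\<lambda>n. B (int n) \<omega>) \<in> E) \<in> {0, 1}"
      unfolding eq by (rule ergodic[unfolded ergodic_process_def, rule_format, OF E])
  qed
qed

text \<open>Reindexing by a constant map expresses equality of one-dimensional marginals as equality
  of process laws, to which the transfer lemmas apply.\<close>

lemma marginal_law: "process_law N (\<lambda>_::nat. C 0) = process_law M (\<lambda>_::nat. A 0)"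
proof -
  have "process_law N (\<lambda>_::nat. B (int 0 + (- 1))) = process_law M (\<lambda>_::nat. A 0)"
    by (rule process_law_reindex_eq[OF measurable_B measurable_process law_B_shift])
  then show ?thesis unfolding C_def by simp
qed

lemma integrable_C: "integrable N (\<lambda>\<omega>. max_pos_entry (C 0 \<omega>))"
  using integrable_max_pos_entry
    integrable_process_law_iff[of "\<lambda>_::nat. C 0" N, OF measurable_C measurable_entry_path(2)[of 0]]
    integrable_process_law_iff[of "\<lambda>_::nat. A 0" M, OF measurable_process measurable_entry_path(2)[of 0]]
  unfolding marginal_law by blast

lemma diag_C: "AE \<omega> in N. cutoff (C 0 \<omega>) i i \<noteq> -\<infinity>"
  using AE_diag[of i]
    AE_process_law_iff[of "\<lambda>_::nat. C 0" N, OF measurable_C sets_entry[of 0 i i]]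
    AE_process_law_iff[of "\<lambda>_::nat. A 0" M, OF measurable_process sets_entry[of 0 i i]]
  unfolding marginal_law by blast

text \<open>Transposition turns \<open>A(-1) \<cdots> A(-n)\<close> into a forward product of the reversed process.\<close>

sublocale R: mp_system "process_law N C" "\<lambda>x n. x (n + 1)" "\<lambda>x i j. cutoff (x 0) j i" "\<lambda>x. max_pos_entry (x 0)"
  by (rule mp_system.mp_system_transpose)
    (rule mp_system_process[OF prob_space_N stationary_C ergodic_C integrable_C diag_C])

lemma R_Z_path: "R.Z x = (\<lambda>k i j. cutoff (x k) j i)"
  unfolding R.Z_def[abs_def] funpow_shift by simp

lemma R_edge_iff: "R.edge i j \<longleftrightarrow> S.edge j i"
proof -
  have "measure (process_law N C) {x. cutoff (x 0) j i \<noteq> -\<infinity>} = measure (process_law M A) {x. cutoff (x 0) j i \<noteq> -\<infinity>}"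
    using measure_process_law[of C N, OF measurable_C sets_entry[of 0 j i]]
      measure_process_law[of A M, OF measurable_process sets_entry[of 0 j i]]
      measure_process_law[of "\<lambda>_::nat. C 0" N, OF measurable_C sets_entry[of 0 j i]]
      measure_process_law[of "\<lambda>_::nat. A 0" M, OF measurable_process sets_entry[of 0 j i]]
    unfolding marginal_law by metis
  then show ?thesis unfolding R.edge_def S.edge_def by metis
qed

lemma R_reach_iff: "R.edge\<^sup>*\<^sup>* i j \<longleftrightarrow> S.edge\<^sup>*\<^sup>* j i"
proof -
  have "R.edge = S.edge\<inverse>\<inverse>" by (intro ext) (simp add: R_edge_iff)
  then show ?thesis by (simp add: rtranclp_conversep)
qed

lemma R_scc: "R.scc i = S.scc i"
  unfolding R.scc_def S.scc_def R_reach_iff by blast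

text \<open>The largest entry ignores transposition, so the reversed product is as large as the
  forward product over the times from -n to -1. That window moves with \<open>n\<close>, hence the
  comparison of exponents in law.\<close>

lemma R_mp_max: "mp_max I (R.Z (\<lambda>k. C k \<omega>)) n = mp_max I (S.Z (\<lambda>k. B (int k + - int n) \<omega>)) n"
proof -
  have "mp_forward I (R.Z (\<lambda>k. C k \<omega>)) n j i = mp_forward I (S.Z (\<lambda>k. B (int k + - int n) \<omega>)) n i j"
    if "i \<in> I" "j \<in> I" for i j
  proof -
    have "- int k - 1 = int n - 1 - int k + - int n" for k by simp
    then have "R.Z (\<lambda>k. C k \<omega>) = (\<lambda>k i j. cutoff (B (int n - 1 - int k + - int n) \<omega>) j i)"
      unfolding R_Z_path C_def by presburger
    moreover have "mp_forward I (\<lambda>k i j. cutoff (B (int n - 1 - int k + - int n) \<omega>) j i) n j i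
        = mp_forward I (\<lambda>k. cutoff (B (int k + - int n) \<omega>)) n i j"
      by (rule mp_forward_transpose_reverse[OF cutoff_not_PInf that])
    ultimately show ?thesis unfolding Z_path by simp
  qed
  then show ?thesis
    unfolding mp_max_def by (subst SUP_commute) (intro SUP_cong refl)
qed

text \<open>By stationarity the moving window has the law of the first \<open>n\<close> matrices of
  the given process, so the normalized maxima have equal laws for each \<open>n\<close>, and two
  constant almost sure limits must then coincide.\<close>

lemma R_exponent:
  assumes I: "I \<noteq> {}"
  shows "R.exponent I = S.exponent I"
proof -
  let ?u = "\<lambda>n x. ereal (1 / real n) * mp_max I (R.Z x) n"
  let ?v = "\<lambda>n x. ereal (1 / real n) * mp_max I (S.Z x) n"
  have um: "?u n \<in> borel_measurable (process_law N C)" for n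
    by (intro borel_measurable_ereal_times borel_measurable_const R.measurable_mp_max_Z)
  have vm: "?v n \<in> borel_measurable (process_law M A)" for n
    by (intro borel_measurable_ereal_times borel_measurable_const S.measurable_mp_max_Z)
  have law: "\<P>(x in process_law N C. ?u n x < c) = \<P>(x in process_law M A. ?v n x < c)" for n c
  proof -
    have su: "{x. ?u n x < c} \<in> sets path_space"
      using borel_measurable_less[OF um borel_measurable_const, of n c]
      by (simp add: space_process_law sets_process_law)
    have sv: "{x. ?v n x < c} \<in> sets path_space"
      using borel_measurable_less[OF vm borel_measurable_const, of n c]
      by (simp add: space_process_law sets_process_law)
    have "measure (process_law N C) {x. ?u n x < c} = \<P>(\<omega> in N. ?u n (\<lambda>k. C k \<omega>) < c)"
      by (rule measure_process_law[OF measurable_C su])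
    also have "\<dots> = \<P>(\<omega> in N. ?v n (\<lambda>k. B (int k + - int n) \<omega>) < c)"
      unfolding R_mp_max ..
    also have "\<dots> = measure (process_law N (\<lambda>k. B (int k + - int n))) {x. ?v n x < c}"
      by (rule measure_process_law[OF measurable_B sv, symmetric])
    also have "\<dots> = measure (process_law M A) {x. ?v n x < c}"
      unfolding law_B_shift ..
    finally show ?thesis by (simp add: space_process_law)
  qed
  have ul: "AE x in process_law N C. (\<lambda>n. ?u n x) \<longlonglongrightarrow> R.exponent I"
    using R.mp_max_tendsto_exponent[OF I] unfolding rmax_tendsto_def by eventually_elim blast
  have vl: "AE x in process_law M A. (\<lambda>n. ?v n x) \<longlonglongrightarrow> S.exponent I"
    using S.mp_max_tendsto_exponent[OF I] unfolding rmax_tendsto_def by eventually_elim blast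
  show ?thesis
    by (rule antisym)
      (rule AE_limit_le_of_equal_laws[OF R.prob_space_axioms S.prob_space_axioms um vm law ul vl],
       rule AE_limit_le_of_equal_laws[OF S.prob_space_axioms R.prob_space_axioms vm um law[symmetric] vl ul])
qed

text \<open>Row \<open>i\<close> of the backward product is column \<open>i\<close> of the
  transposed system, and its predecessors there are the successors in the original graph.\<close>

lemma seq_y_limit:
  assumes c: "c \<in> components_of M A" "i \<in> c"
  shows "AE \<omega> in N. rmax_tendsto (\<lambda>n. ereal (1 / real n) * seq_y (\<lambda>k. B k \<omega>) n i) (component_exponent M A c)"
proof -
  have limit: "(SUP j\<in>{j. R.edge\<^sup>*\<^sup>* j i}. R.exponent (R.scc j)) = component_exponent M A c"
    unfolding component_exponent_eq[OF c] R_reach_iff R_scc R_exponent[OF S.scc_nonempty(1)] ..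
  from AE_process_lawD[OF measurable_C R.column_limit[of i]] AE_space
  show ?thesis
  proof eventually_elim
    case (elim \<omega>)
    have "R.Z (\<lambda>k. C k \<omega>) = (\<lambda>k i j. B (- int k - 1) \<omega> j i)"
      unfolding R_Z_path C_def using cutoff_id[of "B _ \<omega>"] B_not_PInf[OF elim(2)] by simp
    then have "(SUP j. mp_forward UNIV (R.Z (\<lambda>k. C k \<omega>)) n j i) = seq_y (\<lambda>k. B k \<omega>) n i" for n
      by (simp only: seq_y_def mp_apply_def mp_backward_eq_forward add_0_right)
    with elim(1) show ?case unfolding limit by (simp only:)
  qed
qed

end

theorem theorem2p7:
  fixes M :: "'a measure" and A :: "nat \<Rightarrow> 'a \<Rightarrow> 'd::finite \<Rightarrow> 'd \<Rightarrow> ereal"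
  assumes "prob_space M"
    and "rmax_valued M A"
    and "stationary_process M A"
    and "ergodic_process M A"
    and "integrable M (\<lambda>\<omega>. real_of_ereal
           (SUP (i, j) \<in> {(i, j). A 0 \<omega> i j \<noteq> -\<infinity>}. max (A 0 \<omega> i j) 0))"
    and "\<forall>i. \<P>(\<omega> in M. A 0 \<omega> i i = -\<infinity>) = 0"
  shows "(\<forall>(N :: 'b measure) B. stationary_extension M A N B \<longrightarrow>
            (\<forall>c \<in> components_of M A. AE \<omega> in N. \<forall>i\<in>c.
               rmax_tendsto (\<lambda>n. ereal (1 / real n) * seq_y (\<lambda>k. B k \<omega>) n i)
                 (component_exponent M A c)))
       \<and> ((\<forall>i. integrable M (\<lambda>\<omega>. real_of_ereal (A 0 \<omega> i i))) \<longrightarrow>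
            (AE \<omega> in M. \<exists>l. \<forall>i.
               rmax_tendsto (\<lambda>n. ereal (1 / real n) * seq_x (\<lambda>k. A k \<omega>) n i) (l i))
          \<and> (\<forall>c \<in> components_of M A. AE \<omega> in M. \<forall>i\<in>c.
               rmax_tendsto (\<lambda>n. ereal (1 / real n) * seq_x (\<lambda>k. A k \<omega>) n i)
                 (component_exponent M A c)))"
proof -
  interpret mp_process M A
    by (rule mp_process.intro) (rule assms(1-5) assms(6)[rule_format])+
  show ?thesis
  proof (intro conjI allI impI ballI)
    fix N :: "'b measure" and B c
    assume ext: "stationary_extension M A N B" and c: "c \<in> components_of M A"
    interpret mp_process_extension M A N B
      by (intro mp_process_extension.intro mp_process_extension_axioms.intro mp_process_axioms ext)
    show "AE \<omega> in N. \<forall>i\<in>c. rmax_tendsto (\<lambda>n. ereal (1 / real n) * seq_y (\<lambda>k. B k \<omega>) n i)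
        (component_exponent M A c)"
      by (rule AE_finite_allI[OF finite seq_y_limit[OF c]])
  next
    assume diag: "\<forall>i. integrable M (\<lambda>\<omega>. real_of_ereal (A 0 \<omega> i i))"
    have "AE \<omega> in M. \<forall>i\<in>UNIV. rmax_tendsto (\<lambda>n. ereal (1 / real n) * seq_x (\<lambda>k. A k \<omega>) n i)
        (component_exponent M A (S.scc i))"
      by (rule AE_finite_allI[OF finite seq_x_limit[OF diag[rule_format] scc_in_components S.scc_nonempty(2)]])
    then show "AE \<omega> in M. \<exists>l. \<forall>i. rmax_tendsto (\<lambda>n. ereal (1 / real n) * seq_x (\<lambda>k. A k \<omega>) n i) (l i)"
      by eventually_elim (rule exI[of _ "\<lambda>i. component_exponent M A (S.scc i)"], blast)
    fix c assume c: "c \<in> components_of M A"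
    show "AE \<omega> in M. \<forall>i\<in>c. rmax_tendsto (\<lambda>n. ereal (1 / real n) * seq_x (\<lambda>k. A k \<omega>) n i)
        (component_exponent M A c)"
      by (rule AE_finite_allI[OF finite seq_x_limit[OF diag[rule_format] c]])
  qed
qed

end
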